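(* There is an algorithm which, given a line graph $G$ on $n$ vertices and a positive integer $k$, decides whether $G$ has an acyclic matching of size $k$ in time $2^{O(k)}\cdot n^{O(1)}$.
   Context: All graphs are finite and simple. A graph $G$ is a line graph if $G=L(H)$ for some graph $H$, where $L(H)$ has the edges of $H$ as vertices, two adjacent iff they share an endpoint in $H$. A matching $M$ (set of pairwise nonadjacent edges) is acyclic if the subgraph of $G$ induced on the endpoints of the edges of $M$ is acyclic. *)

theory Defs
  imports Main
begin

section \<open>Graphs\<close>

record 'a ugraph =
  verts :: "'a set"
  edges :: "'a set set"

definition simple_graph :: "'a ugraph \<Rightarrow> bool" where
  "simple_graph G \<longleftrightarrow> finite (verts G) \<and> (\<forall>e\<in>edges G. e \<subseteq> verts G \<and> card e = 2)"

definition isomorphic :: "'a ugraph \<Rightarrow> 'b ugraph \<Rightarrow> bool" where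
  "isomorphic G H \<longleftrightarrow>
     (\<exists>\<phi>. bij_betw \<phi> (verts G) (verts H) \<and>
          (\<forall>u\<in>verts G. \<forall>v\<in>verts G. {u, v} \<in> edges G \<longleftrightarrow> {\<phi> u, \<phi> v} \<in> edges H))"

definition line_graph :: "'a ugraph \<Rightarrow> 'a set ugraph" where
  "line_graph H =
     \<lparr>verts = edges H,
      edges = {{e, f} | e f. e \<in> edges H \<and> f \<in> edges H \<and> e \<noteq> f \<and> e \<inter> f \<noteq> {}}\<rparr>"

text \<open>
  Being a line graph is a property up to isomorphism. Every finite graph is isomorphic to one with
  vertices in \<^typ>\<open>nat\<close>, so fixing the vertex type of the root graph \<open>H\<close> loses nothing.
\<close>

definition is_line_graph :: "'a ugraph \<Rightarrow> bool" where
  "is_line_graph G \<longleftrightarrow> (\<exists>H :: nat ugraph. simple_graph H \<and> isomorphic G (line_graph H))"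

definition induced_subgraph :: "'a ugraph \<Rightarrow> 'a set \<Rightarrow> 'a ugraph" where
  "induced_subgraph G S = \<lparr>verts = verts G \<inter> S, edges = {e \<in> edges G. e \<subseteq> S}\<rparr>"

definition is_cycle :: "'a ugraph \<Rightarrow> 'a list \<Rightarrow> bool" where
  "is_cycle G vs \<longleftrightarrow>
     3 \<le> length vs \<and> distinct vs \<and> set vs \<subseteq> verts G \<and>
     (\<forall>i<length vs. {vs ! i, vs ! (Suc i mod length vs)} \<in> edges G)"

definition acyclic_graph :: "'a ugraph \<Rightarrow> bool" where
  "acyclic_graph G \<longleftrightarrow> \<not> (\<exists>vs. is_cycle G vs)"

definition matching :: "'a ugraph \<Rightarrow> 'a set set \<Rightarrow> bool" where
  "matching G M \<longleftrightarrow> M \<subseteq> edges G \<and> (\<forall>e\<in>M. \<forall>f\<in>M. e \<noteq> f \<longrightarrow> e \<inter> f = {})"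

definition acyclic_matching :: "'a ugraph \<Rightarrow> 'a set set \<Rightarrow> bool" where
  "acyclic_matching G M \<longleftrightarrow> matching G M \<and> acyclic_graph (induced_subgraph G (\<Union>M))"


section \<open>Random access machine\<close>

text \<open>
  Algorithms are while-programs for a deterministic random access machine with registers and an
  indirectly addressed memory, both holding natural numbers. Every primitive operation and every
  test costs one step. The only arithmetic is addition and truncated subtraction, so a step
  lengthens the largest stored number by at most one bit (up to a constant depending on the program)
  and the unit-cost measure is polynomially related to Turing machine time; with unit-cost
  multiplication it would not be.
\<close>

datatype prog =
    Const nat nat        \<comment> \<open>\<open>Const r c\<close>: \<open>R[r] := c\<close>\<close>
  | Add nat nat nat      \<comment> \<open>\<open>Add r a b\<close>: \<open>R[r] := R[a] + R[b]\<close>\<close>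
  | Sub nat nat nat      \<comment> \<open>\<open>Sub r a b\<close>: \<open>R[r] := R[a] - R[b]\<close>\<close>
  | Load nat nat         \<comment> \<open>\<open>Load r a\<close>: \<open>R[r] := M[R[a]]\<close>\<close>
  | Store nat nat        \<comment> \<open>\<open>Store a b\<close>: \<open>M[R[a]] := R[b]\<close>\<close>
  | Seq prog prog
  | Cond nat prog prog   \<comment> \<open>tests \<open>R[r] \<noteq> 0\<close>\<close>
  | While nat prog       \<comment> \<open>tests \<open>R[r] \<noteq> 0\<close>\<close>

type_synonym state = "(nat \<Rightarrow> nat) \<times> (nat \<Rightarrow> nat)"

text \<open>\<open>exec P s t s'\<close>: started in \<open>s\<close>, the program \<open>P\<close> halts in \<open>s'\<close> after exactly \<open>t\<close> steps.\<close>

inductive exec :: "prog \<Rightarrow> state \<Rightarrow> nat \<Rightarrow> state \<Rightarrow> bool" where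
  Const: "exec (Const r c) (R, M) 1 (R(r := c), M)"
| Add: "exec (Add r a b) (R, M) 1 (R(r := R a + R b), M)"
| Sub: "exec (Sub r a b) (R, M) 1 (R(r := R a - R b), M)"
| Load: "exec (Load r a) (R, M) 1 (R(r := M (R a)), M)"
| Store: "exec (Store a b) (R, M) 1 (R, M(R a := R b))"
| Seq: "exec P s t s' \<Longrightarrow> exec Q s' u s'' \<Longrightarrow> exec (Seq P Q) s (t + u) s''"
| Cond_True: "fst s r \<noteq> 0 \<Longrightarrow> exec P s t s' \<Longrightarrow> exec (Cond r P Q) s (1 + t) s'"
| Cond_False: "fst s r = 0 \<Longrightarrow> exec Q s t s' \<Longrightarrow> exec (Cond r P Q) s (1 + t) s'"
| While_False: "fst s r = 0 \<Longrightarrow> exec (While r P) s 1 s"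
| While_True: "fst s r \<noteq> 0 \<Longrightarrow> exec P s t s' \<Longrightarrow> exec (While r P) s' u s'' \<Longrightarrow>
    exec (While r P) s (1 + t + u) s''"

inductive_cases exec_elims:
  "exec (Const r c) s t s'"
  "exec (Add r a b) s t s'"
  "exec (Sub r a b) s t s'"
  "exec (Load r a) s t s'"
  "exec (Store a b) s t s'"
  "exec (Seq P Q) s t s'"
  "exec (Cond r P Q) s t s'"
  "exec (While r P) s t s'"

lemma exec_deterministic:
  "exec P s t s' \<Longrightarrow> exec P s u s'' \<Longrightarrow> u = t \<and> s'' = s'"
proof (induction arbitrary: u s'' rule: exec.induct)
  case (Seq P s t s' Q u' s2)
  from Seq.prems obtain t1 s1 u1
    where *: "exec P s t1 s1" "exec Q s1 u1 s''" "u = t1 + u1"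
    by (rule exec_elims(6))
  from Seq.IH(1)[OF *(1)] have "t1 = t" "s1 = s'" by simp_all
  with Seq.IH(2)[of u1 s''] * show ?case by simp
next
  case (Cond_True s r P t s' Q)
  with Cond_True.hyps(1) obtain u1 where *: "u = Suc u1" "exec P s u1 s''"
    by (auto elim: exec_elims(7))
  from Cond_True.IH[OF *(2)] *(1) show ?case by simp
next
  case (Cond_False s r Q t s' P)
  with Cond_False.hyps(1) obtain u1 where *: "u = Suc u1" "exec Q s u1 s''"
    by (auto elim: exec_elims(7))
  from Cond_False.IH[OF *(2)] *(1) show ?case by simp
next
  case (While_False s r P)
  show ?case by (rule exec_elims(8)[OF While_False.prems]) (use While_False in auto)
next
  case (While_True s r P t s' u' s2)
  from While_True.prems show ?case
  proof (rule exec_elims(8))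
    fix t1 s1 u1
    assume *: "u = Suc (t1 + u1)" "exec P s t1 s1" "exec (While r P) s1 u1 s''"
    from While_True.IH(1)[OF *(2)] have "t1 = t" "s1 = s'" by simp_all
    with While_True.IH(2)[of u1 s''] * show ?thesis by simp
  qed (use While_True.hyps in simp)
qed (erule exec_elims; simp)+

text \<open>
  An instance \<open>(G, k)\<close> with vertex set \<open>{..<n}\<close> is given as \<open>R[0] = n\<close>, \<open>R[1] = k\<close> and the adjacency
  matrix of \<open>G\<close>, row by row, in memory cells \<open>0, \<dots>, n\<^sup>2 - 1\<close>; everything else is initially \<open>0\<close>.
\<close>

definition input_state :: "nat ugraph \<Rightarrow> nat \<Rightarrow> state" where
  "input_state G k =
     (let n = card (verts G) in
       ((\<lambda>_. 0)(0 := n, 1 := k),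
        (\<lambda>a. if a < n * n \<and> {a div n, a mod n} \<in> edges G then 1 else 0)))"

definition answers_within :: "prog \<Rightarrow> nat ugraph \<Rightarrow> nat \<Rightarrow> bool \<Rightarrow> nat \<Rightarrow> bool" where
  "answers_within P G k b T \<longleftrightarrow>
     (\<exists>t s. exec P (input_state G k) t s \<and> t \<le> T \<and> fst s 0 = (if b then 1 else 0))"

end

theory Submission
  imports Defs "HOL-Library.Nat_Bijection"
begin

text \<open>
  Let \<open>G = L(H)\<close>. A set of edges of \<open>H\<close> induces an acyclic subgraph of \<open>G\<close> iff it is a linear forest, so
  \<open>G\<close> has an acyclic matching of size \<open>k\<close> iff \<open>H\<close> contains a linear forest with \<open>2 k\<close> edges all of whose
  components have even length; it then has at most \<open>3 k\<close> vertices.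

  A root graph is found by linear algebra over GF(2). The unknown \<open>x u v\<close> says at which of its two ends
  the edge \<open>u\<close> of \<open>H\<close> meets the edge \<open>v\<close>. Two non-adjacent neighbours of \<open>u\<close> meet it at different ends,
  and in a triangle \<open>u, v, w\<close> of \<open>G\<close> the values \<open>x u v + x u w\<close> and \<open>x v u + x v w\<close> agree, as both tell
  whether the three edges form a star. Conversely every solution of these linear equations describes a
  root graph.

  The forest is found by colour coding: if its vertices have distinct colours, a Held-Karp style dynamic
  program over colour sets finds it by walking along the components one after the other, jumping to a
  new component only after an even number of edges. Colourings are produced from a multiplier \<open>a\<close> and a
  bit string of length \<open>O(k)\<close>. The multiplier maps a vertex \<open>x\<close> to \<open>a x mod W\<close>, and the bit string prescribes
  which colour classes are split according to the next binary digit of \<open>(a x mod W) / W\<close>. On average over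
  \<open>a\<close> the binary trie of the images of \<open>s\<close> vertices has only \<open>O(s)\<close> inner nodes, so for some \<open>a\<close> linearly
  many splits separate them all.

  The algorithm is written in a small language of bounded loops whose bounds are clamped by
  \<open>L = (2\<^sup>k (n + 1))\<^sup>p\<close>; its programs compile to random access machine programs of running time
  polynomial in \<open>L\<close>.
\<close>

section \<open>A language of bounded loops and its compilation\<close>

text \<open>The root graph that the equations produce need not be the given \<open>H\<close>: a
  triangle of \<open>G\<close> may come from a star or from a triangle. This is harmless, since the
  correspondence with linear forests holds for every graph whose line graph is \<open>G\<close>. The
  advice string names no vertices. It only says which nodes of the trie are split, in breadth-first
  order, one bit per colour class. A node with two or more vertices counts even if all of them go to
  the same side, so long common prefixes are expensive; the multiplier is there to make them rare.
  The machine has neither multiplication nor division, so predicates such as "bit \<open>t\<close>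
  of \<open>c\<close>" are bounded searches. This is affordable: \<open>L\<close> itself is
  \<open>2^(O(k)) * n^(O(1))\<close>, so any running time polynomial in \<open>L\<close> will do.
  Because of the clamp, the time bound follows from the syntax of the program alone; the size of
  \<open>L\<close> matters only for correctness, where no loop may be cut short.\<close>

definition within :: "prog \<Rightarrow> nat \<Rightarrow> (state \<Rightarrow> bool) \<Rightarrow> state \<Rightarrow> bool" where
  "within P T Q s \<longleftrightarrow> (\<exists>t s'. exec P s t s' \<and> t \<le> T \<and> Q s')"

lemma within_Const: "Q (R(r := c), M) \<Longrightarrow> within (Const r c) 1 Q (R, M)"
  unfolding within_def using exec.Const by blast

lemma within_Add: "Q (R(r := R a + R b), M) \<Longrightarrow> within (Add r a b) 1 Q (R, M)"
  unfolding within_def using exec.Add by blast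

lemma within_Sub: "Q (R(r := R a - R b), M) \<Longrightarrow> within (Sub r a b) 1 Q (R, M)"
  unfolding within_def using exec.Sub by blast

lemma within_Load: "Q (R(r := M (R a)), M) \<Longrightarrow> within (Load r a) 1 Q (R, M)"
  unfolding within_def using exec.Load by blast

lemma within_Store: "Q (R, M(R a := R b)) \<Longrightarrow> within (Store a b) 1 Q (R, M)"
  unfolding within_def using exec.Store by blast

lemma within_Seq: "within P T (within P' T' Q) s \<Longrightarrow> within (Seq P P') (T + T') Q s"
  unfolding within_def using exec.Seq add_mono by meson

lemma within_Cond:
  assumes "R r \<noteq> 0 \<Longrightarrow> within P T Q (R, M)" "R r = 0 \<Longrightarrow> within P' T Q (R, M)"
  shows "within (Cond r P P') (1 + T) Q (R, M)"
proof (cases "R r = 0")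
  case True
  with assms(2) obtain t s' where "exec P' (R, M) t s'" "t \<le> T" "Q s'"
    unfolding within_def by blast
  with True show ?thesis
    unfolding within_def using exec.Cond_False[of "(R, M)" r P' t s' P] by fastforce
next
  case False
  with assms(1) obtain t s' where "exec P (R, M) t s'" "t \<le> T" "Q s'"
    unfolding within_def by blast
  with False show ?thesis
    unfolding within_def using exec.Cond_True[of "(R, M)" r P t s' P'] by fastforce
qed

lemma within_mono:
  "within P T Q s \<Longrightarrow> T \<le> T' \<Longrightarrow> (\<And>s'. Q s' \<Longrightarrow> Q' s') \<Longrightarrow> within P T' Q' s"
  unfolding within_def by (meson order_trans)

text \<open>\<open>J i\<close> is the invariant after \<open>i\<close> rounds. Register
  \<open>r\<close> counts down from \<open>b\<close>, so the number of rounds is known beforehand;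
  each round pays one step for its test, and the final 1 is the failing test.\<close>

lemma within_While_aux:
  assumes body: "\<And>i s. i < b \<Longrightarrow> J i s \<Longrightarrow> within P T (J (Suc i)) s"
    and cnt: "\<And>i s. i \<le> b \<Longrightarrow> J i s \<Longrightarrow> fst s r = b - i"
    and "i \<le> b" "J i s"
  shows "within (While r P) ((b - i) * (T + 1) + 1) (J b) s"
  using assms(3,4)
proof (induction "b - i" arbitrary: i s)
  case 0
  then have "fst s r = 0" "i = b" using cnt[of i s] by auto
  with 0 show ?case
    unfolding within_def by (intro exI[of _ 1] exI[of _ s]) (simp del: One_nat_def add: exec.While_False)
next
  case (Suc j)
  then have lt: "i < b" and nz: "fst s r \<noteq> 0" using cnt[of i s] by auto
  from body[OF lt Suc.prems(2)] obtain t s'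
    where s': "exec P s t s'" "t \<le> T" "J (Suc i) s'" unfolding within_def by blast
  have "within (While r P) ((b - Suc i) * (T + 1) + 1) (J b) s'"
    by (rule Suc.hyps(1)) (use Suc.hyps(2) lt s' in auto)
  then obtain u s'' where s'': "exec (While r P) s' u s''"
      "u \<le> (b - Suc i) * (T + 1) + 1" "J b s''" unfolding within_def by blast
  have "b - i = Suc (b - Suc i)" using lt by simp
  then have "1 + t + u \<le> (b - i) * (T + 1) + 1" using s'(2) s''(2) by simp
  then show ?case unfolding within_def
    using exec.While_True[OF nz s'(1) s''(1)] s''(3) by blast
qed

lemma within_While:
  assumes "\<And>i s. i < b \<Longrightarrow> J i s \<Longrightarrow> within P T (J (Suc i)) s"
    and "\<And>i s. i \<le> b \<Longrightarrow> J i s \<Longrightarrow> fst s r = b - i"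
    and "J 0 s" and "b \<le> B" and "\<And>s'. J b s' \<Longrightarrow> Q s'"
  shows "within (While r P) (B * (T + 1) + 1) Q s"
proof -
  have "within (While r P) ((b - 0) * (T + 1) + 1) (J b) s"
    by (rule within_While_aux) (use assms in auto)
  then show ?thesis
    by (rule within_mono) (use assms(4,5) in \<open>auto intro: add_mono mult_le_mono1\<close>)
qed

section \<open>Bounded loops: syntax, semantics and compilation\<close>

datatype aexp =
    Num nat
  | Var nat
  | Inp aexp
  | Arr nat aexp
  | Plus aexp aexp
  | Minus aexp aexp
  | Sum nat aexp aexp

datatype com =
    Put nat aexp aexp
  | Then com com  (infixr \<open>;;\<close> 60)
  | For nat aexp com

type_synonym env = "nat \<Rightarrow> nat"
type_synonym store = "nat \<Rightarrow> nat \<Rightarrow> nat"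

text \<open>The bound of every \<open>Sum\<close> is cut at \<open>L\<close>. Evaluation is
  therefore total with a running time that depends only on the syntax and on \<open>L\<close>; later
  proofs owe, for each loop, that its bound is at most \<open>L\<close>.\<close>

fun eval :: "nat \<Rightarrow> (nat \<Rightarrow> nat) \<Rightarrow> store \<Rightarrow> env \<Rightarrow> aexp \<Rightarrow> nat" where
  "eval L inp \<sigma> \<rho> (Num c) = c"
| "eval L inp \<sigma> \<rho> (Var x) = \<rho> x"
| "eval L inp \<sigma> \<rho> (Inp e) = inp (eval L inp \<sigma> \<rho> e)"
| "eval L inp \<sigma> \<rho> (Arr j e) = \<sigma> j (eval L inp \<sigma> \<rho> e)"
| "eval L inp \<sigma> \<rho> (Plus e f) = eval L inp \<sigma> \<rho> e + eval L inp \<sigma> \<rho> f"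
| "eval L inp \<sigma> \<rho> (Minus e f) = eval L inp \<sigma> \<rho> e - eval L inp \<sigma> \<rho> f"
| "eval L inp \<sigma> \<rho> (Sum x e f) =
     (\<Sum>i<min (eval L inp \<sigma> \<rho> e) L. eval L inp \<sigma> (\<rho>(x := i)) f)"

fun run :: "nat \<Rightarrow> (nat \<Rightarrow> nat) \<Rightarrow> env \<Rightarrow> com \<Rightarrow> store \<Rightarrow> store" where
  "run L inp \<rho> (Put j e f) \<sigma> = \<sigma>(j := (\<sigma> j)(eval L inp \<sigma> \<rho> e := eval L inp \<sigma> \<rho> f))"
| "run L inp \<rho> (c ;; c') \<sigma> = run L inp \<rho> c' (run L inp \<rho> c \<sigma>)"
| "run L inp \<rho> (For x e c) \<sigma> =
     fold (\<lambda>i. run L inp (\<rho>(x := i)) c) [0..<min (eval L inp \<sigma> \<rho> e) L] \<sigma>"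

fun arrays_e :: "aexp \<Rightarrow> bool" where
  "arrays_e (Num c) = True"
| "arrays_e (Var x) = True"
| "arrays_e (Inp e) = arrays_e e"
| "arrays_e (Arr j e) = (j < 16 \<and> arrays_e e)"
| "arrays_e (Plus e f) = (arrays_e e \<and> arrays_e f)"
| "arrays_e (Minus e f) = (arrays_e e \<and> arrays_e f)"
| "arrays_e (Sum x e f) = (arrays_e e \<and> arrays_e f)"

fun arrays_c :: "com \<Rightarrow> bool" where
  "arrays_c (Put j e f) = (j < 16 \<and> arrays_e e \<and> arrays_e f)"
| "arrays_c (c ;; c') = (arrays_c c \<and> arrays_c c')"
| "arrays_c (For x e c) = (arrays_e e \<and> arrays_c c)"

text \<open>Register 2 holds the clamp \<open>L\<close>, register 3 the number of input cells; cell \<open>i\<close> of array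
  \<open>j < 16\<close> lives at address \<open>R[3] + 16 * i + j\<close>.\<close>

definition address :: "nat \<Rightarrow> nat \<Rightarrow> prog" where
  "address j d = Seq (Add d d d) (Seq (Add d d d) (Seq (Add d d d) (Seq (Add d d d)
     (Seq (Add d d 3) (Seq (Const (d + 1) j) (Add d d (d + 1)))))))"

text \<open>Registers from \<open>d\<close> upwards serve as a stack: the result goes to
  \<open>d\<close>, everything below \<open>d\<close> is preserved, and \<open>m\<close> locates the
  variables. Subtracting truncated twice, \<open>R - (R - L)\<close>, yields the minimum of
  \<open>R\<close> and \<open>L\<close>. \<open>Inp\<close> compares its index with register 3
  because the cells beyond the input hold the arrays.\<close>

fun comp_e :: "(nat \<Rightarrow> nat) \<Rightarrow> nat \<Rightarrow> aexp \<Rightarrow> prog" where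
  "comp_e m d (Num c) = Const d c"
| "comp_e m d (Var x) = Seq (Const d 0) (Add d d (m x))"
| "comp_e m d (Inp e) = Seq (comp_e m d e)
     (Seq (Sub (d + 1) 3 d) (Cond (d + 1) (Load d d) (Const d 0)))"
| "comp_e m d (Arr j e) = Seq (comp_e m d e) (Seq (address j d) (Load d d))"
| "comp_e m d (Plus e f) = Seq (comp_e m d e) (Seq (comp_e m (d + 1) f) (Add d d (d + 1)))"
| "comp_e m d (Minus e f) = Seq (comp_e m d e) (Seq (comp_e m (d + 1) f) (Sub d d (d + 1)))"
| "comp_e m d (Sum x e f) = Seq (comp_e m d e) (Seq (Sub (d + 1) d 2) (Seq (Sub d d (d + 1))
     (Seq (Const (d + 1) 0) (Seq (Const (d + 2) 0) (Seq (Const (d + 3) 1)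
     (Seq (While d (Seq (comp_e (m(x := d + 1)) (d + 4) f) (Seq (Add (d + 2) (d + 2) (d + 4))
        (Seq (Add (d + 1) (d + 1) (d + 3)) (Sub d d (d + 3))))))
     (Seq (Const d 0) (Add d d (d + 2)))))))))"

fun comp_c :: "(nat \<Rightarrow> nat) \<Rightarrow> nat \<Rightarrow> com \<Rightarrow> prog" where
  "comp_c m d (Put j e f) =
     Seq (comp_e m d e) (Seq (address j d) (Seq (comp_e m (d + 1) f) (Store d (d + 1))))"
| "comp_c m d (c ;; c') = Seq (comp_c m d c) (comp_c m d c')"
| "comp_c m d (For x e c) = Seq (comp_e m d e) (Seq (Sub (d + 1) d 2) (Seq (Sub d d (d + 1))
     (Seq (Const (d + 1) 0) (Seq (Const (d + 2) 1)
     (While d (Seq (comp_c (m(x := d + 1)) (d + 3) c)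
        (Seq (Add (d + 1) (d + 1) (d + 2)) (Sub d d (d + 2)))))))))"

fun time_e :: "nat \<Rightarrow> aexp \<Rightarrow> nat" where
  "time_e L (Num c) = 1"
| "time_e L (Var x) = 1 + 1"
| "time_e L (Inp e) = time_e L e + (1 + (1 + 1))"
| "time_e L (Arr j e) = time_e L e + (7 + 1)"
| "time_e L (Plus e f) = time_e L e + (time_e L f + 1)"
| "time_e L (Minus e f) = time_e L e + (time_e L f + 1)"
| "time_e L (Sum x e f) = time_e L e + (1 + (1 + (1 + (1 + (1 +
     ((L * (time_e L f + (1 + (1 + 1)) + 1) + 1) + (1 + 1)))))))"

fun time_c :: "nat \<Rightarrow> com \<Rightarrow> nat" where
  "time_c L (Put j e f) = time_e L e + (7 + (time_e L f + 1))"
| "time_c L (c ;; c') = time_c L c + time_c L c'"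
| "time_c L (For x e c) = time_e L e + (1 + (1 + (1 + (1 +
     (L * (time_c L c + (1 + 1) + 1) + 1)))))"

lemma within_address:
  assumes "d \<ge> 4" "Q (R(d := R 3 + 16 * R d + j, d + 1 := j), M)"
  shows "within (address j d) 7 Q (R, M)"
proof -
  have eq: "(7::nat) = 1 + (1 + (1 + (1 + (1 + (1 + 1)))))" by simp
  have *: "R(d := R 3 + 16 * R d + j, d + 1 := j) = R(d + 1 := j, d := R 3 + 16 * R d + j)"
    by (rule fun_upd_twist) simp
  have "d \<noteq> 3" using assms by simp
  then show ?thesis
    unfolding address_def eq
    apply (intro within_Seq within_Add within_Const)
    using assms(2) unfolding * by (simp add: numeral_eq_Suc add_ac)
qed

text \<open>\<open>4 \<le> d\<close> protects \<open>n\<close>, \<open>k\<close>, the clamp and the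
  input length in registers 0 to 3, and \<open>m x < d\<close> keeps the variables away from the
  stack.\<close>

definition represents ::
    "nat \<Rightarrow> (nat \<Rightarrow> nat) \<Rightarrow> nat \<Rightarrow> (nat \<Rightarrow> nat) \<Rightarrow> nat \<Rightarrow> env \<Rightarrow> store \<Rightarrow> state \<Rightarrow> bool" where
  "represents L inp b m d \<rho> \<sigma> s \<longleftrightarrow>
     fst s 2 = L \<and> fst s 3 = b \<and> 4 \<le> d \<and> (\<forall>x. m x < d \<and> fst s (m x) = \<rho> x) \<and>
     (\<forall>i<b. snd s i = inp i) \<and> (\<forall>i\<ge>b. inp i = 0) \<and>
     (\<forall>j<16. \<forall>i. snd s (b + 16 * i + j) = \<sigma> j i)"

lemma represents_extend:
  assumes "represents L inp b m d \<rho> \<sigma> (R, M)" "\<And>r. r < d \<Longrightarrow> R' r = R r"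
    "d \<le> y" "y < d'" "R' y = i"
  shows "represents L inp b (m(x := y)) d' (\<rho>(x := i)) \<sigma> (R', M)"
  using assms unfolding represents_def by (auto simp: less_imp_le intro: less_le_trans)

lemma represents_agree:
  assumes "represents L inp b m d \<rho> \<sigma> (R, M)" "\<And>r. r < d \<Longrightarrow> R' r = R r" "d \<le> d'"
  shows "represents L inp b m d' \<rho> \<sigma> (R', M)"
  using assms unfolding represents_def by (auto intro: less_le_trans)

text \<open>Used on leaving a loop body: the memory is that of the inner state, while variables and
  stack pointer return to those outside.\<close>

lemma represents_change_store:
  assumes "represents L inp b m d \<rho> \<sigma> (R, M)" "represents L inp b m' d' \<rho>' \<sigma>' (R', M')"
    "\<And>r. r < d \<Longrightarrow> R'' r = R r"
  shows "represents L inp b m d \<rho> \<sigma>' (R'', M')"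
  using assms unfolding represents_def by auto

text \<open>Stated with a continuation \<open>Q\<close>, which only learns that registers below
  \<open>d\<close> are intact and that \<open>d\<close> holds the value. Such facts chain through
  \<open>within_Seq\<close> without naming intermediate states.\<close>

lemma within_comp_e:
  assumes "represents L inp b m d \<rho> \<sigma> (R, M)" "arrays_e e"
    and "\<And>R'. (\<And>r. r < d \<Longrightarrow> R' r = R r) \<Longrightarrow> R' d = eval L inp \<sigma> \<rho> e \<Longrightarrow> Q (R', M)"
  shows "within (comp_e m d e) (time_e L e) Q (R, M)"
  using assms
proof (induction e arbitrary: m d \<rho> R Q)
  case (Num c)
  then show ?case by (auto simp del: One_nat_def intro!: within_Const)
next
  case (Var x)
  show ?case unfolding comp_e.simps time_e.simps
    using Var.prems(1) by (intro within_Seq within_Const within_Add Var.prems(3))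
      (auto simp: represents_def)
next
  case (Inp e)
  show ?case unfolding comp_e.simps time_e.simps
  proof (intro within_Seq Inp.IH[OF Inp.prems(1)])
    fix R' assume R': "\<And>r. r < d \<Longrightarrow> R' r = R r" "R' d = eval L inp \<sigma> \<rho> e"
    show "within (Sub (d + 1) 3 d) 1
      (within (Cond (d + 1) (Load d d) (Const d 0)) (1 + 1) Q) (R', M)"
      using R' Inp.prems(1)
      by (intro within_Sub within_Cond within_Load within_Const Inp.prems(3))
        (auto simp: represents_def)
  qed (use Inp.prems in simp)
next
  case (Arr j e)
  show ?case unfolding comp_e.simps time_e.simps
  proof (intro within_Seq Arr.IH[OF Arr.prems(1)])
    fix R' assume R': "\<And>r. r < d \<Longrightarrow> R' r = R r" "R' d = eval L inp \<sigma> \<rho> e"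
    show "within (address j d) 7 (within (Load d d) 1 Q) (R', M)"
      using R' Arr.prems(1,2)
      by (intro within_address within_Load Arr.prems(3))
        (auto simp: represents_def)
  qed (use Arr.prems in simp)
next
  case (Plus e f)
  show ?case unfolding comp_e.simps time_e.simps
  proof (intro within_Seq Plus.IH(1)[OF Plus.prems(1)])
    fix R' assume R': "\<And>r. r < d \<Longrightarrow> R' r = R r" "R' d = eval L inp \<sigma> \<rho> e"
    show "within (comp_e m (d + 1) f) (time_e L f) (within (Add d d (d + 1)) 1 Q) (R', M)"
      using R' Plus.prems(2) represents_agree[OF Plus.prems(1) R'(1), of "d + 1"]
      by (intro within_Add Plus.IH(2) Plus.prems(3)) auto
  qed (use Plus.prems in simp)
next
  case (Minus e f)
  show ?case unfolding comp_e.simps time_e.simps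
  proof (intro within_Seq Minus.IH(1)[OF Minus.prems(1)])
    fix R' assume R': "\<And>r. r < d \<Longrightarrow> R' r = R r" "R' d = eval L inp \<sigma> \<rho> e"
    show "within (comp_e m (d + 1) f) (time_e L f) (within (Sub d d (d + 1)) 1 Q) (R', M)"
      using R' Minus.prems(2) represents_agree[OF Minus.prems(1) R'(1), of "d + 1"]
      by (intro within_Sub Minus.IH(2) Minus.prems(3)) auto
  qed (use Minus.prems in simp)
next
  case (Sum x e f)
  let ?B = "min (eval L inp \<sigma> \<rho> e) L"
  let ?v = "\<lambda>i. eval L inp \<sigma> (\<rho>(x := i)) f"
  \<comment> \<open>Register \<open>d\<close> counts down, \<open>d + 1\<close> is the loop
    variable, \<open>d + 2\<close> the partial sum and \<open>d + 3\<close> the constant 1.\<close>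
  define J where "J i s \<longleftrightarrow> snd s = M \<and> (\<forall>r<d. fst s r = R r) \<and> fst s d = ?B - i \<and>
      fst s (d + 1) = i \<and> fst s (d + 2) = (\<Sum>j<i. ?v j) \<and> fst s (d + 3) = 1" for i s
  have d: "d \<ge> 4" and L: "R 2 = L" using Sum.prems(1) by (auto simp: represents_def)
  show ?case unfolding comp_e.simps time_e.simps
  proof (rule within_Seq, rule Sum.IH(1)[OF Sum.prems(1)])
    fix R' assume R': "\<And>r. r < d \<Longrightarrow> R' r = R r" "R' d = eval L inp \<sigma> \<rho> e"
    show "within (Seq (Sub (d + 1) d 2) (Seq (Sub d d (d + 1))
      (Seq (Const (d + 1) 0) (Seq (Const (d + 2) 0) (Seq (Const (d + 3) 1)
      (Seq (While d (Seq (comp_e (m(x := d + 1)) (d + 4) f) (Seq (Add (d + 2) (d + 2) (d + 4))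
         (Seq (Add (d + 1) (d + 1) (d + 3)) (Sub d d (d + 3))))))
      (Seq (Const d 0) (Add d d (d + 2)))))))))
      (1 + (1 + (1 + (1 + (1 + ((L * (time_e L f + (1 + (1 + 1)) + 1) + 1) + (1 + 1))))))) Q (R', M)"
    proof (intro within_Seq within_Sub within_Const within_While[where b = ?B and J = J])
      show "J 0 (R'(d + 1 := R' d - R' 2, d := (R'(d + 1 := R' d - R' 2)) d -
        (R'(d + 1 := R' d - R' 2)) (d + 1), d + 1 := 0, d + 2 := 0, d + 3 := 1), M)"
        using R' L d by (auto simp: J_def)
    next
      fix i s assume i: "i < ?B" and J: "J i s"
      obtain R1 where s: "s = (R1, M)" using J by (cases s) (auto simp: J_def)
      have J': "\<forall>r<d. R1 r = R r" "R1 d = ?B - i" "R1 (d + 1) = i"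
        "R1 (d + 2) = (\<Sum>j<i. ?v j)" "R1 (d + 3) = 1" using J by (auto simp: s J_def)
      show "within (comp_e (m(x := d + 1)) (d + 4) f) (time_e L f)
        (within (Seq (Add (d + 2) (d + 2) (d + 4)) (Seq (Add (d + 1) (d + 1) (d + 3))
          (Sub d d (d + 3)))) (1 + (1 + 1)) (J (Suc i))) s"
        unfolding s
      proof (rule Sum.IH(2))
        show "represents L inp b (m(x := d + 1)) (d + 4) (\<rho>(x := i)) \<sigma> (R1, M)"
          using J' by (intro represents_extend[OF Sum.prems(1)]) auto
        fix R2 assume R2: "\<And>r. r < d + 4 \<Longrightarrow> R2 r = R1 r" "R2 (d + 4) = ?v i"
        show "within (Seq (Add (d + 2) (d + 2) (d + 4)) (Seq (Add (d + 1) (d + 1) (d + 3))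
          (Sub d d (d + 3)))) (1 + (1 + 1)) (J (Suc i)) (R2, M)"
          using R2 J' i by (intro within_Seq within_Add within_Sub) (auto simp: J_def)
      qed (use Sum.prems(2) in simp)
    next
      fix s assume J: "J ?B s"
      obtain R1 where s: "s = (R1, M)" using J by (cases s) (auto simp: J_def)
      show "within (Const d 0) 1 (within (Add d d (d + 2)) 1 Q) s"
        using J unfolding s by (intro within_Add within_Const Sum.prems(3)) (auto simp: J_def)
    qed (auto simp: J_def)
  qed (use Sum.prems in simp)
qed

text \<open>The 16 arrays are interleaved, so index and array number can be read off an address by
  division by 16: a write hits one cell of one array, and never the input below
  \<open>b\<close>.\<close>

lemma represents_store:
  assumes "represents L inp b m d \<rho> \<sigma> (R, M)" "j < 16"
  shows "represents L inp b m d \<rho> (\<sigma>(j := (\<sigma> j)(i := v))) (R, M(b + 16 * i + j := v))"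
proof -
  have "16 * i' + j' = 16 * i + j \<longleftrightarrow> i' = i \<and> j' = j" if "j' < 16" for i' j' :: nat
    using that assms(2) by (metis add.commute mod_less mod_mult_self2 mult.commute
        add_right_cancel mult_left_cancel zero_neq_numeral)
  then have "(b + 16 * i' + j' = b + 16 * i + j) = (i' = i \<and> j' = j)" if "j' < 16" for i' j' :: nat
    using that by (metis add.assoc add_left_cancel)
  then show ?thesis using assms unfolding represents_def by auto
qed

lemma within_comp_c:
  assumes "represents L inp b m d \<rho> \<sigma> (R, M)" "arrays_c c"
    and "\<And>R' M'. (\<And>r. r < d \<Longrightarrow> R' r = R r) \<Longrightarrow>
      represents L inp b m d \<rho> (run L inp \<rho> c \<sigma>) (R', M') \<Longrightarrow> Q (R', M')"
  shows "within (comp_c m d c) (time_c L c) Q (R, M)"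
  using assms
proof (induction c arbitrary: m d \<rho> R M \<sigma> Q)
  case (Put j e f)
  have d: "d \<ge> 4" and b: "R 3 = b" using Put.prems(1) by (auto simp: represents_def)
  show ?case unfolding comp_c.simps time_c.simps
  proof (rule within_Seq, rule within_comp_e[OF Put.prems(1)])
    fix R' assume R': "\<And>r. r < d \<Longrightarrow> R' r = R r" "R' d = eval L inp \<sigma> \<rho> e"
    show "within (Seq (address j d) (Seq (comp_e m (d + 1) f) (Store d (d + 1))))
      (7 + (time_e L f + 1)) Q (R', M)"
    proof (intro within_Seq within_address d within_comp_e)
      show "represents L inp b m (d + 1) \<rho> \<sigma>
        (R'(d := R' 3 + 16 * R' d + j, d + 1 := j), M)"
        using R' by (intro represents_agree[OF Put.prems(1)]) auto
      fix R'' assume R'': "\<And>r. r < d + 1 \<Longrightarrow>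
          R'' r = (R'(d := R' 3 + 16 * R' d + j, d + 1 := j)) r"
        "R'' (d + 1) = eval L inp \<sigma> \<rho> f"
      have eq: "R'' d = b + 16 * eval L inp \<sigma> \<rho> e + j" using R' R'' d b by simp
      have agree: "R'' r = R r" if "r < d" for r using R' R'' that by simp
      show "within (Store d (d + 1)) 1 Q (R'', M)"
      proof (intro within_Store Put.prems(3))
        show "represents L inp b m d \<rho> (run L inp \<rho> (Put j e f) \<sigma>) (R'', M(R'' d := R'' (d + 1)))"
          using Put.prems(2) represents_store[OF represents_agree[OF Put.prems(1) agree]]
          unfolding eq R''(2) by simp
      qed (rule agree)
    qed (use Put.prems in simp)
  qed (use Put.prems in simp)
next
  case (Then c c')
  show ?case unfolding comp_c.simps time_c.simps
  proof (intro within_Seq Then.IH(1)[OF Then.prems(1)])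
    fix R' M' assume *: "\<And>r. r < d \<Longrightarrow> R' r = R r"
      "represents L inp b m d \<rho> (run L inp \<rho> c \<sigma>) (R', M')"
    show "within (comp_c m d c') (time_c L c') Q (R', M')"
      using * Then.prems(2) by (intro Then.IH(2)[OF *(2)] Then.prems(3)) auto
  qed (use Then.prems in simp)
next
  case (For x e c)
  let ?B = "min (eval L inp \<sigma> \<rho> e) L"
  let ?\<sigma> = "\<lambda>i. fold (\<lambda>i. run L inp (\<rho>(x := i)) c) [0..<i] \<sigma>"
  define J where "J i s \<longleftrightarrow> (\<forall>r<d. fst s r = R r) \<and> fst s d = ?B - i \<and>
      fst s (d + 1) = i \<and> fst s (d + 2) = 1 \<and> represents L inp b m d \<rho> (?\<sigma> i) s" for i s
  have d: "d \<ge> 4" and L: "R 2 = L" using For.prems(1) by (auto simp: represents_def)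
  show ?case unfolding comp_c.simps time_c.simps
  proof (rule within_Seq, rule within_comp_e[OF For.prems(1)])
    fix R' assume R': "\<And>r. r < d \<Longrightarrow> R' r = R r" "R' d = eval L inp \<sigma> \<rho> e"
    show "within (Seq (Sub (d + 1) d 2) (Seq (Sub d d (d + 1))
      (Seq (Const (d + 1) 0) (Seq (Const (d + 2) 1)
      (While d (Seq (comp_c (m(x := d + 1)) (d + 3) c)
        (Seq (Add (d + 1) (d + 1) (d + 2)) (Sub d d (d + 2)))))))))
      (1 + (1 + (1 + (1 + (L * (time_c L c + (1 + 1) + 1) + 1))))) Q (R', M)"
    proof (intro within_Seq within_Sub within_Const within_While[where b = ?B and J = J])
      show "J 0 (R'(d + 1 := R' d - R' 2, d := (R'(d + 1 := R' d - R' 2)) d -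
        (R'(d + 1 := R' d - R' 2)) (d + 1), d + 1 := 0, d + 2 := 1), M)"
        using R' L d represents_agree[OF For.prems(1), of "R'(d := min (R' d) L, d + 1 := 0, d + 2 := 1)" d]
        by (auto simp: J_def min_def)
    next
      fix i s assume i: "i < ?B" and J: "J i s"
      obtain R1 M1 where s: "s = (R1, M1)" by (cases s)
      have J': "\<forall>r<d. R1 r = R r" "R1 d = ?B - i" "R1 (d + 1) = i" "R1 (d + 2) = 1"
        and rep: "represents L inp b m d \<rho> (?\<sigma> i) (R1, M1)" using J by (auto simp: s J_def)
      show "within (comp_c (m(x := d + 1)) (d + 3) c) (time_c L c)
        (within (Seq (Add (d + 1) (d + 1) (d + 2)) (Sub d d (d + 2))) (1 + 1) (J (Suc i))) s"
        unfolding s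
      proof (rule For.IH)
        show "represents L inp b (m(x := d + 1)) (d + 3) (\<rho>(x := i)) (?\<sigma> i) (R1, M1)"
          using J' by (intro represents_extend[OF rep]) auto
        fix R2 M2 assume R2: "\<And>r. r < d + 3 \<Longrightarrow> R2 r = R1 r"
          and rep2: "represents L inp b (m(x := d + 1)) (d + 3) (\<rho>(x := i))
            (run L inp (\<rho>(x := i)) c (?\<sigma> i)) (R2, M2)"
        have rep3: "represents L inp b m d \<rho> (?\<sigma> (Suc i))
            (R2(d + 1 := Suc i, d := ?B - Suc i), M2)"
          using represents_change_store[OF rep rep2] R2 by simp
        show "within (Seq (Add (d + 1) (d + 1) (d + 2)) (Sub d d (d + 2))) (1 + 1)
          (J (Suc i)) (R2, M2)"
          using R2 J' i rep3 by (intro within_Seq within_Add within_Sub) (auto simp: J_def)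
      qed (use For.prems(2) in simp)
    next
      fix s assume J: "J ?B s"
      obtain R1 M1 where s: "s = (R1, M1)" by (cases s)
      show "Q s"
        using J unfolding s by (intro For.prems(3)) (auto simp: J_def)
    qed (auto simp: J_def)
  qed (use For.prems in simp)
qed

section \<open>Running time is polynomial in the clamp\<close>

lemma poly_add:
  assumes "\<exists>C D. \<forall>L\<ge>1. f L \<le> C * L ^ D" "\<exists>C D. \<forall>L\<ge>1. g L \<le> C * L ^ D"
  shows "\<exists>C D. \<forall>L\<ge>(1::nat). f L + g L \<le> (C::nat) * L ^ D"
proof -
  obtain C D C' D' where f: "\<And>L. L \<ge> 1 \<Longrightarrow> f L \<le> C * L ^ D"
    and g: "\<And>L. L \<ge> 1 \<Longrightarrow> g L \<le> C' * L ^ D'"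
    using assms by metis
  have "f L + g L \<le> (C + C') * L ^ (D + D')" if "L \<ge> 1" for L
  proof -
    have "f L \<le> C * L ^ (D + D')" "g L \<le> C' * L ^ (D + D')"
      using f[OF that] g[OF that] that
      by (meson le_add1 le_add2 mult_le_mono2 order_trans power_increasing)+
    then show ?thesis by (simp add: add_mult_distrib)
  qed
  then show ?thesis by blast
qed

lemma poly_mult:
  assumes "\<exists>C D. \<forall>L\<ge>1. f L \<le> C * L ^ D"
  shows "\<exists>C D. \<forall>L\<ge>(1::nat). L * f L \<le> (C::nat) * L ^ D"
proof -
  obtain C D where f: "\<And>L. L \<ge> 1 \<Longrightarrow> f L \<le> C * L ^ D" using assms by metis
  have "L * f L \<le> C * L ^ Suc D" if "L \<ge> 1" for L
    using mult_le_mono2[OF f[OF that], of L] by (simp add: mult_ac)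
  then show ?thesis by blast
qed

lemma poly_const: "\<exists>C D. \<forall>L\<ge>(1::nat). c \<le> (C::nat) * L ^ D"
  by (rule exI[of _ c], rule exI[of _ 0]) simp

lemma time_e_poly: "\<exists>C D. \<forall>L\<ge>1. time_e L e \<le> C * L ^ D"
proof (induction e)
  case (Sum x e f)
  then show ?case unfolding time_e.simps
    by (intro poly_add[OF Sum(1)] poly_add poly_mult poly_const Sum(2))
qed (unfold time_e.simps, (intro poly_add poly_const | assumption)+)

lemma time_c_poly: "\<exists>C D. \<forall>L\<ge>1. time_c L c \<le> C * L ^ D"
proof (induction c)
  case (Put j e f)
  show ?case unfolding time_c.simps by (intro poly_add poly_const time_e_poly)
next
  case (Then c c')
  then show ?case unfolding time_c.simps by (rule poly_add)
next
  case (For x e c)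
  show ?case unfolding time_c.simps by (intro poly_add poly_mult poly_const time_e_poly For)
qed

definition init_env :: "nat \<Rightarrow> nat \<Rightarrow> env" where
  "init_env n k x = (if x = 0 then n else k)"

text \<open>Register 5 is the constant 1, register 3 becomes \<open>n * n\<close>, 6 becomes
  \<open>2 ^ k\<close> by doubling, 7 the base \<open>2 ^ k * (n + 1)\<close> and 2 its
  \<open>p\<close>-th power. One multiplication by the base adds register 2 as many times as the
  base says, so its cost is linear in the base and independent of the power reached.\<close>

definition prelude :: "nat \<Rightarrow> prog" where
  "prelude p =
     Seq (Const 5 1) (Seq (Const 3 0) (Seq (Add 4 0 3)
     (Seq (While 4 (Seq (Add 3 3 0) (Sub 4 4 5)))
     (Seq (Const 6 1) (Seq (Const 7 0) (Seq (Add 4 1 7)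
     (Seq (While 4 (Seq (Add 6 6 6) (Sub 4 4 5)))
     (Seq (Add 4 0 5)
     (Seq (While 4 (Seq (Add 7 7 6) (Sub 4 4 5)))
     (Seq (Const 2 1) (Seq (Const 8 p)
     (While 8 (Seq (Const 9 0) (Seq (Add 4 7 9)
        (Seq (While 4 (Seq (Add 9 9 2) (Sub 4 4 5)))
        (Seq (Const 2 0) (Seq (Add 2 2 9) (Sub 8 8 5))))))))))))))))))"


lemma within_prelude:
  assumes "\<And>R'. R' 0 = R 0 \<Longrightarrow> R' 1 = R 1 \<Longrightarrow> R' 2 = (2 ^ R 1 * (R 0 + 1)) ^ p \<Longrightarrow>
      R' 3 = R 0 * R 0 \<Longrightarrow> Q (R', M)"
  defines "B \<equiv> 2 ^ R 1 * (R 0 + 1)"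
  shows "within (prelude p) (12 + 3 * R 0 + 3 * R 1 + 3 * (R 0 + 1) + 4 + p * (8 + 3 * B)) Q (R, M)"
proof -
  let ?n = "R 0" and ?k = "R 1"
  define J1 where "J1 i s \<longleftrightarrow> snd s = M \<and> fst s 0 = ?n \<and> fst s 1 = ?k \<and> fst s 5 = 1 \<and>
    fst s 3 = i * ?n \<and> fst s 4 = ?n - i" for i and s :: state
  define J2 where "J2 i s \<longleftrightarrow> snd s = M \<and> fst s 0 = ?n \<and> fst s 1 = ?k \<and> fst s 5 = 1 \<and>
    fst s 3 = ?n * ?n \<and> fst s 6 = 2 ^ i \<and> fst s 7 = 0 \<and> fst s 4 = ?k - i" for i and s :: state
  define J3 where "J3 i s \<longleftrightarrow> snd s = M \<and> fst s 0 = ?n \<and> fst s 1 = ?k \<and> fst s 5 = 1 \<and>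
    fst s 3 = ?n * ?n \<and> fst s 6 = 2 ^ ?k \<and> fst s 7 = i * 2 ^ ?k \<and> fst s 4 = (?n + 1) - i" for i and s :: state
  define J4 where "J4 i s \<longleftrightarrow> snd s = M \<and> fst s 0 = ?n \<and> fst s 1 = ?k \<and> fst s 5 = 1 \<and>
    fst s 3 = ?n * ?n \<and> fst s 7 = B \<and> fst s 2 = B ^ i \<and> fst s 8 = p - i" for i and s :: state
  define J5 where "J5 i j s \<longleftrightarrow> J4 i s \<and> fst s 9 = j * B ^ i \<and> fst s 4 = B - j" for i j and s :: state
  have body4: "within (Seq (Const 9 0) (Seq (Add 4 7 9)
        (Seq (While 4 (Seq (Add 9 9 2) (Sub 4 4 5)))
        (Seq (Const 2 0) (Seq (Add 2 2 9) (Sub 8 8 5))))))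
      (1 + (1 + ((B * ((1 + 1) + 1) + 1) + (1 + (1 + 1))))) (J4 (Suc i)) s" if "J4 i s" "i < p" for i s
  proof -
    have "snd s = M" using that(1) unfolding J4_def by blast
    then obtain R1 where s: "s = (R1, M)" by (metis prod.collapse)
    show ?thesis unfolding s
      apply (rule within_Seq, rule within_Const, rule within_Seq, rule within_Add)
      apply (rule within_Seq, rule within_While[where b = B and J = "J5 i"])
      subgoal for j s'
        apply (cases s', simp only:)
        apply (rule within_Seq, rule within_Add, rule within_Sub)
        apply (auto simp: J5_def J4_def)
        done
      subgoal by (simp add: J5_def)
      subgoal using that by (simp add: J5_def J4_def s)
      subgoal by simp
      subgoal for s'
        apply (cases s', simp only:)
        apply (rule within_Seq, rule within_Const, rule within_Seq, rule within_Add, rule within_Sub)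
        using that apply (auto simp: J5_def J4_def)
        done
      done
  qed
  have "within (prelude p) (1 + (1 + (1 + ((?n * ((1 + 1) + 1) + 1) + (1 + (1 + (1 +
     ((?k * ((1 + 1) + 1) + 1) + (1 + (((?n + 1) * ((1 + 1) + 1) + 1) + (1 + (1 +
     (p * ((1 + (1 + ((B * ((1 + 1) + 1) + 1) + (1 + (1 + 1))))) + 1) + 1)))))))))))))
     Q (R, M)"
    unfolding prelude_def
    apply (rule within_Seq, rule within_Const, rule within_Seq, rule within_Const)
    apply (rule within_Seq, rule within_Add)
    apply (rule within_Seq, rule within_While[where b = ?n and J = J1])
    subgoal for i s
      apply (cases s, simp only:)
      apply (rule within_Seq, rule within_Add, rule within_Sub)
      apply (auto simp: J1_def)
      done
    subgoal by (simp add: J1_def)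
    subgoal by (simp add: J1_def)
    subgoal by simp
    subgoal for s
      apply (cases s, simp only:)
      apply (rule within_Seq, rule within_Const, rule within_Seq, rule within_Const)
      apply (rule within_Seq, rule within_Add)
      apply (rule within_Seq, rule within_While[where b = ?k and J = J2])
      subgoal for a b i s
        apply (cases s, simp only:)
        apply (rule within_Seq, rule within_Add, rule within_Sub)
        apply (auto simp: J2_def)
        done
      subgoal by (simp add: J2_def)
      subgoal by (simp add: J1_def J2_def)
      subgoal by simp
      subgoal for a b s
        apply (cases s, simp only:)
        apply (rule within_Seq, rule within_Add)
        apply (rule within_Seq, rule within_While[where b = "?n + 1" and J = J3])
        subgoal for a b i s
          apply (cases s, simp only:)
          apply (rule within_Seq, rule within_Add, rule within_Sub)
          apply (auto simp: J3_def)
          done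
        subgoal by (simp add: J3_def)
        subgoal by (simp add: J3_def J2_def)
        subgoal by simp
        subgoal for a b s
          apply (cases s, simp only:)
          apply (rule within_Seq, rule within_Const, rule within_Seq, rule within_Const)
          apply (rule within_While[where b = p and J = J4])
          subgoal by (rule body4)
          subgoal by (simp add: J4_def)
          subgoal by (simp add: J4_def J3_def B_def mult.commute)
          subgoal by simp
          subgoal for a b s
            by (cases s) (auto simp: J4_def B_def intro!: assms(1))
          done
        done
      done
    done
  then show ?thesis by (rule within_mono) (simp_all add: algebra_simps)
qed

lemma compile_program:
  assumes "arrays_c c" "arrays_e e"
  shows "\<exists>P C D. \<forall>n k M. (\<forall>i\<ge>n * n. M i = 0) \<longrightarrow>
    (let L = (2 ^ k * (n + 1)) ^ p; \<rho> = init_env n k in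
      within P (C * (2 ^ k * (n + 1)) ^ D)
        (\<lambda>s. fst s 0 = eval L M (run L M \<rho> c (\<lambda>_ _. 0)) \<rho> e) ((\<lambda>_. 0)(0 := n, 1 := k), M))"
proof -
  obtain C1 D1 where t1: "\<And>L. L \<ge> 1 \<Longrightarrow> time_c L c \<le> C1 * L ^ D1" using time_c_poly by metis
  obtain C2 D2 where t2: "\<And>L. L \<ge> 1 \<Longrightarrow> time_e L e \<le> C2 * L ^ D2" using time_e_poly by metis
  \<comment> \<open>Every variable except 0 starts out in register 1, which matches
    \<open>init_env\<close>. The stack starts at 10, above the scratch registers of
    \<open>prelude\<close>.\<close>
  let ?m = "\<lambda>x::nat. if x = 0 then 0 else 1 :: nat"
  define P where "P = Seq (prelude p) (Seq (comp_c ?m 10 c) (Seq (comp_e ?m 10 e)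
    (Seq (Const 0 0) (Add 0 0 10))))"
  define C where "C = 28 + 11 * p + C1 + C2"
  define D where "D = 1 + p * D1 + p * D2"
  have "within P (C * (2 ^ k * (n + 1)) ^ D)
        (\<lambda>s. fst s 0 = eval L M (run L M (init_env n k) c (\<lambda>_ _. 0)) (init_env n k) e)
        ((\<lambda>_. 0)(0 := n, 1 := k), M)"
    if M: "\<forall>i\<ge>n * n. M i = 0" and L: "L = (2 ^ k * (n + 1)) ^ p" for n k L M
  proof -
    let ?B = "2 ^ k * (n + 1)"
    let ?Q = "\<lambda>s. fst s 0 = eval L M (run L M (init_env n k) c (\<lambda>_ _. 0)) (init_env n k) e"
    have B: "n < ?B" "k < ?B" "1 \<le> ?B"
    proof -
      have "1 * (n + 1) \<le> ?B" by (rule mult_le_mono1) simp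
      then show "n < ?B" by simp
      then show "1 \<le> ?B" by linarith
      have "k < 2 ^ k" by simp
      also have "\<dots> * 1 \<le> ?B" by (rule mult_le_mono2) simp
      finally show "k < ?B" by simp
    qed
    have L1: "L \<ge> 1" unfolding L using B(3) by simp
    have w: "within P ((12 + 3 * n + 3 * k + 3 * (n + 1) + 4 + p * (8 + 3 * ?B)) +
      (time_c L c + (time_e L e + (1 + 1)))) ?Q ((\<lambda>_. 0)(0 := n, 1 := k), M)"
      unfolding P_def
    proof (rule within_Seq)
      let ?R = "(\<lambda>_. 0)(0 := n, 1 := k) :: nat \<Rightarrow> nat"
      have *: "within (prelude p) (12 + 3 * ?R 0 + 3 * ?R 1 + 3 * (?R 0 + 1) + 4 +
         p * (8 + 3 * (2 ^ ?R 1 * (?R 0 + 1))))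
        (within (Seq (comp_c ?m 10 c) (Seq (comp_e ?m 10 e) (Seq (Const 0 0) (Add 0 0 10))))
          (time_c L c + (time_e L e + (1 + 1))) ?Q) (?R, M)"
      proof (rule within_prelude)
        fix R' :: "nat \<Rightarrow> nat" assume R': "R' 0 = ?R 0" "R' 1 = ?R 1"
          "R' 2 = (2 ^ ?R 1 * (?R 0 + 1)) ^ p" "R' 3 = ?R 0 * ?R 0"
        have rep: "represents L M (n * n) ?m 10 (init_env n k) (\<lambda>_ _. 0) (R', M)"
          using R' M L unfolding represents_def by (auto simp: init_env_def)
        show "within (Seq (comp_c ?m 10 c) (Seq (comp_e ?m 10 e) (Seq (Const 0 0) (Add 0 0 10))))
          (time_c L c + (time_e L e + (1 + 1))) ?Q (R', M)"
        proof (rule within_Seq, rule within_comp_c[OF rep assms(1)])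
          fix R1 M1 assume rep1: "represents L M (n * n) ?m 10 (init_env n k)
            (run L M (init_env n k) c (\<lambda>_ _. 0)) (R1, M1)"
          show "within (Seq (comp_e ?m 10 e) (Seq (Const 0 0) (Add 0 0 10)))
            (time_e L e + (1 + 1)) ?Q (R1, M1)"
          proof (rule within_Seq, rule within_comp_e[OF rep1 assms(2)])
            fix R2 :: "nat \<Rightarrow> nat" assume "R2 10 = eval L M (run L M (init_env n k) c (\<lambda>_ _. 0)) (init_env n k) e"
            then show "within (Seq (Const 0 0) (Add 0 0 10)) (1 + 1) ?Q (R2, M1)"
              by (intro within_Seq within_Const within_Add) simp
          qed
        qed
      qed
      then show "within (prelude p) (12 + 3 * n + 3 * k + 3 * (n + 1) + 4 + p * (8 + 3 * ?B))
        (within (Seq (comp_c ?m 10 c) (Seq (comp_e ?m 10 e) (Seq (Const 0 0) (Add 0 0 10))))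
          (time_c L c + (time_e L e + (1 + 1))) ?Q) (?R, M)"
        by simp
    qed
    have pw: "?B ^ i \<le> ?B ^ D" if "i \<le> D" for i
      using that B(3) by (rule power_increasing)
    have "time_c L c \<le> C1 * ?B ^ D"
    proof -
      have "C1 * L ^ D1 \<le> C1 * ?B ^ D"
        unfolding L power_mult[symmetric] by (intro mult_le_mono2 pw) (simp add: D_def)
      then show ?thesis using t1[OF L1] by linarith
    qed
    moreover have "time_e L e \<le> C2 * ?B ^ D"
    proof -
      have "C2 * L ^ D2 \<le> C2 * ?B ^ D"
        unfolding L power_mult[symmetric] by (intro mult_le_mono2 pw) (simp add: D_def)
      then show ?thesis using t2[OF L1] by linarith
    qed
    moreover have "(12 + 3 * n + 3 * k + 3 * (n + 1) + 4 + p * (8 + 3 * ?B)) + 2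
      \<le> (28 + 11 * p) * ?B ^ D"
    proof -
      have "p * (8 + 3 * ?B) \<le> p * (11 * ?B)" 
      proof (rule mult_le_mono2)
        have "8 + 3 * b \<le> 11 * b" if "1 \<le> b" for b :: nat using that by simp
        then show "8 + 3 * ?B \<le> 11 * ?B" using B(3) .
      qed
      then have "p * (8 + 3 * ?B) \<le> (11 * p) * ?B" by (simp add: mult_ac)
      moreover have "12 + 3 * n + 3 * k + 3 * (n + 1) + 4 + 2 \<le> 28 * ?B"
      proof -
        have "12 + 3 * n + 3 * k + 3 * (n + 1) + 4 + 2 \<le> 28 * b" if "n < b" "k < b" "1 \<le> b" for b :: nat
          using that by presburger
        then show ?thesis using B .
      qed
      ultimately have "(12 + 3 * n + 3 * k + 3 * (n + 1) + 4 + p * (8 + 3 * ?B)) + 2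
        \<le> (28 + 11 * p) * ?B" by (simp only: add_mult_distrib)
      also have "\<dots> \<le> (28 + 11 * p) * ?B ^ D"
        using pw[of 1] by (intro mult_le_mono2) (simp add: D_def)
      finally show ?thesis .
    qed
    ultimately have "(12 + 3 * n + 3 * k + 3 * (n + 1) + 4 + p * (8 + 3 * ?B)) +
      (time_c L c + (time_e L e + (1 + 1))) \<le> C * ?B ^ D"
      unfolding C_def by (simp only: add_mult_distrib)
    with w show ?thesis by (rule within_mono)
  qed
  then show ?thesis unfolding Let_def by blast
qed

section \<open>Splitting colour classes\<close>

text \<open>A state holds the colours, the numerators \<open>y x\<close> of what remains of the
  fractions over \<open>W\<close>, and the next free colour \<open>m\<close>. The next binary digit
  of \<open>y x / W\<close> is 1 iff \<open>W \<le> 2 * y x\<close>. Both parts of the class get new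
  colours.\<close>

definition split_class :: "nat \<Rightarrow> nat \<Rightarrow> (nat \<Rightarrow> nat) \<times> (nat \<Rightarrow> nat) \<times> nat \<Rightarrow>
    (nat \<Rightarrow> nat) \<times> (nat \<Rightarrow> nat) \<times> nat" where
  "split_class W t = (\<lambda>(col, y, m).
     (\<lambda>x. if col x = t then m + of_bool (W \<le> 2 * y x) else col x,
      \<lambda>x. if col x = t then 2 * y x - W * of_bool (W \<le> 2 * y x) else y x,
      m + 2))"

text \<open>A queue in disguise: class \<open>t\<close> is inspected at time \<open>t\<close>, and
  the parts of a nonempty class receive larger numbers, so they are inspected later.\<close>

fun colouring :: "nat \<Rightarrow> (nat \<Rightarrow> nat) \<Rightarrow> (nat \<Rightarrow> bool) \<Rightarrow> nat \<Rightarrow>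
    (nat \<Rightarrow> nat) \<times> (nat \<Rightarrow> nat) \<times> nat" where
  "colouring W y T 0 = (\<lambda>_. 0, y, 1)"
| "colouring W y T (Suc t) =
     (if T t then split_class W t (colouring W y T t) else colouring W y T t)"

lemma colouring_bound:
  "fst (colouring W y T t) x < snd (snd (colouring W y T t)) \<and> snd (snd (colouring W y T t)) \<le> 2 * t + 1"
  by (induction t) (auto simp: split_class_def case_prod_beta)

definition dbl :: "nat \<Rightarrow> (nat \<Rightarrow> nat) \<Rightarrow> nat \<Rightarrow> nat" where
  "dbl W y x = 2 * y x - W * of_bool (W \<le> 2 * y x)"

definition half :: "nat \<Rightarrow> (nat \<Rightarrow> nat) \<Rightarrow> bool \<Rightarrow> nat set \<Rightarrow> nat set" where
  "half W y b Y = {x \<in> Y. (W \<le> 2 * y x) = b}"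

text \<open>Number of inner nodes of the binary trie of the fractions \<open>y x / W\<close>, cut off at depth \<open>d\<close>.\<close>

fun nodes :: "nat \<Rightarrow> nat \<Rightarrow> (nat \<Rightarrow> nat) \<Rightarrow> nat set \<Rightarrow> nat" where
  "nodes W 0 y Y = 0"
| "nodes W (Suc d) y Y = (if card Y \<le> 1 then 0 else
     Suc (nodes W d (dbl W y) (half W y False Y) + nodes W d (dbl W y) (half W y True Y)))"

fun separated :: "nat \<Rightarrow> nat \<Rightarrow> (nat \<Rightarrow> nat) \<Rightarrow> nat set \<Rightarrow> bool" where
  "separated W 0 y Y \<longleftrightarrow> card Y \<le> 1"
| "separated W (Suc d) y Y \<longleftrightarrow> card Y \<le> 1 \<or>
     separated W d (dbl W y) (half W y False Y) \<and> separated W d (dbl W y) (half W y True Y)"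

lemma half_cong: "(\<And>x. x \<in> Y \<Longrightarrow> y x = y' x) \<Longrightarrow> half W y b Y = half W y' b Y"
  by (auto simp: half_def)

text \<open>A split rewrites \<open>y\<close> only on the class that it treats; the counts for all
  other classes are carried over by this.\<close>

lemma nodes_cong: "(\<And>x. x \<in> Y \<Longrightarrow> y x = y' x) \<Longrightarrow> nodes W d y Y = nodes W d y' Y"
proof (induction d arbitrary: y y' Y)
  case (Suc d)
  have "nodes W d (dbl W y) (half W y b Y) = nodes W d (dbl W y') (half W y b Y)" for b
    by (rule Suc.IH) (simp add: dbl_def half_def Suc.prems)
  moreover have "half W y b Y = half W y' b Y" for b by (rule half_cong) (rule Suc.prems)
  ultimately show ?case by simp
qed simp

lemma separated_cong: "(\<And>x. x \<in> Y \<Longrightarrow> y x = y' x) \<Longrightarrow> separated W d y Y = separated W d y' Y"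
proof (induction d arbitrary: y y' Y)
  case (Suc d)
  have "separated W d (dbl W y) (half W y b Y) = separated W d (dbl W y') (half W y b Y)" for b
    by (rule Suc.IH) (simp add: dbl_def half_def Suc.prems)
  moreover have "half W y b Y = half W y' b Y" for b by (rule half_cong) (rule Suc.prems)
  ultimately show ?case by simp
qed simp

lemma separated_small: "card Y \<le> 1 \<Longrightarrow> separated W d y Y"
  by (cases d) auto

text \<open>The advice is to split exactly the classes with at least two elements. Every split uses
  up one inner node of the trie and issues two colours, so at most
  \<open>2 * nodes W d y S + 1\<close> colours ever arise, and within \<open>B\<close> steps each of
  their classes is inspected.\<close>

lemma colouring_separates:
  assumes S: "finite S" and sep: "separated W d y S" and B: "2 * nodes W d y S + 1 \<le> B"
  shows "\<exists>T. inj_on (fst (colouring W y T B)) S"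
proof -
  define cls where "cls s c = {x \<in> S. fst s x = c}" for s :: "(nat \<Rightarrow> nat) \<times> (nat \<Rightarrow> nat) \<times> nat" and c
  \<comment> \<open>\<open>T\<close> depends on the state reached by following \<open>T\<close> so
    far. The greedy process \<open>pr\<close> does not mention \<open>T\<close>, which breaks the
    circle.\<close>
  define pr where "pr = rec_nat (\<lambda>_. 0, y, 1)
    (\<lambda>t s. if 2 \<le> card (cls s t) then split_class W t s else s)"
  define T where "T t \<longleftrightarrow> 2 \<le> card (cls (pr t) t)" for t
  have pr: "pr t = colouring W y T t" for t
    by (induction t) (simp_all add: pr_def T_def)
  \<comment> \<open>\<open>j\<close> counts the splits, \<open>dep c\<close> is the depth of the
    trie left below class \<open>c\<close>. The inner nodes below classes not yet inspected, plus
    \<open>j\<close>, serve as the potential that never grows.\<close>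
  define Inv where "Inv t s \<longleftrightarrow> (\<exists>dep j. snd (snd s) = 2 * j + 1 \<and> (\<forall>x\<in>S. fst s x < snd (snd s)) \<and>
    (\<forall>c. separated W (dep c) (fst (snd s)) (cls s c)) \<and> (\<forall>c<t. card (cls s c) \<le> 1) \<and>
    (\<Sum>c\<in>{t..<snd (snd s)}. nodes W (dep c) (fst (snd s)) (cls s c)) + j \<le> nodes W d y S)"
    for t and s :: "(nat \<Rightarrow> nat) \<times> (nat \<Rightarrow> nat) \<times> nat"
  have "Inv t (pr t)" for t
  proof (induction t)
    case 0
    have "cls (pr 0) c = (if c = 0 then S else {})" for c by (auto simp: cls_def pr_def)
    then show ?case
      unfolding Inv_def using sep
      by (intro exI[of _ "\<lambda>_. d"] exI[of _ 0]) (auto simp: pr_def separated_small)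
  next
    case (Suc t)
    obtain col z m where s: "pr t = (col, z, m)" by (metis prod_cases3)
    define K where "K c = {x \<in> S. col x = c}" for c
    have K: "cls (pr t) = K" by (auto simp: cls_def K_def s)
    from Suc obtain dep j where m: "m = 2 * j + 1" "\<And>x. x \<in> S \<Longrightarrow> col x < m"
      and sp: "\<And>c. separated W (dep c) z (K c)" and small: "\<And>c. c < t \<Longrightarrow> card (K c) \<le> 1"
      and sm: "(\<Sum>c\<in>{t..<m}. nodes W (dep c) z (K c)) + j \<le> nodes W d y S"
      unfolding Inv_def K unfolding s fst_conv snd_conv by blast
    show ?case
    proof (cases "2 \<le> card (K t)")
      case False
      then have "pr (Suc t) = (col, z, m)" using s K by (simp add: pr_def)
      moreover have "(\<Sum>c\<in>{Suc t..<m}. nodes W (dep c) z (K c)) \<le> (\<Sum>c\<in>{t..<m}. nodes W (dep c) z (K c))"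
        by (rule sum_mono2) auto
      moreover have "card (K c) \<le> 1" if "c < Suc t" for c
        using small[of c] False that by (cases "c = t") auto
      ultimately show ?thesis
        unfolding Inv_def using m sp sm K[symmetric]
        by (intro exI[of _ dep] exI[of _ j]) (auto simp: cls_def s)
    next
      case True
      then obtain x0 where "x0 \<in> K t" by (metis card.empty ex_in_conv not_numeral_le_zero)
      then have tm: "t < m" using m(2) by (auto simp: K_def)
      define col' where "col' x = (if col x = t then m + of_bool (W \<le> 2 * z x) else col x)" for x
      define z' where "z' x = (if col x = t then dbl W z x else z x)" for x
      have s': "pr (Suc t) = (col', z', m + 2)"
        using True s K by (simp add: pr_def split_class_def col'_def z'_def dbl_def fun_eq_iff)
      define K' where "K' c = {x \<in> S. col' x = c}" for c
      have K': "cls (pr (Suc t)) = K'" by (auto simp: cls_def K'_def s')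
      have Kt: "K' t = {}" using tm m(2) by (auto simp: K'_def col'_def)
      have ne: "col x \<noteq> m" "col x \<noteq> Suc m" "\<not> m \<le> col x" if "x \<in> S" for x using m(2)[OF that] by simp_all
      have Km: "K' m = half W z False (K t)" "K' (Suc m) = half W z True (K t)"
        using ne by (auto simp: K'_def K_def col'_def half_def)
      have Ko: "K' c = K c" if "c \<noteq> t" "c < m" for c
        using that by (auto simp: K'_def K_def col'_def)
      have Kbig: "K' c = {}" if "c \<ge> m + 2" for c
        using that ne by (fastforce simp: K'_def col'_def of_bool_def split: if_splits)
      obtain e where e: "dep t = Suc e" using sp[of t] True by (cases "dep t") auto
      define dep' where "dep' c = (if c = m \<or> c = Suc m then e else dep c)" for c
      have zc: "nodes W i z' (K' c) = nodes W i z (K' c)" "separated W i z' (K' c) = separated W i z (K' c)"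
        if "c < m" for c i
        by (rule nodes_cong separated_cong; use that in \<open>auto simp: K'_def col'_def z'_def split: if_splits\<close>)+
      have zd: "nodes W i z' (K' c) = nodes W i (dbl W z) (K' c)"
        "separated W i z' (K' c) = separated W i (dbl W z) (K' c)" if "c \<ge> m" for c i
        by (rule nodes_cong separated_cong; use that ne in \<open>fastforce simp: K'_def col'_def z'_def split: if_splits\<close>)+
      have sep': "separated W (dep' c) z' (K' c)" for c
      proof -
        consider "c = t" | "c \<noteq> t" "c < m" | "c = m" | "c = Suc m" | "c \<ge> m + 2" by linarith
        then show ?thesis
        proof cases
          case 2
          then show ?thesis using sp[of c] zc(2)[of c] Ko[of c] by (simp add: dep'_def)
        next
          case 3
          then show ?thesis using sp[of t] True zd(2)[of m] Km e by (simp add: dep'_def)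
        next
          case 4
          then show ?thesis using sp[of t] True zd(2)[of "Suc m"] Km e by (simp add: dep'_def)
        qed (use Kt Kbig in \<open>auto intro: separated_small\<close>)
      qed
      have small': "card (K' c) \<le> 1" if "c < Suc t" for c
        using small[of c] Ko[of c] Kt that tm by (cases "c = t") auto
      have "(\<Sum>c\<in>{Suc t..<m + 2}. nodes W (dep' c) z' (K' c)) =
          (\<Sum>c\<in>{Suc t..<m}. nodes W (dep' c) z' (K' c)) + nodes W e z' (K' m) + nodes W e z' (K' (Suc m))"
        using tm by (simp add: dep'_def)
      also have "(\<Sum>c\<in>{Suc t..<m}. nodes W (dep' c) z' (K' c)) = (\<Sum>c\<in>{Suc t..<m}. nodes W (dep c) z (K c))"
      proof (intro sum.cong refl)
        fix c assume "c \<in> {Suc t..<m}"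
        then show "nodes W (dep' c) z' (K' c) = nodes W (dep c) z (K c)"
          using zc(1)[of c "dep c"] Ko[of c] by (simp add: dep'_def)
      qed
      finally have "Suc (\<Sum>c\<in>{Suc t..<m + 2}. nodes W (dep' c) z' (K' c)) =
        (\<Sum>c\<in>{Suc t..<m}. nodes W (dep c) z (K c)) + nodes W (dep t) z (K t)"
        using e True zd(1)[of m e] zd(1)[of "Suc m" e] Km by (simp del: sum.op_ivl_Suc)
      also have "\<dots> = (\<Sum>c\<in>{t..<m}. nodes W (dep c) z (K c))"
        using tm by (simp add: sum.atLeast_Suc_lessThan)
      finally have sm': "(\<Sum>c\<in>{Suc t..<m + 2}. nodes W (dep' c) z' (K' c)) + Suc j \<le> nodes W d y S"
        using sm by simp
      have "\<forall>x\<in>S. col' x < m + 2" using m(2) by (auto simp: col'_def intro: less_SucI)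
      then show ?thesis
        unfolding Inv_def K' using m(1) sep' small' sm'
        by (intro exI[of _ dep'] exI[of _ "Suc j"]) (simp add: s')
    qed
  qed
  from this[of B] obtain j where m: "snd (snd (pr B)) = 2 * j + 1" "\<forall>x\<in>S. fst (pr B) x < snd (snd (pr B))"
    and small: "\<forall>c<B. card (cls (pr B) c) \<le> 1" and "j \<le> nodes W d y S"
    unfolding Inv_def by auto
  \<comment> \<open>All colours are below \<open>2 * j + 1\<close>, hence below \<open>B\<close>, so
    every class in use has been inspected and has at most one element.\<close>
  then have lt: "fst (pr B) x < B" if "x \<in> S" for x using that B by fastforce
  have "inj_on (fst (pr B)) S"
  proof (rule inj_onI)
    fix x x' assume x: "x \<in> S" "x' \<in> S" "fst (pr B) x = fst (pr B) x'"
    let ?C = "cls (pr B) (fst (pr B) x)"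
    have "finite ?C" "x \<in> ?C" "x' \<in> ?C" "card ?C \<le> 1" using S x small lt by (auto simp: cls_def)
    then show "x = x'" by (metis One_nat_def card_le_Suc0_iff_eq)
  qed
  then show ?thesis unfolding pr by blast
qed

section \<open>Binary prefixes and their collisions\<close>

definition prefix :: "nat \<Rightarrow> nat \<Rightarrow> (nat \<Rightarrow> nat) \<Rightarrow> nat \<Rightarrow> nat" where
  "prefix W l y x = 2 ^ l * y x div W"

definition collisions :: "nat \<Rightarrow> nat \<Rightarrow> (nat \<Rightarrow> nat) \<Rightarrow> nat set \<Rightarrow> (nat \<times> nat) set" where
  "collisions W l y Y = {(x, x'). x \<in> Y \<and> x' \<in> Y \<and> x < x' \<and> prefix W l y x = prefix W l y x'}"

lemma finite_collisions: "finite Y \<Longrightarrow> finite (collisions W l y Y)"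
  by (rule finite_subset[of _ "Y \<times> Y"]) (auto simp: collisions_def)

lemma dbl_less: "y x < W \<Longrightarrow> dbl W y x < W"
  by (auto simp: dbl_def)

lemma prefix_Suc:
  assumes "y x < W"
  shows "prefix W (Suc l) y x = 2 ^ l * of_bool (W \<le> 2 * y x) + prefix W l (dbl W y) x"
proof -
  have eq: "2 * y x = W * of_bool (W \<le> 2 * y x) + dbl W y x" by (auto simp: dbl_def)
  have "2 ^ Suc l * y x = 2 ^ l * (2 * y x)" by simp
  also have "\<dots> = 2 ^ l * (W * of_bool (W \<le> 2 * y x) + dbl W y x)" by (rule arg_cong[OF eq])
  also have "\<dots> = 2 ^ l * of_bool (W \<le> 2 * y x) * W + 2 ^ l * dbl W y x"
    by (simp only: add_mult_distrib2 mult_ac)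
  finally show ?thesis using assms unfolding prefix_def by simp
qed

text \<open>Elements of one half share their first digit, so agreeing on \<open>l\<close> further
  digits means agreeing on \<open>l + 1\<close> digits; the pairs from the two halves are
  disjoint.\<close>

lemma collisions_half:
  assumes "finite Y" "\<And>x. x \<in> Y \<Longrightarrow> y x < W"
  shows "card (collisions W l (dbl W y) (half W y False Y)) + card (collisions W l (dbl W y) (half W y True Y))
    \<le> card (collisions W (Suc l) y Y)"
proof -
  let ?A = "\<lambda>b. collisions W l (dbl W y) (half W y b Y)"
  have fin: "finite (?A b)" for b using assms(1) by (intro finite_collisions) (simp add: half_def)
  have "card (?A False) + card (?A True) = card (?A False \<union> ?A True)"
    by (rule card_Un_disjoint[symmetric, OF fin fin]) (auto simp: collisions_def half_def)
  also have "\<dots> \<le> card (collisions W (Suc l) y Y)"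
    using assms by (intro card_mono finite_collisions) (auto simp: collisions_def half_def prefix_Suc)
  finally show ?thesis .
qed

lemma collisions_0:
  assumes "finite Y" "\<And>x. x \<in> Y \<Longrightarrow> y x < W" "2 \<le> card Y"
  shows "1 \<le> card (collisions W 0 y Y)"
proof -
  obtain x x' where "x \<in> Y" "x' \<in> Y" "x \<noteq> x'"
    using assms(1,3) by (metis One_nat_def Suc_1 card_le_Suc0_iff_eq not_less_eq_eq)
  then obtain x x' where "x \<in> Y" "x' \<in> Y" "x < x'" by (metis linorder_neqE_nat)
  then have "(x, x') \<in> collisions W 0 y Y" using assms(2) by (simp add: collisions_def prefix_def)
  then show ?thesis
    using finite_collisions[OF assms(1)] by (metis One_nat_def Suc_leI card_gt_0_iff empty_iff)
qed

text \<open>An inner node at depth \<open>l\<close> contains a pair with equal prefixes of length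
  \<open>l\<close>, and nodes of the same depth contain disjoint sets of elements.\<close>

lemma nodes_le_collisions:
  assumes "finite Y" "\<And>x. x \<in> Y \<Longrightarrow> y x < W"
  shows "nodes W d y Y \<le> (\<Sum>l<d. card (collisions W l y Y))"
  using assms
proof (induction d arbitrary: y Y)
  case (Suc d)
  show ?case
  proof (cases "card Y \<le> 1")
    case False
    let ?A = "\<lambda>l b. card (collisions W l (dbl W y) (half W y b Y))"
    have "nodes W d (dbl W y) (half W y b Y) \<le> (\<Sum>l<d. ?A l b)" for b
      using Suc.prems by (intro Suc.IH) (auto simp: half_def dbl_less)
    then have "nodes W (Suc d) y Y \<le> 1 + ((\<Sum>l<d. ?A l False) + (\<Sum>l<d. ?A l True))"
      using False by (simp add: add_mono)
    also have "\<dots> = 1 + (\<Sum>l<d. ?A l False + ?A l True)" by (simp add: sum.distrib)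
    also have "\<dots> \<le> card (collisions W 0 y Y) + (\<Sum>l<d. card (collisions W (Suc l) y Y))"
      using Suc.prems False by (intro add_mono sum_mono collisions_half collisions_0) auto
    also have "\<dots> = (\<Sum>l<Suc d. card (collisions W l y Y))"
      by (simp add: sum.lessThan_Suc_shift del: sum.lessThan_Suc)
    finally show ?thesis .
  qed simp
qed simp

text \<open>The top \<open>l0\<close> levels have fewer than \<open>2 ^ l0\<close> nodes however the
  elements lie. Counting collisions there as well would cost a bound quadratic in the number of
  elements.\<close>

lemma nodes_le:
  assumes "finite Y" "\<And>x. x \<in> Y \<Longrightarrow> y x < W"
  shows "nodes W (l0 + d) y Y < 2 ^ l0 + (\<Sum>l<d. card (collisions W (l0 + l) y Y))"
  using assms
proof (induction l0 arbitrary: y Y)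
  case 0
  then show ?case using nodes_le_collisions[of Y y W d] by simp
next
  case (Suc l0)
  let ?A = "\<lambda>l b. card (collisions W l (dbl W y) (half W y b Y))"
  have IH: "nodes W (l0 + d) (dbl W y) (half W y b Y) < 2 ^ l0 + (\<Sum>l<d. ?A (l0 + l) b)" for b
    using Suc.prems by (intro Suc.IH) (auto simp: half_def dbl_less)
  have "nodes W (Suc l0 + d) y Y \<le> Suc (nodes W (l0 + d) (dbl W y) (half W y False Y) +
      nodes W (l0 + d) (dbl W y) (half W y True Y))" by simp
  also have "\<dots> < 2 ^ Suc l0 + ((\<Sum>l<d. ?A (l0 + l) False) + (\<Sum>l<d. ?A (l0 + l) True))"
    using IH[of False] IH[of True] by simp
  also have "(\<Sum>l<d. ?A (l0 + l) False) + (\<Sum>l<d. ?A (l0 + l) True) =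
      (\<Sum>l<d. ?A (l0 + l) False + ?A (l0 + l) True)" by (simp add: sum.distrib)
  also have "\<dots> \<le> (\<Sum>l<d. card (collisions W (Suc (l0 + l)) y Y))"
    using Suc.prems by (intro sum_mono collisions_half) auto
  finally show ?case by simp
qed

lemma separated_if_no_collision:
  assumes "finite Y" "\<And>x. x \<in> Y \<Longrightarrow> y x < W" "collisions W d y Y = {}"
  shows "separated W d y Y"
  using assms
proof (induction d arbitrary: y Y)
  case 0
  then show ?case using collisions_0[of Y y W] by fastforce
next
  case (Suc d)
  have "card (collisions W d (dbl W y) (half W y b Y)) = 0" for b
    using collisions_half[of Y y W d] Suc.prems by (cases b) auto
  note * = this
  have "collisions W d (dbl W y) (half W y b Y) = {}" for b
  proof -
    have "finite (half W y b Y)" using Suc.prems(1) by (simp add: half_def)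
    then show ?thesis using *[of b] finite_collisions by auto
  qed
  then have "separated W d (dbl W y) (half W y b Y)" for b
    using Suc.prems by (intro Suc.IH) (auto simp: half_def dbl_less)
  then show ?case by simp
qed

lemma prefix_eq_close:
  assumes "prefix W l y x = prefix W l y x'" "0 < W"
  shows "2 ^ l * \<bar>int (y x') - int (y x)\<bar> < int W"
proof -
  let ?a = "2 ^ l * y x" and ?b = "2 ^ l * y x'"
  have "?a div W = ?b div W" using assms(1) by (simp add: prefix_def)
  then have "?a = W * (?b div W) + ?a mod W" "?b = W * (?b div W) + ?b mod W"
    by (metis mult_div_mod_eq)+
  moreover have "?a mod W < W" "?b mod W < W" using assms(2) by simp_all
  ultimately have "\<bar>int ?b - int ?a\<bar> < int W" by linarith
  also have "\<bar>int ?b - int ?a\<bar> = \<bar>2 ^ l * (int (y x') - int (y x))\<bar>" by (simp add: algebra_simps)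
  also have "\<dots> = 2 ^ l * \<bar>int (y x') - int (y x)\<bar>" by (simp add: abs_mult)
  finally show ?thesis .
qed

lemma card_le_diameter:
  fixes A :: "nat set"
  assumes "\<And>a a'. a \<in> A \<Longrightarrow> a' \<in> A \<Longrightarrow> a \<le> a' \<Longrightarrow> a' - a \<le> D"
  shows "card A \<le> D + 1"
proof (cases "A = {}")
  case False
  let ?m = "LEAST a. a \<in> A"
  have m: "?m \<in> A" "\<And>a. a \<in> A \<Longrightarrow> ?m \<le> a" using False by (auto intro: LeastI Least_le)
  have "A \<subseteq> {?m..?m + D}" using m assms[of ?m] by fastforce
  then have "card A \<le> card {?m..?m + D}" by (intro card_mono) auto
  then show ?thesis by simp
qed simp

text \<open>If \<open>a x\<close> and \<open>a x'\<close> are close modulo \<open>W\<close>, then \<open>a\<close> lies near one of the \<open>x' - x + 1\<close> points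
  \<open>j W / (x' - x)\<close>.\<close>

lemma card_collision_multipliers:
  assumes x: "x < x'" "x' < V" and W: "0 < W"
  shows "card {a. a < W \<and> prefix W l (\<lambda>x. a * x mod W) x = prefix W l (\<lambda>x. a * x mod W) x'}
    \<le> 4 * W div 2 ^ l + V"
proof -
  define z where "z = x' - x"
  have z: "0 < z" "z < V" "x' = x + z" using x by (auto simp: z_def)
  define A where "A j = {a. a < W \<and> 2 ^ l * \<bar>int a * int z - int j * int W\<bar> < int W}" for j
  let ?C = "{a. a < W \<and> prefix W l (\<lambda>x. a * x mod W) x = prefix W l (\<lambda>x. a * x mod W) x'}"
  have sub: "?C \<subseteq> (\<Union>j\<in>{..z}. A j)"
  proof
    fix a assume a: "a \<in> ?C"
    define j where "j = a * x' div W - a * x div W"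
    have le: "a * x div W \<le> a * x' div W" by (intro div_le_mono mult_le_mono2) (simp add: z)
    have e: "int (a * x' mod W) - int (a * x mod W) = int a * int z - int j * int W"
    proof -
      have "int (a * x') = int W * int (a * x' div W) + int (a * x' mod W)"
        "int (a * x) = int W * int (a * x div W) + int (a * x mod W)"
        by (metis mult_div_mod_eq of_nat_add of_nat_mult)+
      moreover have "int j = int (a * x' div W) - int (a * x div W)" using le by (simp add: j_def)
      then have "int j * int W = int W * int (a * x' div W) - int W * int (a * x div W)"
        by (simp only: right_diff_distrib mult.commute)
      moreover have "int a * int z = int (a * x') - int (a * x)" by (simp add: z distrib_left)
      ultimately show ?thesis by linarith
    qed
    have "2 ^ l * \<bar>int a * int z - int j * int W\<bar> < int W"
      using prefix_eq_close[of W l "\<lambda>x. a * x mod W" x x'] a W unfolding e[symmetric] by simp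
    moreover have "j \<le> z"
    proof (rule ccontr)
      assume "\<not> j \<le> z"
      then have "int (z + 1) * int W \<le> int j * int W" by (intro mult_right_mono) auto
      moreover have "int a * int z \<le> int W * int z" using a by (intro mult_right_mono) auto
      moreover have "int (a * x' mod W) - int (a * x mod W) > - int W"
        using mod_less_divisor[OF W, of "a * x"] by linarith
      ultimately show False unfolding e by (simp add: algebra_simps)
    qed
    ultimately show "a \<in> (\<Union>j\<in>{..z}. A j)" using a by (auto simp: A_def)
  qed
  \<comment> \<open>Membership in \<open>A j\<close> confines \<open>a\<close> to an open interval
    of length \<open>2 * W / (2 ^ l * z)\<close> around \<open>j * W / z\<close>.\<close>
  let ?D = "2 * W div (2 ^ l * z)"
  have cA: "card (A j) \<le> ?D + 1" for j
  proof (rule card_le_diameter)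
    fix a a' assume a: "a \<in> A j" "a' \<in> A j" "a \<le> a'"
    have "2 ^ l * (int a' * int z - int a * int z) \<le>
        2 ^ l * (\<bar>int a' * int z - int j * int W\<bar> + \<bar>int a * int z - int j * int W\<bar>)"
      by (intro mult_left_mono) (linarith, simp)
    also have "\<dots> < 2 * int W" using a by (simp add: A_def distrib_left)
    finally have "int ((a' - a) * (2 ^ l * z)) < int (2 * W)"
      using a(3) by (simp add: of_nat_diff algebra_simps)
    then have "(a' - a) * (2 ^ l * z) \<le> 2 * W" by linarith
    then show "a' - a \<le> ?D" using z(1) by (simp add: less_eq_div_iff_mult_less_eq)
  qed
  have "card ?C \<le> card (\<Union>j\<in>{..z}. A j)" by (rule card_mono[OF _ sub]) (auto simp: A_def)
  also have "\<dots> \<le> (\<Sum>j\<in>{..z}. card (A j))" by (rule card_UN_le) simp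
  also have "\<dots> \<le> (\<Sum>j\<in>{..z}. ?D + 1)" by (rule sum_mono) (rule cA)
  also have "\<dots> = (z + 1) * ?D + (z + 1)" by simp
  also have "\<dots> \<le> 4 * W div 2 ^ l + V"
  proof (rule add_mono)
    \<comment> \<open>By \<open>z + 1 \<le> 2 * z\<close> the number of intervals cancels against
      their length, leaving a bound independent of \<open>z\<close>; the rounding error of 1 per
      interval makes up the summand \<open>V\<close>.\<close>
    have "(z + 1) * ?D * 2 ^ l \<le> (2 * z) * ?D * 2 ^ l" using z(1) by (intro mult_le_mono) auto
    also have "\<dots> = 2 * (?D * (2 ^ l * z))" by simp
    also have "\<dots> \<le> 2 * (2 * W)" by (intro mult_le_mono2) simp
    finally have "(z + 1) * ?D * 2 ^ l \<le> 4 * W" by simp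
    then show "(z + 1) * ?D \<le> 4 * W div 2 ^ l" by (simp add: less_eq_div_iff_mult_less_eq)
  qed (use z in simp)
  finally show ?thesis .
qed

lemma sum_collisions:
  assumes S: "finite S" "S \<subseteq> {..<V}" and W: "0 < W"
  shows "(\<Sum>a<W. card (collisions W l (\<lambda>x. a * x mod W) S)) \<le> card S ^ 2 * (4 * W div 2 ^ l + V)"
proof -
  let ?P = "{p \<in> S \<times> S. fst p < snd p}"
  let ?c = "\<lambda>a p. prefix W l (\<lambda>x. a * x mod W) (fst p) = prefix W l (\<lambda>x. a * x mod W) (snd p)"
  have finP: "finite ?P" using S(1) by simp
  have "card (collisions W l (\<lambda>x. a * x mod W) S) = (\<Sum>p\<in>?P. of_bool (?c a p))" for a
  proof -
    have "collisions W l (\<lambda>x. a * x mod W) S = {p \<in> ?P. ?c a p}" by (auto simp: collisions_def)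
    then show ?thesis using finP by (simp add: sum.If_cases of_bool_def Int_def)
  qed
  then have "(\<Sum>a<W. card (collisions W l (\<lambda>x. a * x mod W) S)) = (\<Sum>p\<in>?P. \<Sum>a<W. of_bool (?c a p))"
    by (simp add: sum.swap[of _ ?P])
  also have "\<dots> \<le> (\<Sum>p\<in>?P. 4 * W div 2 ^ l + V)"
  proof (rule sum_mono)
    fix p assume p: "p \<in> ?P"
    have "(\<Sum>a<W. of_bool (?c a p) :: nat) = card {a. a < W \<and> ?c a p}"
      by (simp add: sum.If_cases of_bool_def Int_def)
    also have "\<dots> \<le> 4 * W div 2 ^ l + V"
      using p S(2) W by (intro card_collision_multipliers) auto
    finally show "(\<Sum>a<W. of_bool (?c a p)) \<le> 4 * W div 2 ^ l + V" .
  qed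
  also have "\<dots> = card ?P * (4 * W div 2 ^ l + V)" by simp
  also have "\<dots> \<le> card S ^ 2 * (4 * W div 2 ^ l + V)"
    using card_mono[of "S \<times> S" ?P] S(1) by (intro mult_le_mono1) (auto simp: card_cartesian_product power2_eq_square)
  finally show ?thesis .
qed

lemma sum_div_pow2_le: "(\<Sum>l<d. X div 2 ^ (l0 + l)) * 2 ^ l0 \<le> 2 * (X::nat)"
proof -
  have "(\<Sum>l<d. X div 2 ^ l) + 2 * (X div 2 ^ d) \<le> 2 * X" for X d :: nat
  proof (induction d)
    case (Suc d)
    have "X div 2 ^ Suc d = X div 2 ^ d div 2" by (simp only: power_Suc2 div_mult2_eq)
    then have "2 * (X div 2 ^ Suc d) \<le> X div 2 ^ d" by simp
    then show ?case using Suc by simp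
  qed simp
  then have *: "(\<Sum>l<d. X div 2 ^ l) \<le> 2 * X" for X d :: nat using add_leE by blast
  have "(\<Sum>l<d. X div 2 ^ (l0 + l)) = (\<Sum>l<d. X div 2 ^ l0 div 2 ^ l)"
    by (simp add: power_add div_mult2_eq)
  also have "\<dots> \<le> 2 * (X div 2 ^ l0)" by (rule *)
  finally have "(\<Sum>l<d. X div 2 ^ (l0 + l)) * 2 ^ l0 \<le> 2 * (X div 2 ^ l0 * 2 ^ l0)" by simp
  also have "\<dots> \<le> 2 * X" by (intro mult_le_mono2) simp
  finally show ?thesis .
qed

lemma exists_less_average:
  fixes f :: "nat \<Rightarrow> nat"
  assumes "(\<Sum>a<W. f a) < M * W"
  shows "\<exists>a<W. f a < M"
proof (rule ccontr)
  assume "\<not> ?thesis"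
  then have "(\<Sum>a<W. M) \<le> (\<Sum>a<W. f a)" by (intro sum_mono) auto
  then show False using assms by (simp add: mult.commute)
qed

text \<open>Averaging over the multipliers. With \<open>c \<le> 2 ^ l0 \<le> 2 * c\<close>, the
  levels above \<open>l0\<close> have fewer than \<open>2 * c\<close> nodes, and on average the
  levels from \<open>l0\<close> on have at most \<open>8 * c + 1\<close> collisions, by a geometric
  series. A multiplier with weighted count below \<open>16 * c + 3\<close> gives fewer than
  \<open>18 * c + 3\<close> nodes; doubling this yields \<open>36 * s + 7\<close>.\<close>

theorem colouring_injective:
  assumes S: "S \<subseteq> {..<V}" "S \<noteq> {}" "card S \<le> s" and W: "W = (V + 4) ^ 6" and B: "36 * s + 7 \<le> B"
  shows "\<exists>a<W. \<exists>T. inj_on (fst (colouring W (\<lambda>x. a * x mod W) T B)) S"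
proof -
  define c where "c = card S"
  have finS: "finite S" using S(1) finite_subset by blast
  have c1: "1 \<le> c" using S(2) finS by (simp add: c_def Suc_leI card_gt_0_iff)
  define N where "N = V + 4"
  have WN: "W = N ^ 6" and W0: "0 < W" by (simp_all add: W N_def)
  have cV: "c \<le> V" using card_mono[OF _ S(1)] by (simp add: c_def)
  have "\<exists>l. c \<le> 2 ^ l" by (intro exI[of _ c]) simp
  then obtain l0 where l0: "c \<le> 2 ^ l0" and least: "\<And>l. l < l0 \<Longrightarrow> \<not> c \<le> 2 ^ l"
    using exists_least_iff[of "\<lambda>l. c \<le> 2 ^ l"] by blast
  have l0': "2 ^ l0 \<le> 2 * c"
    using least[of "l0 - 1"] c1 by (cases l0) auto
  define d where "d = 6 * N"
  \<comment> \<open>Collisions at the last level are weighted by \<open>M\<close>, so a count below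
    \<open>M\<close> both excludes them and bounds the others. They number at most
    \<open>W div 2\<close> over all multipliers, and \<open>16 * c + 3\<close> is the least
    \<open>M\<close> with \<open>16 * c + 2 + M < 2 * M\<close>.\<close>
  define M where "M = 16 * c + 3"
  have dW: "W \<le> 2 ^ d"
  proof -
    have "N ^ 6 \<le> (2 ^ N) ^ 6" by (intro power_mono) auto
    then show ?thesis by (simp add: WN d_def power_mult[symmetric] mult.commute)
  qed
  let ?y = "\<lambda>a x. a * x mod W"
  let ?cc = "\<lambda>l a. card (collisions W l (?y a) S)"
  let ?f = "\<lambda>a. (\<Sum>l<d. ?cc (l0 + l) a) + M * ?cc (l0 + d) a"
  have c2N: "c ^ 2 \<le> N ^ 2" using cV by (intro power_mono) (auto simp: N_def)
  have t1: "(\<Sum>a<W. \<Sum>l<d. ?cc (l0 + l) a) \<le> 8 * c * W + W"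
  proof -
    have "(\<Sum>a<W. \<Sum>l<d. ?cc (l0 + l) a) = (\<Sum>l<d. \<Sum>a<W. ?cc (l0 + l) a)" by (rule sum.swap)
    also have "\<dots> \<le> (\<Sum>l<d. c ^ 2 * (4 * W div 2 ^ (l0 + l) + V))"
      unfolding c_def by (intro sum_mono sum_collisions finS S(1) W0)
    also have "\<dots> = c ^ 2 * (\<Sum>l<d. 4 * W div 2 ^ (l0 + l)) + c ^ 2 * d * V"
      by (simp add: sum.distrib sum_distrib_left[symmetric] distrib_left)
    also have "\<dots> \<le> 8 * c * W + W"
    proof (rule add_mono)
      have "c * (\<Sum>l<d. 4 * W div 2 ^ (l0 + l)) \<le> 2 ^ l0 * (\<Sum>l<d. 4 * W div 2 ^ (l0 + l))"
        by (intro mult_le_mono1 l0)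
      also have "\<dots> \<le> 2 * (4 * W)" using sum_div_pow2_le[of "4 * W" l0 d] by (simp add: mult.commute)
      finally have "c * (c * (\<Sum>l<d. 4 * W div 2 ^ (l0 + l))) \<le> c * (8 * W)" by (intro mult_le_mono2) simp
      then show "c ^ 2 * (\<Sum>l<d. 4 * W div 2 ^ (l0 + l)) \<le> 8 * c * W"
        by (simp add: power2_eq_square mult_ac)
      \<comment> \<open>The summand \<open>V\<close> of the collision bound accumulates over
        \<open>d\<close> levels and \<open>c ^ 2\<close> pairs; the exponent 6 of \<open>W\<close>
        is large enough to absorb it.\<close>
      have "c ^ 2 * d * V \<le> N ^ 2 * (6 * N) * N"
        using c2N by (intro mult_le_mono) (auto simp: d_def N_def)
      also have "\<dots> = 6 * N ^ 4" by (simp add: power2_eq_square power4_eq_xxxx)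
      also have "\<dots> \<le> N ^ 2 * N ^ 4"
        using power_mono[of 4 N 2] by (intro mult_le_mono1) (simp add: N_def)
      also have "\<dots> = W" by (simp add: WN power_add[symmetric])
      finally show "c ^ 2 * d * V \<le> W" .
    qed
    finally show ?thesis .
  qed
  have t2: "2 * (\<Sum>a<W. ?cc (l0 + d) a) \<le> W"
  proof -
    have "4 * W div 2 ^ (l0 + d) \<le> 4"
    proof -
      have "4 * W \<le> 4 * 2 ^ (l0 + d)"
        using dW by (intro mult_le_mono2) (metis add.commute le_trans one_le_numeral power_increasing le_add1)
      then have "4 * W div 2 ^ (l0 + d) \<le> 4 * 2 ^ (l0 + d) div 2 ^ (l0 + d)" by (rule div_le_mono)
      then show ?thesis by simp
    qed
    then have "c ^ 2 * (4 * W div 2 ^ (l0 + d) + V) \<le> N ^ 2 * N"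
      using c2N by (intro mult_le_mono) (auto simp: N_def)
    moreover have "(\<Sum>a<W. ?cc (l0 + d) a) \<le> c ^ 2 * (4 * W div 2 ^ (l0 + d) + V)"
      unfolding c_def by (rule sum_collisions[OF finS S(1) W0])
    ultimately have "2 * (\<Sum>a<W. ?cc (l0 + d) a) \<le> 2 * (N ^ 2 * N)" by linarith
    also have "\<dots> \<le> N ^ 3 * (N ^ 2 * N)"
      using power_mono[of 4 N 3] by (intro mult_le_mono1) (simp add: N_def)
    also have "\<dots> = W" by (simp add: WN eval_nat_numeral)
    finally show ?thesis .
  qed
  have "(\<Sum>a<W. ?f a) = (\<Sum>a<W. \<Sum>l<d. ?cc (l0 + l) a) + M * (\<Sum>a<W. ?cc (l0 + d) a)"
    by (simp add: sum.distrib sum_distrib_left)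
  then have "2 * (\<Sum>a<W. ?f a) \<le> 2 * (8 * c * W + W) + M * W"
    using t1 mult_le_mono2[OF t2, of M] by (simp only: mult.left_commute[of 2 M] distrib_left add_mono mult_le_mono2)
  also have "\<dots> = (16 * c + 2 + M) * W" by (simp add: algebra_simps)
  also have "\<dots> < (2 * M) * W" using W0 by (intro mult_strict_right_mono) (simp_all add: M_def)
  finally have "(\<Sum>a<W. ?f a) < M * W" by simp
  from exists_less_average[OF this] obtain a where a: "a < W" "?f a < M" by blast
  have y: "?y a x < W" for x using W0 by simp
  have "?cc (l0 + d) a = 0"
  proof (rule ccontr)
    assume "?cc (l0 + d) a \<noteq> 0"
    then have "M * 1 \<le> M * ?cc (l0 + d) a" by (intro mult_le_mono2) simp
    then show False using a(2) by linarith
  qed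
  then have "collisions W (l0 + d) (?y a) S = {}" using finite_collisions[OF finS] by simp
  then have sep: "separated W (l0 + d) (?y a) S" by (intro separated_if_no_collision finS y)
  have "nodes W (l0 + d) (?y a) S < 2 ^ l0 + (\<Sum>l<d. ?cc (l0 + l) a)" by (intro nodes_le finS y)
  also have "\<dots> \<le> 2 * c + M" using l0' a(2) by linarith
  finally have "2 * nodes W (l0 + d) (?y a) S + 1 \<le> B"
    using B S(3) unfolding M_def c_def by linarith
  from colouring_separates[OF finS sep this] a(1) show ?thesis by blast
qed

section \<open>Linear forests in the root graph\<close>

text \<open>\<open>C\<close> is the set of colours used, \<open>v\<close> the last vertex,
  \<open>e\<close> the number of edges walked. Remembering colours instead of vertices keeps the
  table small, and a fresh colour guarantees a fresh vertex. As jumps happen only at even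
  \<open>e\<close>, every component left behind has an even number of edges; isolated vertices do no
  harm.\<close>

inductive reach :: "nat \<Rightarrow> (nat \<Rightarrow> nat \<Rightarrow> bool) \<Rightarrow> (nat \<Rightarrow> nat) \<Rightarrow> nat set \<Rightarrow> nat \<Rightarrow> nat \<Rightarrow> bool"
  for V E col where
  start: "w < V \<Longrightarrow> reach V E col {col w} w 0"
| step: "reach V E col C v e \<Longrightarrow> E v w \<Longrightarrow> w < V \<Longrightarrow> col w \<notin> C \<Longrightarrow>
    reach V E col (insert (col w) C) w (Suc e)"
| jump: "reach V E col C v e \<Longrightarrow> even e \<Longrightarrow> w < V \<Longrightarrow> col w \<notin> C \<Longrightarrow>
    reach V E col (insert (col w) C) w e"

lemma all_less_Suc: "(\<forall>i<Suc m. P i) \<longleftrightarrow> P 0 \<and> (\<forall>i<m. P (Suc i))"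
  by (metis Suc_less_eq not0_implies_Suc zero_less_Suc)

text \<open>The graph embeds in a path: on a cycle, the vertex of largest index would have two
  different neighbours with the same index, one less than its own.\<close>

lemma acyclic_if_index:
  assumes inj: "inj_on f (verts G)"
    and edge: "\<And>u v. {u, v} \<in> edges G \<Longrightarrow> f v = Suc (f u) \<or> f u = Suc (f v)"
  shows "acyclic_graph G"
  unfolding acyclic_graph_def
proof
  assume "\<exists>vs. is_cycle G vs"
  then obtain vs where vs: "3 \<le> length vs" "distinct vs" "set vs \<subseteq> verts G"
    and e: "\<And>i. i < length vs \<Longrightarrow> {vs ! i, vs ! (Suc i mod length vs)} \<in> edges G"
    unfolding is_cycle_def by blast
  let ?l = "length vs"
  have "Max (f ` set vs) \<in> f ` set vs" using vs(1) by (intro Max_in) auto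
  then obtain i where i: "i < ?l" "f (vs ! i) = Max (f ` set vs)" by (auto simp: in_set_conv_nth)
  have le: "f (vs ! j) \<le> f (vs ! i)" if "j < ?l" for j
    using that unfolding i(2) by (intro Max_ge) auto
  define a where "a = Suc i mod ?l"
  define b where "b = (if i = 0 then ?l - 1 else i - 1)"
  have ab: "a < ?l" "b < ?l" "Suc b mod ?l = i" 
    using i(1) vs(1) mod_less_divisor[of ?l "Suc i"]
    by (fastforce simp: a_def b_def)+
  have "a \<noteq> b"
  proof (cases "Suc i = ?l")
    case True
    then show ?thesis using vs(1) by (auto simp: a_def b_def)
  next
    case False
    then show ?thesis using vs(1) i(1) by (auto simp: a_def b_def)
  qed
  moreover have "f (vs ! i) = Suc (f (vs ! a))"
    using edge[OF e[OF i(1)]] le[OF ab(1)] unfolding a_def by auto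
  moreover have "f (vs ! i) = Suc (f (vs ! b))"
    using edge[OF e[OF ab(2)]] le[OF ab(2)] unfolding ab(3) by auto
  ultimately have "vs ! a = vs ! b"
    using inj vs(3) ab(1,2) by (metis inj_onD nat.inject nth_mem subsetD)
  with \<open>a \<noteq> b\<close> show False using vs(2) ab(1,2) by (simp add: nth_eq_iff_index_eq)
qed

text \<open>The root graph stays implicit. A vertex \<open>u\<close> of \<open>G\<close> is an edge
  of it, \<open>en u\<close> is the pair of its ends, and the root vertices are numbers below
  \<open>V\<close>.\<close>

locale root_labelling =
  fixes G :: "nat ugraph" and n V :: nat and en :: "nat \<Rightarrow> nat set"
  assumes simple: "simple_graph G" and verts_G: "verts G = {..<n}"
    and card_en: "u < n \<Longrightarrow> card (en u) = 2"
    and en_bound: "u < n \<Longrightarrow> en u \<subseteq> {..<V}"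
    and en_inj: "u < n \<Longrightarrow> v < n \<Longrightarrow> en u = en v \<Longrightarrow> u = v"
    and adj: "u < n \<Longrightarrow> v < n \<Longrightarrow> {u, v} \<in> edges G \<longleftrightarrow> u \<noteq> v \<and> en u \<inter> en v \<noteq> {}"
begin

definition E :: "nat \<Rightarrow> nat \<Rightarrow> bool" where
  "E v w \<longleftrightarrow> (\<exists>u<n. en u = {v, w})"

lemma other_end:
  assumes "g < n" "a \<in> en g"
  obtains b where "en g = {a, b}" "a \<noteq> b"
  using card_en[OF assms(1)] assms(2) by (auto simp: card_2_iff doubleton_eq_iff)

text \<open>\<open>ws\<close> lists the vertices in the order of the walk, \<open>es i\<close> is
  its \<open>i\<close>-th edge and \<open>ts i\<close> the position in \<open>ws\<close> where that
  edge starts. The last clause joins edges \<open>2 * i\<close> and \<open>2 * i + 1\<close> at a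
  common vertex; these pairs become the matching.\<close>

definition layout :: "nat list \<Rightarrow> (nat \<Rightarrow> nat) \<Rightarrow> (nat \<Rightarrow> nat) \<Rightarrow> nat \<Rightarrow> bool" where
  "layout ws es ts e \<longleftrightarrow> distinct ws \<and>
    (\<forall>i<e. Suc (ts i) < length ws \<and> es i < n \<and> en (es i) = {ws ! ts i, ws ! Suc (ts i)}) \<and>
    (\<forall>j<e. \<forall>i<j. ts i < ts j) \<and> (\<forall>i. even i \<longrightarrow> Suc i < e \<longrightarrow> ts (Suc i) = Suc (ts i))"

text \<open>The clause for odd \<open>e\<close> strengthens the induction: a half-finished pair ends
  at the last vertex, and since jumps are barred there, the next edge continues it.\<close>

lemma reach_layout:
  assumes "reach V E col C w e"
  shows "\<exists>ws es ts. layout ws es ts e \<and> ws \<noteq> [] \<and> last ws = w \<and> col ` set ws = C \<and>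
    (odd e \<longrightarrow> Suc (Suc (ts (e - 1))) = length ws)"
  using assms
proof induction
  case (start w)
  show ?case by (rule exI[of _ "[w]"]) (simp add: layout_def)
next
  case (step C v e w)
  then obtain ws es ts where l: "layout ws es ts e" and IH: "ws \<noteq> []" "last ws = v"
    "col ` set ws = C" "odd e \<longrightarrow> Suc (Suc (ts (e - 1))) = length ws" by blast
  have IH': "distinct ws"
    "\<And>i. i < e \<Longrightarrow> Suc (ts i) < length ws \<and> es i < n \<and> en (es i) = {ws ! ts i, ws ! Suc (ts i)}"
    "\<And>i j. j < e \<Longrightarrow> i < j \<Longrightarrow> ts i < ts j"
    "\<And>i. even i \<Longrightarrow> Suc i < e \<Longrightarrow> ts (Suc i) = Suc (ts i)"
    using l unfolding layout_def by simp_all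
  obtain u where u: "u < n" "en u = {v, w}" using step(2) by (auto simp: E_def)
  have l: "ws ! (length ws - 1) = v" using IH(1,2) by (simp add: last_conv_nth)
  let ?ws = "ws @ [w]" and ?es = "es(e := u)" and ?ts = "ts(e := length ws - 1)"
  have "layout ?ws ?es ?ts (Suc e)"
    unfolding layout_def
  proof (intro conjI allI impI)
    show "distinct ?ws" using IH(3) IH'(1) step(4) by auto
  next
    fix i assume i: "i < Suc e"
    show "Suc (?ts i) < length ?ws"
      using IH(1) IH'(2)[of i] i by (cases "i = e") auto
    show "?es i < n" using IH'(2)[of i] i u by (cases "i = e") auto
    show "en (?es i) = {?ws ! ?ts i, ?ws ! Suc (?ts i)}"
      using IH(1) IH'(2)[of i] i u l by (cases "i = e") (auto simp: nth_append)
  next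
    fix j i assume "j < Suc e" "i < j"
    then show "?ts i < ?ts j"
      using IH'(2)[of i] IH'(3)[of j i] by (cases "j = e") auto
  next
    fix i assume "even i" "Suc i < Suc e"
    then show "?ts (Suc i) = Suc (?ts i)"
      using IH'(4)[of i] IH(4) by (cases "Suc i = e") auto
  qed
  moreover have "?ws \<noteq> []" "last ?ws = w" "col ` set ?ws = insert (col w) C"
    "Suc (Suc (?ts (Suc e - 1))) = length ?ws" using IH by auto
  ultimately show ?case by blast
next
  case (jump C v e w)
  then obtain ws es ts where l: "layout ws es ts e" and IH: "ws \<noteq> []" "last ws = v"
    "col ` set ws = C" by blast
  have "layout (ws @ [w]) es ts e"
    using l IH jump(4) unfolding layout_def by (auto simp: nth_append less_SucI)
  moreover have "ws @ [w] \<noteq> []" "last (ws @ [w]) = w" "col ` set (ws @ [w]) = insert (col w) C"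
    using IH by auto
  ultimately show ?case using jump(2) by blast
qed

lemma reach_sound:
  assumes "reach V E col C w (2 * k)"
  shows "\<exists>M. acyclic_matching G M \<and> card M = k"
proof -
  obtain ws es ts where l: "layout ws es ts (2 * k)"
    using reach_layout[OF assms] by blast
  have ws: "distinct ws"
    and es: "\<And>i. i < 2 * k \<Longrightarrow> Suc (ts i) < length ws" "\<And>i. i < 2 * k \<Longrightarrow> es i < n"
      "\<And>i. i < 2 * k \<Longrightarrow> en (es i) = {ws ! ts i, ws ! Suc (ts i)}"
    and mono: "\<And>i j. j < 2 * k \<Longrightarrow> i < j \<Longrightarrow> ts i < ts j"
    and pair: "\<And>i. even i \<Longrightarrow> Suc i < 2 * k \<Longrightarrow> ts (Suc i) = Suc (ts i)"
    using l unfolding layout_def by simp_all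
  have ts_eq: "i = j" if "i < 2 * k" "j < 2 * k" "ts i = ts j" for i j
    using mono[of j i] mono[of i j] that by (metis less_irrefl linorder_neqE_nat)
  have ts_Suc: "j = Suc i" if "i < 2 * k" "j < 2 * k" "ts j = Suc (ts i)" for i j
  proof -
    have "i < j" using mono[of i j] ts_eq[of i j] that by (metis Suc_n_not_le_n less_or_eq_imp_le linorder_neqE_nat n_not_Suc_n)
    moreover have "\<not> Suc i < j"
      using mono[of "Suc i" i] mono[of j "Suc i"] that by (auto dest: less_trans)
    ultimately show ?thesis by simp
  qed
  have idx: "ts i = ts j \<or> ts j = Suc (ts i) \<or> ts i = Suc (ts j)"
    if "i < 2 * k" "j < 2 * k" "en (es i) \<inter> en (es j) \<noteq> {}" for i j
    using that es(1)[of i] es(1)[of j] nth_eq_iff_index_eq[OF ws]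
    unfolding es(3)[OF that(1)] es(3)[OF that(2)] by auto
  have inj: "inj_on es {..<2 * k}"
  proof (rule inj_onI)
    fix i j assume ij: "i \<in> {..<2 * k}" "j \<in> {..<2 * k}" "es i = es j"
    then have "{ws ! ts i, ws ! Suc (ts i)} = {ws ! ts j, ws ! Suc (ts j)}"
      using es(3)[of i] es(3)[of j] by simp
    then have "ts i = ts j"
      using ij es(1)[of i] es(1)[of j] nth_eq_iff_index_eq[OF ws] unfolding doubleton_eq_iff by auto
    then show "i = j" using ts_eq ij by simp
  qed
  define m where "m i = {es (2 * i), es (Suc (2 * i))}" for i
  define M where "M = m ` {..<k}"
  have UM: "\<Union>M \<subseteq> es ` {..<2 * k}" by (auto simp: M_def m_def)
  have m_disj: "m i \<inter> m j = {}" if "i < k" "j < k" "i \<noteq> j" for i j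
  proof -
    have "2 * i < 2 * k" "Suc (2 * i) < 2 * k" "2 * j < 2 * k" "Suc (2 * j) < 2 * k"
      using that by simp_all
    moreover have "2 * i \<noteq> 2 * j" "2 * i \<noteq> Suc (2 * j)" "Suc (2 * i) \<noteq> 2 * j" "Suc (2 * i) \<noteq> Suc (2 * j)"
      using that(3) by presburger+
    ultimately show ?thesis
      unfolding m_def using inj_on_eq_iff[OF inj] by simp
  qed
  have "inj_on m {..<k}"
  proof (rule inj_onI)
    fix i j assume "i \<in> {..<k}" "j \<in> {..<k}" "m i = m j"
    then show "i = j" using m_disj[of i j] by (auto simp: m_def)
  qed
  then have card: "card M = k" unfolding M_def by (simp add: card_image)
  have "m i \<in> edges G" if "i < k" for i
  proof -
    have i: "2 * i < 2 * k" "Suc (2 * i) < 2 * k" using that by simp_all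
    have "es (2 * i) \<noteq> es (Suc (2 * i))" using inj_on_eq_iff[OF inj] i by simp
    moreover have "en (es (2 * i)) \<inter> en (es (Suc (2 * i))) \<noteq> {}"
      using es(3)[OF i(1)] es(3)[OF i(2)] pair[of "2 * i"] i by auto
    ultimately show ?thesis unfolding m_def using adj es(2) i by simp
  qed
  then have match: "matching G M"
    unfolding matching_def M_def using m_disj by auto
  \<comment> \<open>The index of an edge is its number in the walk. Edges with a common end start at
    neighbouring positions of \<open>ws\<close>, and as \<open>ts\<close> is strictly increasing, no
    other edge comes between them.\<close>
  let ?f = "inv_into {..<2 * k} es"
  have f: "?f x < 2 * k" "es (?f x) = x" if "x \<in> es ` {..<2 * k}" for x
    using inv_into_into[OF that] f_inv_into_f[OF that] by auto
  have "acyclic_graph (induced_subgraph G (\<Union>M))"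
  proof (rule acyclic_if_index)
    show "inj_on ?f (verts (induced_subgraph G (\<Union>M)))"
      using UM by (auto simp: induced_subgraph_def intro: inj_on_subset[OF inj_on_inv_into[OF order_refl]])
  next
    fix u v assume uv: "{u, v} \<in> edges (induced_subgraph G (\<Union>M))"
    then have mem: "u \<in> es ` {..<2 * k}" "v \<in> es ` {..<2 * k}" and e: "{u, v} \<in> edges G"
      using UM by (auto simp: induced_subgraph_def)
    have uv: "u < n" "v < n" using mem es(2) by auto
    have "u \<noteq> v" "en u \<inter> en v \<noteq> {}" using adj[OF uv] e by auto
    then have "ts (?f v) = Suc (ts (?f u)) \<or> ts (?f u) = Suc (ts (?f v))"
      using idx[of "?f u" "?f v"] f[OF mem(1)] f[OF mem(2)] ts_eq by metis
    then show "?f v = Suc (?f u) \<or> ?f u = Suc (?f v)"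
      using ts_Suc f[OF mem(1)] f[OF mem(2)] by blast
  qed
  then show ?thesis using match card unfolding acyclic_matching_def by blast
qed

text \<open>Otherwise one could walk on forever, leaving each edge through its far end by another
  edge of \<open>S\<close>. As \<open>S\<close> is finite, some edge recurs, and the first
  recurrence is a cycle of \<open>G\<close>.\<close>

lemma leaf_exists:
  assumes S: "S \<subseteq> {..<n}" "S \<noteq> {}" and ac: "acyclic_graph (induced_subgraph G S)"
  shows "\<exists>f\<in>S. \<exists>a\<in>en f. \<forall>g\<in>S. a \<in> en g \<longrightarrow> g = f"
proof (rule ccontr)
  assume "\<not> ?thesis"
  then have *: "\<exists>g\<in>S. a \<in> en g \<and> g \<noteq> f" if "f \<in> S" "a \<in> en f" for f a using that by blast
  \<comment> \<open>A state of the walk is an edge together with the end through which it will be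
    left.\<close>
  define P where "P x \<longleftrightarrow> fst x \<in> S \<and> snd x \<in> en (fst x)" for x :: "nat \<times> nat"
  define Q where "Q x y \<longleftrightarrow> fst y \<noteq> fst x \<and> en (fst y) = {snd x, snd y} \<and> snd x \<noteq> snd y"
    for x y :: "nat \<times> nat"
  have ex: "\<exists>y. P y \<and> Q x y" if Px: "P x" for x
  proof -
    obtain g where g: "g \<in> S" "snd x \<in> en g" "g \<noteq> fst x" 
      using *[of "fst x" "snd x"] Px unfolding P_def by blast
    obtain b where "en g = {snd x, b}" "snd x \<noteq> b" using other_end[of g "snd x"] g S(1) by blast
    then show ?thesis using g by (intro exI[of _ "(g, b)"]) (auto simp: P_def Q_def)
  qed
  obtain f0 where "f0 \<in> S" using S(2) by blast
  moreover have "en f0 \<noteq> {}" using card_en[of f0] S(1) \<open>f0 \<in> S\<close> by auto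
  ultimately have "\<exists>x. P x" by (auto simp: P_def)
  then obtain h where h: "\<And>i. P (h i)" "\<And>i. Q (h i) (h (Suc i))"
    using dependent_nat_choice[of "\<lambda>_. P" "\<lambda>_. Q"] ex by blast
  define f where "f i = fst (h i)" for i
  define a where "a i = snd (h i)" for i
  have fS: "f i \<in> S" for i using h(1) by (simp add: P_def f_def)
  then have fn: "f i < n" for i using S(1) by auto
  have a1: "a i \<in> en (f i)" for i using h(1) by (simp add: P_def f_def a_def)
  have ne: "f (Suc i) \<noteq> f i" and en_f: "en (f (Suc i)) = {a i, a (Suc i)}" for i
    using h(2)[of i] by (auto simp: Q_def f_def a_def)
  have e: "{f i, f (Suc i)} \<in> edges G" for i
    using adj[OF fn fn, of i "Suc i"] ne[of i] a1[of i] en_f[of i] by auto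
  have ne2: "f (Suc (Suc i)) \<noteq> f i" for i
  proof
    assume eq: "f (Suc (Suc i)) = f i"
    have "a i \<in> en (f i)" "a (Suc i) \<in> en (f i)" using a1[of i] en_f[of "Suc i"] eq by auto
    moreover have "card {a i, a (Suc i)} = 2" using card_en[OF fn, of "Suc i"] en_f[of i] by simp
    ultimately have "en (f i) = {a i, a (Suc i)}"
      using card_en[OF fn, of i] by (intro card_subset_eq[symmetric]) (auto intro: card_ge_0_finite)
    then have "f (Suc i) = f i" using en_inj[OF fn fn] en_f[of i] by simp
    then show False using ne by simp
  qed
  have "finite S" using S(1) finite_subset by blast
  have "\<not> inj_on f UNIV"
    using finite_imageD[of f UNIV] finite_subset[OF _ \<open>finite S\<close>, of "range f"] fS by auto
  then have "\<exists>j. \<exists>i<j. f i = f j" unfolding inj_on_def by (metis linorder_neqE_nat)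
  then obtain j where j: "\<exists>i<j. f i = f j" and least: "\<And>j'. j' < j \<Longrightarrow> \<not> (\<exists>i<j'. f i = f j')"
    using exists_least_iff[of "\<lambda>j. \<exists>i<j. f i = f j"] by blast
  then obtain i where i: "i < j" "f i = f j" by blast
  \<comment> \<open>Consecutive edges differ, and so do edges two apart, since they would otherwise
    share both ends with the edge between them. Hence the cycle has length at least 3.\<close>
  have "j \<noteq> Suc i" "j \<noteq> Suc (Suc i)" using ne[of i] ne2[of i] i by auto
  then have len: "3 \<le> j - i" using i by simp
  have inj: "x = y" if "x < j" "y < j" "f x = f y" for x y
    using least[of x] least[of y] that by (metis linorder_neqE_nat)
  let ?vs = "map f [i..<j]"
  have "is_cycle (induced_subgraph G S) ?vs"
    unfolding is_cycle_def
  proof (intro conjI allI impI)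
    show "distinct ?vs" using inj by (auto simp: distinct_map inj_on_def)
    show "set ?vs \<subseteq> verts (induced_subgraph G S)"
      using fS S(1) verts_G by (auto simp: induced_subgraph_def)
    fix x assume x: "x < length ?vs"
    have "?vs ! (Suc x mod length ?vs) = f (Suc (i + x))"
    proof (cases "Suc x = j - i")
      case True
      then have "Suc (i + x) = j" using i(1) by simp
      then show ?thesis using True i len by simp
    next
      case False
      then have "Suc x < j - i" using x by simp
      then show ?thesis by simp
    qed
    moreover have "?vs ! x = f (i + x)" using x by simp
    ultimately show "{?vs ! x, ?vs ! (Suc x mod length ?vs)} \<in> edges (induced_subgraph G S)"
      using e fS by (simp add: induced_subgraph_def)
  qed (use len in simp)
  then show False using ac unfolding acyclic_graph_def by blast
qed

lemma acyclic_subset: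
  assumes "acyclic_graph (induced_subgraph G S)" "S' \<subseteq> S"
  shows "acyclic_graph (induced_subgraph G S')"
proof -
  have "is_cycle (induced_subgraph G S) vs" if "is_cycle (induced_subgraph G S') vs" for vs
    using that assms(2) unfolding is_cycle_def induced_subgraph_def by auto
  then show ?thesis using assms(1) unfolding acyclic_graph_def by blast
qed

text \<open>Three edges at one root vertex are pairwise adjacent in \<open>G\<close> and form a
  triangle; so root vertices have degree at most 2 in the forest.\<close>

lemma no_triple:
  assumes "S \<subseteq> {..<n}" "acyclic_graph (induced_subgraph G S)"
    "f \<in> S" "g \<in> S" "h \<in> S" "z \<in> en f" "z \<in> en g" "z \<in> en h" "f \<noteq> g" "g \<noteq> h"
  shows "f = h"
proof (rule ccontr)
  assume "f \<noteq> h"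
  have "{f, g} \<in> edges G" "{g, h} \<in> edges G" "{h, f} \<in> edges G"
    using adj assms \<open>f \<noteq> h\<close> by (auto simp: subset_iff)
  moreover have "f \<in> verts G" "g \<in> verts G" "h \<in> verts G" using assms(1,3-5) verts_G by auto
  ultimately have "is_cycle (induced_subgraph G S) [f, g, h]"
    using assms(3-5,9,10) \<open>f \<noteq> h\<close> unfolding is_cycle_def induced_subgraph_def
    by (simp add: all_less_Suc numeral_2_eq_2)
  then show False using assms(2) unfolding acyclic_graph_def by blast
qed

text \<open>A greedy walk that takes one matching edge, that is two edges of the root graph, per
  round. Starting each component at a leaf, the walk meets the matched pairs one after the other, so
  the parity condition on jumps holds by construction.\<close>

lemma reach_complete:
  assumes M: "acyclic_matching G M" and k: "card M = k" "k \<ge> 1"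
    and col: "inj_on col (\<Union>(en ` \<Union>M))"
  shows "\<exists>Z w. Z \<subseteq> \<Union>(en ` \<Union>M) \<and> w \<in> Z \<and> reach V E col (col ` Z) w (2 * k)"
proof -
  define S where "S = \<Union>M"
  define VS where "VS = \<Union>(en ` S)"
  have match: "M \<subseteq> edges G" "\<And>e f. e \<in> M \<Longrightarrow> f \<in> M \<Longrightarrow> e \<noteq> f \<Longrightarrow> e \<inter> f = {}"
    and ac: "acyclic_graph (induced_subgraph G S)"
    using M unfolding acyclic_matching_def matching_def S_def by auto
  have finM: "finite M" using k card.infinite by fastforce
  have edge2: "e \<subseteq> {..<n}" "card e = 2" if "e \<in> M" for e
    using that match(1) simple verts_G unfolding simple_graph_def by auto
  have Sn: "S \<subseteq> {..<n}" using edge2 by (auto simp: S_def)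
  have finS: "finite S" using Sn finite_subset by blast
  have VSV: "VS \<subseteq> {..<V}" using en_bound Sn by (fastforce simp: VS_def)
  have col': "inj_on col VS" using col by (simp add: VS_def S_def)
  have card_U: "card (\<Union>M') = 2 * card M'" if "M' \<subseteq> M" for M'
  proof -
    have "card (\<Union>M') = sum card M'"
    proof (rule card_Union_disjoint)
      show "pairwise disjnt M'"
        unfolding pairwise_def disjnt_def using match(2) that by (meson subsetD)
      show "finite e" if "e \<in> M'" for e
        using edge2(1)[of e] that \<open>M' \<subseteq> M\<close> finite_subset by blast
    qed
    also have "\<dots> = (\<Sum>e\<in>M'. 2)" using that edge2 by (intro sum.cong) auto
    finally show ?thesis by simp
  qed
  \<comment> \<open>\<open>M'\<close> is the part of the matching already walked, \<open>Z\<close>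
    the visited root vertices. Among the visited vertices only \<open>w\<close> may lie on remaining
    edges, and on at most one; hence the next two edges lead to new vertices.\<close>
  define St where "St M' Z w \<longleftrightarrow> M' \<subseteq> M \<and> Z \<subseteq> VS \<and> w \<in> Z \<and> reach V E col (col ` Z) w (2 * card M') \<and>
    (\<forall>z\<in>Z - {w}. \<forall>f\<in>S - \<Union>M'. z \<notin> en f) \<and>
    (\<forall>f\<in>S - \<Union>M'. \<forall>g\<in>S - \<Union>M'. w \<in> en f \<longrightarrow> w \<in> en g \<longrightarrow> f = g)" for M' Z w
  have col_new: "col d \<notin> col ` Z" if "Z \<subseteq> VS" "d \<in> VS" "d \<notin> Z" for d Z
    using that col' by (metis inj_on_image_mem_iff)
  have pair: "\<exists>M'' Z' w'. St M'' Z' w' \<and> card M'' = Suc (card M')"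
    if st: "St M' Z w" and g: "g \<in> S - \<Union>M'" "w \<in> en g" for M' Z w g
  proof -
    have st': "M' \<subseteq> M" "Z \<subseteq> VS" "w \<in> Z" "reach V E col (col ` Z) w (2 * card M')"
      "\<And>z f. z \<in> Z \<Longrightarrow> z \<noteq> w \<Longrightarrow> f \<in> S - \<Union>M' \<Longrightarrow> z \<notin> en f"
      "\<And>f g. f \<in> S - \<Union>M' \<Longrightarrow> g \<in> S - \<Union>M' \<Longrightarrow> w \<in> en f \<Longrightarrow> w \<in> en g \<Longrightarrow> f = g"
      using st unfolding St_def by blast+
    obtain e where e: "e \<in> M" "g \<in> e" using g by (auto simp: S_def)
    then obtain h where h: "e = {g, h}" "g \<noteq> h" using edge2[OF e(1)] by (auto simp: card_2_iff)
    have eM': "e \<notin> M'" using g e by auto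
    have hS: "h \<in> S - \<Union>M'"
    proof -
      have "h \<notin> \<Union>M'"
      proof
        assume "h \<in> \<Union>M'"
        then obtain e' where e': "e' \<in> M'" "h \<in> e'" by blast
        then have "e' = e" using match(2)[of e' e] e(1) st'(1) h(1) by auto
        then show False using e' eM' by simp
      qed
      then show ?thesis using e(1) h by (auto simp: S_def)
    qed
    have gh: "g < n" "h < n" using g hS Sn by auto
    have "{g, h} \<in> edges G" using match(1) e(1) h(1) by auto
    then have sh: "en g \<inter> en h \<noteq> {}" using adj[OF gh] by simp
    \<comment> \<open>\<open>g\<close> is the only remaining edge at \<open>w\<close>, so its
      partner \<open>h\<close> avoids \<open>w\<close> and meets \<open>g\<close> at the other end
      \<open>d\<close>. The round then walks from \<open>w\<close> over \<open>d\<close> to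
      \<open>c\<close>.\<close>
    have wh: "w \<notin> en h" using st'(6)[OF g(1) hS g(2)] h(2) by blast
    obtain d where d: "en g = {w, d}" "w \<noteq> d" using other_end[OF gh(1) g(2)] .
    have dh: "d \<in> en h" using sh wh d by auto
    obtain c where c: "en h = {d, c}" "d \<noteq> c" using other_end[OF gh(2) dh] .
    have wc: "w \<noteq> c" using wh c by auto
    have dZ: "d \<notin> Z" using st'(5)[of d g] g d by auto
    have cZ: "c \<notin> Z" using st'(5)[of c h] hS c wc by auto
    have dVS: "d \<in> VS" "c \<in> VS" using g hS d c by (auto simp: VS_def)
    have "reach V E col (insert (col d) (col ` Z)) d (Suc (2 * card M'))"
      using st'(4) dVS VSV col_new[OF st'(2) dVS(1) dZ] d(1) gh by (intro reach.step) (auto simp: E_def)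
    then have "reach V E col (insert (col c) (col ` insert d Z)) c (Suc (Suc (2 * card M')))"
      using dVS VSV col_new[of "insert d Z" c] dVS st'(2) cZ c gh
      by (intro reach.step[of _ _ _ _ d]) (auto simp: E_def)
    then have r: "reach V E col (col ` insert c (insert d Z)) c (2 * Suc (card M'))" by simp
    have card: "card (insert e M') = Suc (card M')"
      using eM' finite_subset[OF st'(1) finM] by simp
    have SU: "S - \<Union>(insert e M') = S - \<Union>M' - {g, h}" using h by auto
    have c1: "z \<notin> en f" if z: "z \<in> insert c (insert d Z) - {c}" and f: "f \<in> S - \<Union>M' - {g, h}" for z f
    proof
      assume zf: "z \<in> en f"
      consider "z = d" | "z = w" | "z \<in> Z" "z \<noteq> w" using z by blast
      then show False
      proof cases
        case 1
        then have "g = f" using no_triple[OF Sn ac, of g h f d] g hS f d dh zf h(2) by auto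
        then show ?thesis using f by simp
      next
        case 2
        then show ?thesis using st'(6)[OF g(1) _ g(2), of f] f zf by auto
      next
        case 3
        then show ?thesis using st'(5) f zf by blast
      qed
    qed
    have c2: "f = f'" if "f \<in> S - \<Union>M' - {g, h}" "f' \<in> S - \<Union>M' - {g, h}" "c \<in> en f" "c \<in> en f'" for f f'
      using no_triple[OF Sn ac, of f h f' c] that hS c by auto
    have "insert e M' \<subseteq> M" "insert c (insert d Z) \<subseteq> VS" using st'(1,2) e(1) dVS by auto
    then have "St (insert e M') (insert c (insert d Z)) c"
      unfolding St_def card SU
    proof (intro conjI ballI impI)
      show "c \<in> insert c (insert d Z)" by simp
    qed (assumption | rule r | rule c1; assumption | rule c2; assumption)+
    then show ?thesis using card by blast
  qed
  \<comment> \<open>If no remaining edge touches a visited vertex, the walk resumes at a leaf of the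
    remaining forest; a leaf lies on a single remaining edge, as the invariant demands.\<close>
  have jump: "\<exists>a f. St M' (insert a Z) a \<and> f \<in> S - \<Union>M' \<and> a \<in> en f"
    if M': "M' \<subseteq> M" "M' \<noteq> M" and Z: "Z \<subseteq> VS" "\<And>z f. z \<in> Z \<Longrightarrow> f \<in> S - \<Union>M' \<Longrightarrow> z \<notin> en f"
      and r: "M' = {} \<and> Z = {} \<or> (\<exists>w. reach V E col (col ` Z) w (2 * card M'))" for M' Z
  proof -
    obtain e where e: "e \<in> M" "e \<notin> M'" using M' by blast
    obtain x where x: "x \<in> e" using edge2(2)[OF e(1)] by fastforce
    have "x \<notin> e'" if "e' \<in> M'" for e' using match(2)[OF e(1), of e'] M'(1) e(2) x that by blast
    then have "S - \<Union>M' \<noteq> {}" using x e(1) by (auto simp: S_def)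
    then obtain f a where f: "f \<in> S - \<Union>M'" "a \<in> en f"
      and uniq: "\<And>g. g \<in> S - \<Union>M' \<Longrightarrow> a \<in> en g \<Longrightarrow> g = f"
      using leaf_exists[of "S - \<Union>M'"] Sn acyclic_subset[OF ac, of "S - \<Union>M'"] by blast
    have aZ: "a \<notin> Z" using Z(2) f by blast
    have aVS: "a \<in> VS" using f by (auto simp: VS_def)
    have "reach V E col (col ` insert a Z) a (2 * card M')"
      using r
    proof
      assume "M' = {} \<and> Z = {}"
      then show ?thesis using reach.start[of a V E col] aVS VSV by auto
    next
      assume "\<exists>w. reach V E col (col ` Z) w (2 * card M')"
      then show ?thesis using reach.jump[of V E col "col ` Z" _ "2 * card M'" a] aVS VSV
          col_new[OF Z(1) aVS aZ] by auto
    qed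
    moreover have "insert a Z \<subseteq> VS" using Z(1) aVS by simp
    ultimately have "St M' (insert a Z) a"
      unfolding St_def
    proof (intro conjI ballI impI)
      show "z \<notin> en f" if "z \<in> insert a Z - {a}" "f \<in> S - \<Union>M'" for z f using Z(2) that by blast
      show "f = g" if "f \<in> S - \<Union>M'" "g \<in> S - \<Union>M'" "a \<in> en f" "a \<in> en g" for f g
        using uniq that by blast
    qed (use M' in auto)
    then show ?thesis using f by blast
  qed
  have "\<exists>M' Z w. St M' Z w \<and> card M' = Suc j" if "j < k" for j
    using that
  proof (induction j)
    case 0
    have "{} \<noteq> M" using k by auto
    then obtain a f where "St {} (insert a {}) a" "f \<in> S - \<Union>{}" "a \<in> en f"
      using jump[of "{}" "{}"] by auto
    from pair[OF this] show ?case by simp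
  next
    case (Suc j)
    then obtain M' Z w where st: "St M' Z w" and c: "card M' = Suc j" by auto
    show ?case
    proof (cases "\<exists>g\<in>S - \<Union>M'. w \<in> en g")
      case True
      then obtain g where "g \<in> S - \<Union>M'" "w \<in> en g" by blast
      from pair[OF st this] c show ?thesis by simp
    next
      case False
      have *: "M' \<subseteq> M" "Z \<subseteq> VS" "\<And>z f. z \<in> Z \<Longrightarrow> f \<in> S - \<Union>M' \<Longrightarrow> z \<notin> en f"
        "reach V E col (col ` Z) w (2 * card M')"
        using st False unfolding St_def by blast+
      have "M' \<noteq> M" using c Suc.prems k by auto
      then obtain a f where af: "St M' (insert a Z) a" "f \<in> S - \<Union>M'" "a \<in> en f"
        using jump[OF *(1) _ *(2,3)] *(4) by blast
      show ?thesis using pair[OF af] c by simp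
    qed
  qed
  from this[of "k - 1"] k(2) obtain M' Z w where "St M' Z w" "card M' = k" by auto
  then show ?thesis unfolding St_def VS_def S_def by blast
qed

text \<open>The two edges of the root graph that make up an edge of \<open>G\<close> share a vertex
  and so cover at most three.\<close>

lemma card_root_vertices:
  assumes M: "matching G M" "card M = k" "k \<ge> 1"
  shows "card (\<Union>(en ` \<Union>M)) \<le> 3 * k"
proof -
  have finM: "finite M" using M card.infinite by fastforce
  have *: "card (\<Union>(en ` e)) \<le> 3" if "e \<in> M" for e
  proof -
    have e: "e \<in> edges G" using that M unfolding matching_def by auto
    then have "e \<subseteq> {..<n}" "card e = 2" using simple verts_G unfolding simple_graph_def by auto
    then obtain g h where gh: "e = {g, h}" "g \<noteq> h" "g < n" "h < n" by (auto simp: card_2_iff)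
    then have "en g \<inter> en h \<noteq> {}" using adj e by auto
    moreover have fin: "finite (en g)" "finite (en h)" using card_en gh by (auto intro: card_ge_0_finite)
    ultimately have "card (en g \<inter> en h) \<ge> 1" by (simp add: Suc_leI card_gt_0_iff)
    moreover have "card (en g \<union> en h) + card (en g \<inter> en h) = 4"
      using card_Un_Int[OF fin] card_en gh by simp
    ultimately show ?thesis using gh by simp
  qed
  have "\<Union>(en ` \<Union>M) = (\<Union>e\<in>M. \<Union>(en ` e))" by auto
  also have "card \<dots> \<le> (\<Sum>e\<in>M. card (\<Union>(en ` e)))" by (rule card_UN_le[OF finM])
  also have "\<dots> \<le> (\<Sum>e\<in>M. 3)" by (rule sum_mono) (rule *)
  finally show ?thesis using M by simp
qed

end

section \<open>Root graphs from linear equations\<close>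

definition adjacent :: "nat ugraph \<Rightarrow> nat \<Rightarrow> nat \<Rightarrow> bool" where
  "adjacent G u v \<longleftrightarrow> {u, v} \<in> edges G"

lemma adjacent_sym: "adjacent G u v \<longleftrightarrow> adjacent G v u"
  by (simp add: adjacent_def insert_commute)

definition root_eq :: "nat ugraph \<Rightarrow> nat \<Rightarrow> nat \<Rightarrow> nat \<Rightarrow> (nat \<Rightarrow> nat \<Rightarrow> bool) \<Rightarrow> bool" where
  "root_eq G u v w x \<longleftrightarrow> (adjacent G u v \<and> adjacent G u w \<and> v \<noteq> w \<longrightarrow>
     (if adjacent G v w then (x u v \<noteq> x u w) = (x v u \<noteq> x v w) else x u v \<noteq> x u w))"

definition root_system :: "nat ugraph \<Rightarrow> nat \<Rightarrow> (nat \<Rightarrow> nat \<Rightarrow> bool) \<Rightarrow> bool" where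
  "root_system G n x \<longleftrightarrow> (\<forall>u<n. \<forall>v<n. \<forall>w<n. root_eq G u v w x)"

text \<open>Fix an end \<open>a u\<close> of each edge and let \<open>x u v\<close> say whether it
  lies on \<open>v\<close>.\<close>

lemma line_graph_root_system:
  assumes G: "simple_graph G" "verts G = {..<n}" "is_line_graph G"
  shows "\<exists>x. root_system G n x"
proof -
  obtain H :: "nat ugraph" and \<phi> where H: "simple_graph H" and bij: "bij_betw \<phi> (verts G) (edges H)"
    and iso: "\<And>u v. u < n \<Longrightarrow> v < n \<Longrightarrow> {u, v} \<in> edges G \<longleftrightarrow> {\<phi> u, \<phi> v} \<in> edges (line_graph H)"
    using G unfolding is_line_graph_def isomorphic_def by (auto simp: line_graph_def)
  have inj: "\<phi> u = \<phi> v \<Longrightarrow> u = v" if "u < n" "v < n" for u v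
    using bij that G(2) by (auto simp: bij_betw_def inj_on_def)
  have card2: "card (\<phi> u) = 2" if "u < n" for u
    using H bij that G(2) by (auto simp: simple_graph_def bij_betw_def)
  have adj: "adjacent G u v \<longleftrightarrow> u \<noteq> v \<and> \<phi> u \<inter> \<phi> v \<noteq> {}" if "u < n" "v < n" for u v
  proof -
    have "\<phi> u \<in> edges H" "\<phi> v \<in> edges H" using bij that G(2) by (auto simp: bij_betw_def)
    then show ?thesis
      using inj[OF that] iso[OF that] unfolding adjacent_def line_graph_def
      by (auto simp: doubleton_eq_iff)
  qed
  define a where "a u = (SOME z. z \<in> \<phi> u)" for u
  have a: "a u \<in> \<phi> u" if "u < n" for u
    using card2[OF that] unfolding a_def by (metis card.empty some_in_eq zero_neq_numeral)
  define x where "x u v \<longleftrightarrow> a u \<in> \<phi> v" for u v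
  \<comment> \<open>The right-hand side is symmetric in the three edges, which is why the equation
    for a triangle may equate the views from \<open>u\<close> and from \<open>v\<close>.\<close>
  have key: "(x u v \<noteq> x u w) \<longleftrightarrow> \<phi> u \<inter> \<phi> v \<inter> \<phi> w = {}"
    if uvw: "u < n" "v < n" "w < n" "adjacent G u v" "adjacent G u w" for u v w
  proof -
    obtain b where b: "\<phi> u = {a u, b}" "b \<noteq> a u"
      using card2[OF uvw(1)] a[OF uvw(1)] by (auto simp: card_2_iff doubleton_eq_iff)
    have one: "a u \<in> \<phi> t \<longleftrightarrow> b \<notin> \<phi> t" if t: "t < n" "adjacent G u t" for t
    proof -
      have ut: "u \<noteq> t" "\<phi> u \<inter> \<phi> t \<noteq> {}" using adj[OF \<open>u < n\<close> t(1)] t(2) by auto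
      have "\<phi> u = \<phi> t" if "a u \<in> \<phi> t" "b \<in> \<phi> t"
        using that b card2[OF t(1)] card2[OF \<open>u < n\<close>]
        by (intro card_subset_eq) (auto intro: card_ge_0_finite)
      then show ?thesis using ut b inj[OF \<open>u < n\<close> t(1)] by auto
    qed
    show ?thesis using one[of v] one[of w] uvw b unfolding x_def by auto
  qed
  have "root_eq G u v w x" if "u < n" "v < n" "w < n" for u v w
    unfolding root_eq_def
  proof
    assume *: "adjacent G u v \<and> adjacent G u w \<and> v \<noteq> w"
    then have k: "(x u v \<noteq> x u w) \<longleftrightarrow> \<phi> u \<inter> \<phi> v \<inter> \<phi> w = {}" using key that by blast
    show "if adjacent G v w then (x u v \<noteq> x u w) = (x v u \<noteq> x v w) else x u v \<noteq> x u w"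
    proof (cases "adjacent G v w")
      case True
      then have "(x v u \<noteq> x v w) \<longleftrightarrow> \<phi> v \<inter> \<phi> u \<inter> \<phi> w = {}"
        using key[of v u w] that * adjacent_sym by blast
      then show ?thesis using True k by (simp add: Int_commute)
    next
      case False
      then show ?thesis using k adj[of v w] that * by auto
    qed
  qed
  then show ?thesis unfolding root_system_def by blast
qed

text \<open>The number \<open>a\<close> codes end \<open>a mod 2\<close> of edge
  \<open>a div 2\<close>, and \<open>x u v\<close> says whether \<open>u\<close> meets
  \<open>v\<close> at its odd end. The classes of this relation are the root vertices.\<close>

definition same_end :: "nat ugraph \<Rightarrow> (nat \<Rightarrow> nat \<Rightarrow> bool) \<Rightarrow> nat \<Rightarrow> nat \<Rightarrow> bool" where
  "same_end G x a b \<longleftrightarrow> a = b \<or> adjacent G (a div 2) (b div 2) \<and>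
     x (a div 2) (b div 2) = odd a \<and> x (b div 2) (a div 2) = odd b"

definition rep :: "nat ugraph \<Rightarrow> (nat \<Rightarrow> nat \<Rightarrow> bool) \<Rightarrow> nat \<Rightarrow> nat" where
  "rep G x a = (LEAST b. same_end G x a b)"

lemma same_end_sym: "same_end G x a b \<Longrightarrow> same_end G x b a"
  unfolding same_end_def using adjacent_sym by auto

lemma eq_if_div_odd: "a div 2 = c div 2 \<Longrightarrow> odd a = odd c \<Longrightarrow> a = (c::nat)"
  by (metis div_mult_mod_eq odd_iff_mod_2_eq_one not_mod_2_eq_1_eq_0)

text \<open>If \<open>u\<close> and \<open>w\<close> meet \<open>v\<close> at the same end of
  \<open>v\<close>, then \<open>u\<close> and \<open>w\<close> are adjacent, since non-adjacent
  neighbours of \<open>v\<close> sit at different ends. The triangle equations seen from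
  \<open>v\<close> then say that \<open>u\<close> meets \<open>v\<close> and \<open>w\<close> at one
  end, and likewise \<open>w\<close> meets \<open>v\<close> and \<open>u\<close>.\<close>

lemma same_end_trans:
  assumes x: "root_system G n x" and ab: "same_end G x a b" and bc: "same_end G x b c"
    and lt: "a < 2 * n" "b < 2 * n" "c < 2 * n"
  shows "same_end G x a c"
proof (cases "a = b \<or> b = c")
  case True
  then show ?thesis using ab bc by auto
next
  case False
  define u v w where "u = a div 2" and "v = b div 2" and "w = c div 2"
  have n: "u < n" "v < n" "w < n" using lt by (auto simp: u_def v_def w_def)
  have uv: "adjacent G u v" "x u v = odd a" "x v u = odd b"
    and vw: "adjacent G v w" "x v w = odd b" "x w v = odd c"
    using ab bc False by (auto simp: same_end_def u_def v_def w_def)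
  show ?thesis
  proof (cases "u = w")
    case True
    then have "a div 2 = c div 2" "odd a = odd c" using uv vw by (simp_all add: u_def w_def)
    then have "a = c" by (rule eq_if_div_odd)
    then show ?thesis by (simp add: same_end_def)
  next
    case False
    have e: "root_eq G v u w x" "root_eq G v w u x" using x n unfolding root_system_def by auto
    have "adjacent G u w"
      using e(1) uv vw False adjacent_sym[of G u v] unfolding root_eq_def by (auto split: if_splits)
    then show ?thesis
      using e uv vw False adjacent_sym[of G u v] adjacent_sym[of G u w] adjacent_sym[of G v w]
      unfolding root_eq_def same_end_def u_def[symmetric] w_def[symmetric] by auto
  qed
qed

lemma rep_le: "rep G x a \<le> a"
  unfolding rep_def by (rule Least_le) (simp add: same_end_def)

lemma same_end_rep: "same_end G x a (rep G x a)"
  unfolding rep_def by (rule LeastI[of _ a]) (simp add: same_end_def)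

lemma rep_eq_iff:
  assumes x: "root_system G n x" and lt: "a < 2 * n" "b < 2 * n"
  shows "rep G x a = rep G x b \<longleftrightarrow> same_end G x a b"
proof
  assume eq: "rep G x a = rep G x b"
  have "same_end G x (rep G x a) b" using same_end_rep[of G x b] eq same_end_sym by simp
  then show "same_end G x a b"
    using same_end_trans[OF x same_end_rep[of G x a]] lt rep_le[of G x a] by auto
next
  assume ab: "same_end G x a b"
  have "same_end G x a (rep G x b)"
    using same_end_trans[OF x ab same_end_rep] lt rep_le[of G x b] by auto
  moreover have "same_end G x b (rep G x a)"
    using same_end_trans[OF x same_end_sym[OF ab] same_end_rep] lt rep_le[of G x a] by auto
  ultimately show "rep G x a = rep G x b"
    using Least_le[of "same_end G x a" "rep G x b"] Least_le[of "same_end G x b" "rep G x a"]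
    unfolding rep_def by linarith
qed

definition ends :: "nat ugraph \<Rightarrow> (nat \<Rightarrow> nat \<Rightarrow> bool) \<Rightarrow> nat \<Rightarrow> nat set" where
  "ends G x u = {rep G x (2 * u), rep G x (2 * u + 1)}"

text \<open>\<open>x u v\<close> and \<open>x v u\<close> single out one end each, so distinct edges
  share at most one root vertex, and they share one iff they are adjacent.\<close>

lemma root_labelling_ends:
  assumes G: "simple_graph G" "verts G = {..<n}" and x: "root_system G n x"
  shows "root_labelling G n (2 * n) (ends G x)"
proof
  have irr: "\<not> adjacent G u u" for u
    using G unfolding simple_graph_def adjacent_def by fastforce
  have eq: "rep G x (2 * u + of_bool i) = rep G x (2 * v + of_bool j) \<longleftrightarrow>
      u = v \<and> i = j \<or> adjacent G u v \<and> x u v = i \<and> x v u = j" if "u < n" "v < n" for u v i j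
  proof -
    have "2 * u + of_bool i < 2 * n" "2 * v + of_bool j < 2 * n" using that by (cases i; cases j; simp)+
    moreover have "2 * u + of_bool i = 2 * v + of_bool j \<longleftrightarrow> u = v \<and> i = j"
      by (cases i; cases j; simp; presburger)
    ultimately show ?thesis
      using rep_eq_iff[OF x, of "2 * u + of_bool i" "2 * v + of_bool j"] unfolding same_end_def by auto
  qed
  note eqs = eq[of _ _ False False] eq[of _ _ False True] eq[of _ _ True False] eq[of _ _ True True]
  fix u v assume u: "u < n"
  show "card (ends G x u) = 2"
    using eqs(2)[OF u u] irr by (simp add: ends_def)
  show "ends G x u \<subseteq> {..<2 * n}"
    using u rep_le[of G x "2 * u"] rep_le[of G x "2 * u + 1"] by (auto simp: ends_def)
  assume v: "v < n"
  show "u = v" if "ends G x u = ends G x v"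
    using that eqs[OF u v] irr by (auto simp: ends_def doubleton_eq_iff)
  show "{u, v} \<in> edges G \<longleftrightarrow> u \<noteq> v \<and> ends G x u \<inter> ends G x v \<noteq> {}"
    using eqs[OF u v] irr[of u] unfolding ends_def adjacent_def
    by (cases "x u v"; cases "x v u") auto
qed (use G in auto)

section \<open>Affine forms over GF(2) and elimination\<close>

definition affine :: "nat \<Rightarrow> (nat \<Rightarrow> bool) \<Rightarrow> (nat \<Rightarrow> bool) \<Rightarrow> bool" where
  "affine N F z \<longleftrightarrow> odd ((\<Sum>p<N. of_bool (F p \<and> z p)) + of_bool (F N) :: nat)"

lemma odd_sum_xor:
  "odd (\<Sum>p<(N::nat). of_bool (F p \<noteq> F' p) :: nat) \<longleftrightarrow>
    odd (\<Sum>p<N. of_bool (F p) :: nat) \<noteq> odd (\<Sum>p<N. of_bool (F' p) :: nat)"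
  by (induction N) (auto simp: of_bool_def)

lemma affine_xor: "affine N (\<lambda>p. F p \<noteq> F' p) z \<longleftrightarrow> affine N F z \<noteq> affine N F' z"
proof -
  have "(F p \<noteq> F' p) \<and> z p \<longleftrightarrow> (F p \<and> z p) \<noteq> (F' p \<and> z p)" for p by blast
  then show ?thesis
    unfolding affine_def using odd_sum_xor[of "\<lambda>p. F p \<and> z p" "\<lambda>p. F' p \<and> z p" N] by auto
qed

lemma affine_const: "affine N (\<lambda>p. p = N \<and> b) z \<longleftrightarrow> b"
  unfolding affine_def by (simp add: sum.neutral)

lemma affine_var: "y < N \<Longrightarrow> affine N (\<lambda>p. p = y) z \<longleftrightarrow> z y"
proof -
  assume y: "y < N"
  have "(\<Sum>p<N. of_bool (p = y \<and> z p) :: nat) = (\<Sum>p<N. if p = y then of_bool (z y) else 0)"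
    by (intro sum.cong) auto
  then show ?thesis using y unfolding affine_def by auto
qed

lemma affine_flip:
  assumes "i < N"
  shows "affine N F (z(i := (z i \<noteq> t))) \<longleftrightarrow> affine N F z \<noteq> (F i \<and> t)"
proof -
  have *: "F p \<and> (z(i := (z i \<noteq> t))) p \<longleftrightarrow> (F p \<and> z p) \<noteq> (p = i \<and> F i \<and> t)" for p by auto
  have "(\<Sum>p<N. of_bool (p = i \<and> F i \<and> t) :: nat) = (\<Sum>p<N. if p = i then of_bool (F i \<and> t) else 0)"
    by (intro sum.cong) auto
  then have "odd (\<Sum>p<N. of_bool (p = i \<and> F i \<and> t) :: nat) \<longleftrightarrow> F i \<and> t" using assms by simp
  then show ?thesis
    unfolding affine_def * using odd_sum_xor[of "\<lambda>p. F p \<and> z p" "\<lambda>p. p = i \<and> F i \<and> t" N] by auto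
qed

lemma affine_zero: "affine N F (\<lambda>_. False) \<longleftrightarrow> F N"
  unfolding affine_def by simp

text \<open>\<open>A\<close> is read as an affine map of GF(2)-vectors, row \<open>y\<close> giving
  the new value of unknown \<open>y\<close>, with column \<open>N\<close> as constant term. It fixes
  all solutions of the whole system, and its image satisfies the equations in \<open>Qs\<close>: a
  general solution in parametric form, from which any choice of the parameters \<open>z\<close>
  yields a solution.\<close>

definition solved ::
    "nat \<Rightarrow> ((nat \<Rightarrow> bool) \<Rightarrow> bool) \<Rightarrow> (nat \<Rightarrow> nat \<Rightarrow> bool) \<Rightarrow> ((nat \<Rightarrow> bool) \<Rightarrow> bool) set \<Rightarrow> bool" where
  "solved N sol A Qs \<longleftrightarrow> (\<forall>z. sol z \<longrightarrow> (\<forall>y<N. affine N (A y) z = z y)) \<and>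
     (\<forall>z. \<forall>q\<in>Qs. q (\<lambda>y. affine N (A y) z))"

lemma solved_init: "solved N sol (\<lambda>y p. p = y) {}"
  unfolding solved_def by (simp add: affine_var)

text \<open>\<open>F z\<close> says that \<open>q\<close> fails after substitution of the rows. As
  \<open>F\<close> contains parameter \<open>i\<close>, replacing \<open>z i\<close> by
  \<open>z i + F z\<close> maps every \<open>z\<close> to a zero of \<open>F\<close>; composing with
  \<open>A\<close> adds \<open>F\<close> to the rows that contain \<open>i\<close>. Old equations
  hold at all parameters, hence still, and solutions are zeros of \<open>F\<close>, hence still
  fixed.\<close>

lemma solved_pivot:
  assumes s: "solved N sol A Qs" and form: "\<And>z. affine N F z \<longleftrightarrow> \<not> q (\<lambda>y. affine N (A y) z)"
    and sol: "\<And>z. sol z \<Longrightarrow> q z" and ext: "\<And>z z'. (\<And>y. y < N \<Longrightarrow> z y = z' y) \<Longrightarrow> q z = q z'"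
    and i: "i < N" "F i"
  shows "solved N sol (\<lambda>y p. A y p \<noteq> (A y i \<and> F p)) (insert q Qs)"
proof -
  have a: "affine N (\<lambda>p. A y p \<noteq> (A y i \<and> F p)) z \<longleftrightarrow> affine N (A y) z \<noteq> (A y i \<and> affine N F z)" for y z
    using affine_xor[of N "A y" F z] by (cases "A y i") simp_all
  have 1: "affine N (\<lambda>p. A y p \<noteq> (A y i \<and> F p)) z = z y" if "sol z" "y < N" for z y
  proof -
    have "q (\<lambda>y. affine N (A y) z) = q z" using s that(1) by (intro ext) (auto simp: solved_def)
    then have "\<not> affine N F z" using form sol[OF that(1)] by simp
    then show ?thesis using s that unfolding a solved_def by auto
  qed
  have 2: "q' (\<lambda>y. affine N (\<lambda>p. A y p \<noteq> (A y i \<and> F p)) z)" if "q' \<in> insert q Qs" for q' z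
  proof -
    define z' where "z' = z(i := (z i \<noteq> affine N F z))"
    have "affine N (\<lambda>p. A y p \<noteq> (A y i \<and> F p)) z = affine N (A y) z'" for y
      unfolding a z'_def using affine_flip[OF i(1)] by simp
    moreover have "\<not> affine N F z'" unfolding z'_def using affine_flip[OF i(1)] i(2) by simp
    then have "q (\<lambda>y. affine N (A y) z')" using form by blast
    ultimately show ?thesis using that s unfolding solved_def by auto
  qed
  show ?thesis unfolding solved_def using 1 2 by blast
qed

text \<open>\<open>F\<close> is constant, and the constant is 0 because a solution exists. The
  assumption that \<open>G\<close> is a line graph enters here, through \<open>z0\<close>.\<close>

lemma solved_no_pivot:
  assumes s: "solved N sol A Qs" and form: "\<And>z. affine N F z \<longleftrightarrow> \<not> q (\<lambda>y. affine N (A y) z)"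
    and sol: "\<And>z. sol z \<Longrightarrow> q z" and ext: "\<And>z z'. (\<And>y. y < N \<Longrightarrow> z y = z' y) \<Longrightarrow> q z = q z'"
    and i: "\<And>i. i < N \<Longrightarrow> \<not> F i" and ex: "sol z0"
  shows "solved N sol A (insert q Qs)"
proof -
  have const: "affine N F z = F N" for z
    using i unfolding affine_def by (simp add: sum.neutral)
  have "q (\<lambda>y. affine N (A y) z0) = q z0" using s ex by (intro ext) (auto simp: solved_def)
  then have "\<not> F N" using form[of z0] sol[OF ex] const by simp
  then show ?thesis using s form const unfolding solved_def by auto
qed

section \<open>The decision program\<close>

fun fresh :: "nat \<Rightarrow> aexp \<Rightarrow> bool" where
  "fresh x (Num c) = True"
| "fresh x (Var y) = (x \<noteq> y)"
| "fresh x (Inp e) = fresh x e"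
| "fresh x (Arr j e) = fresh x e"
| "fresh x (Plus e f) = (fresh x e \<and> fresh x f)"
| "fresh x (Minus e f) = (fresh x e \<and> fresh x f)"
| "fresh x (Sum y e f) = (fresh x e \<and> (x = y \<or> fresh x f))"

lemma eval_fresh: "fresh x e \<Longrightarrow> eval L inp \<sigma> (\<rho>(x := i)) e = eval L inp \<sigma> \<rho> e"
proof (induction e arbitrary: \<rho>)
  case (Sum y e f)
  have "eval L inp \<sigma> (\<rho>(x := i, y := j)) f = eval L inp \<sigma> (\<rho>(y := j)) f" for j
  proof (cases "x = y")
    case False
    then have "\<rho>(x := i, y := j) = \<rho>(y := j, x := i)" by (simp add: fun_upd_twist)
    moreover have "fresh x f" using Sum.prems False by simp
    ultimately show ?thesis using Sum.IH(2) by (simp only:)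
  qed simp
  moreover have "eval L inp \<sigma> (\<rho>(x := i)) e = eval L inp \<sigma> \<rho> e" using Sum.prems by (intro Sum.IH) simp
  ultimately show ?case by (simp only: eval.simps)
qed auto

fun fresh_c :: "nat \<Rightarrow> com \<Rightarrow> bool" where
  "fresh_c x (Put j e f) = (fresh x e \<and> fresh x f)"
| "fresh_c x (c ;; c') = (fresh_c x c \<and> fresh_c x c')"
| "fresh_c x (For y e c) = (fresh x e \<and> (x = y \<or> fresh_c x c))"

lemma run_fresh: "fresh_c x c \<Longrightarrow> run L inp (\<rho>(x := i)) c \<sigma> = run L inp \<rho> c \<sigma>"
proof (induction c arbitrary: \<rho> \<sigma>)
  case (For y e c)
  have "run L inp (\<rho>(x := i, y := j)) c = run L inp (\<rho>(y := j)) c" for j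
  proof (cases "x = y")
    case False
    then have "\<rho>(x := i, y := j) = \<rho>(y := j, x := i)" by (simp add: fun_upd_twist)
    moreover have "fresh_c x c" using For.prems False by simp
    ultimately show ?thesis using For.IH by (intro ext) (simp only:)
  qed simp
  moreover have "eval L inp \<sigma> (\<rho>(x := i)) e = eval L inp \<sigma> \<rho> e" using For.prems by (intro eval_fresh) simp
  ultimately show ?case by (simp only: run.simps)
qed (auto simp: eval_fresh)

fun writes :: "com \<Rightarrow> nat set" where
  "writes (Put j e f) = {j}"
| "writes (c ;; c') = writes c \<union> writes c'"
| "writes (For x e c) = writes c"

lemma run_unchanged: "j \<notin> writes c \<Longrightarrow> run L inp \<rho> c \<sigma> j = \<sigma> j"
proof (induction c arbitrary: \<rho> \<sigma>)
  case (For x e c)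
  have "fold (\<lambda>i. run L inp (\<rho>(x := i)) c) xs \<sigma> j = \<sigma> j" for xs
    using For by (induction xs arbitrary: \<sigma>) auto
  then show ?case by simp
qed auto

lemma run_For_induct:
  assumes "eval L inp \<sigma> \<rho> e = b" "b \<le> L" "P 0 \<sigma>"
    and "\<And>i \<sigma>'. i < b \<Longrightarrow> P i \<sigma>' \<Longrightarrow> P (Suc i) (run L inp (\<rho>(x := i)) c \<sigma>')"
  shows "P b (run L inp \<rho> (For x e c) \<sigma>)"
proof -
  have "P i (fold (\<lambda>i. run L inp (\<rho>(x := i)) c) [0..<i] \<sigma>)" if "i \<le> b" for i
    using that by (induction i) (auto simp: assms)
  then show ?thesis using assms(1,2) by simp
qed

text \<open>Truth values are numbers, with 0 for false. Variables 98 and 99 are reserved as dummies for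
  \<open>When\<close> and \<open>MulE\<close>.\<close>

definition "NzE a = Minus (Num 1) (Minus (Num 1) a)"
definition "NotE a = Minus (Num 1) a"
definition "LeE a b = Minus (Num 1) (Minus a b)"
definition "LtE a b = LeE (Plus a (Num 1)) b"
definition "EqE a b = Minus (Num 1) (Plus (Minus a b) (Minus b a))"
definition "XorE a b = Plus (Minus a b) (Minus b a)"
text \<open>Repeated addition by a loop of \<open>a\<close> rounds, hence correct only for
  \<open>a\<close> up to the clamp.\<close>

definition "MulE a b = Sum 99 a b"
definition "AndE a b = MulE (NzE a) (NzE b)"
definition "OrE a b = NzE (Plus a b)"
definition "ExE x e f = NzE (Sum x e f)"
definition "FirstE x y e f = Sum y e (NotE (ExE x (Plus (Var y) (Num 1)) f))"
definition "When e c = For 98 (NzE e) c"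

lemmas sugar_defs = NzE_def NotE_def LeE_def LtE_def EqE_def XorE_def MulE_def AndE_def OrE_def ExE_def
  FirstE_def When_def

lemma eval_NzE: "eval L inp \<sigma> \<rho> (NzE a) = of_bool (eval L inp \<sigma> \<rho> a \<noteq> 0)"
  by (simp add: NzE_def)

lemma eval_NotE: "eval L inp \<sigma> \<rho> (NotE a) = of_bool (eval L inp \<sigma> \<rho> a = 0)"
  by (simp add: NotE_def)

lemma eval_LeE: "eval L inp \<sigma> \<rho> (LeE a b) = of_bool (eval L inp \<sigma> \<rho> a \<le> eval L inp \<sigma> \<rho> b)"
  by (simp add: LeE_def)

lemma eval_LtE: "eval L inp \<sigma> \<rho> (LtE a b) = of_bool (eval L inp \<sigma> \<rho> a < eval L inp \<sigma> \<rho> b)"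
  by (simp add: LtE_def eval_LeE Suc_le_eq)

lemma eval_EqE: "eval L inp \<sigma> \<rho> (EqE a b) = of_bool (eval L inp \<sigma> \<rho> a = eval L inp \<sigma> \<rho> b)"
  by (auto simp: EqE_def)

lemma eval_XorE:
  "eval L inp \<sigma> \<rho> a = of_bool P \<Longrightarrow> eval L inp \<sigma> \<rho> b = of_bool Q \<Longrightarrow>
    eval L inp \<sigma> \<rho> (XorE a b) = of_bool (P \<noteq> Q)"
  by (auto simp: XorE_def)

lemma eval_MulE:
  "fresh 99 b \<Longrightarrow> eval L inp \<sigma> \<rho> a \<le> L \<Longrightarrow>
    eval L inp \<sigma> \<rho> (MulE a b) = eval L inp \<sigma> \<rho> a * eval L inp \<sigma> \<rho> b"
  by (simp add: MulE_def eval_fresh)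

lemma fresh_99 [simp]:
  "fresh 99 (NzE a) = fresh 99 a" "fresh 99 (NotE a) = fresh 99 a"
  "fresh 99 (LeE a b) = (fresh 99 a \<and> fresh 99 b)" "fresh 99 (LtE a b) = (fresh 99 a \<and> fresh 99 b)"
  "fresh 99 (EqE a b) = (fresh 99 a \<and> fresh 99 b)" "fresh 99 (XorE a b) = (fresh 99 a \<and> fresh 99 b)"
  "fresh 99 (MulE a b) = fresh 99 a" "fresh 99 (AndE a b) = fresh 99 a"
  "fresh 99 (OrE a b) = (fresh 99 a \<and> fresh 99 b)"
  "fresh 99 (ExE x e f) = (fresh 99 e \<and> (99 = x \<or> fresh 99 f))"
  by (auto simp: sugar_defs)

lemma eval_AndE:
  "fresh 99 b \<Longrightarrow> 1 \<le> L \<Longrightarrow>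
    eval L inp \<sigma> \<rho> (AndE a b) = of_bool (eval L inp \<sigma> \<rho> a \<noteq> 0 \<and> eval L inp \<sigma> \<rho> b \<noteq> 0)"
  by (auto simp: AndE_def eval_MulE eval_NzE)

lemma eval_OrE:
  "eval L inp \<sigma> \<rho> (OrE a b) = of_bool (eval L inp \<sigma> \<rho> a \<noteq> 0 \<or> eval L inp \<sigma> \<rho> b \<noteq> 0)"
  by (auto simp: OrE_def eval_NzE)

lemma eval_ExE:
  "eval L inp \<sigma> \<rho> e \<le> L \<Longrightarrow>
    eval L inp \<sigma> \<rho> (ExE x e f) = of_bool (\<exists>i<eval L inp \<sigma> \<rho> e. eval L inp \<sigma> (\<rho>(x := i)) f \<noteq> 0)"
  by (auto simp: ExE_def eval_NzE)

text \<open>Every \<open>y\<close> before the first hit contributes 1, so the sum is the position of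
  the first hit. This gives minimisation with loops that cannot be left early.\<close>

lemma sum_not_yet:
  "(\<Sum>y<b. of_bool (\<not> (\<exists>i<y + 1. P i))) = (if \<exists>i<b. P i then LEAST i. P i else b :: nat)"
proof (cases "\<exists>i<b. P i")
  case True
  define l where "l = (LEAST i. P i)"
  have l: "P l" "\<And>i. P i \<Longrightarrow> l \<le> i" using True unfolding l_def by (auto intro: LeastI Least_le)
  have lb: "l \<le> b" using True l(2) by (meson le_trans less_imp_le)
  have "(\<Sum>y<b. of_bool (\<not> (\<exists>i<y + 1. P i)) :: nat) = (\<Sum>y<b. of_bool (y < l))"
  proof (intro sum.cong refl)
    fix y
    show "of_bool (\<not> (\<exists>i<y + 1. P i)) = (of_bool (y < l) :: nat)"
      using l by (auto simp: less_Suc_eq_le not_less intro: le_trans)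
  qed
  also have "\<dots> = card ({..<b} \<inter> {y. y < l})" by (simp add: of_bool_def sum.If_cases)
  also have "{..<b} \<inter> {y. y < l} = {..<l}" using lb by auto
  finally show ?thesis using True by (simp add: l_def)
next
  case False
  then have "\<not> (\<exists>i<y + 1. P i)" if "y < b" for y
    using that by (auto simp: less_Suc_eq_le dest: le_less_trans)
  then have "(\<Sum>y<b. of_bool (\<not> (\<exists>i<y + 1. P i)) :: nat) = (\<Sum>y<b. 1)" by (intro sum.cong) auto
  then show ?thesis unfolding if_not_P[OF False] by simp
qed

lemma eval_FirstE:
  assumes "eval L inp \<sigma> \<rho> e \<le> L" "fresh y f" "x \<noteq> y"
  shows "eval L inp \<sigma> \<rho> (FirstE x y e f) =
    (if \<exists>i<eval L inp \<sigma> \<rho> e. eval L inp \<sigma> (\<rho>(x := i)) f \<noteq> 0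
     then LEAST i. eval L inp \<sigma> (\<rho>(x := i)) f \<noteq> 0 else eval L inp \<sigma> \<rho> e)"
proof -
  let ?b = "eval L inp \<sigma> \<rho> e"
  have "eval L inp \<sigma> (\<rho>(y := j, x := i)) f = eval L inp \<sigma> (\<rho>(x := i)) f" for i j
    using eval_fresh[OF assms(2), of L inp \<sigma> "\<rho>(x := i)" j] assms(3) by (simp add: fun_upd_twist)
  then have "eval L inp \<sigma> \<rho> (FirstE x y e f) =
      (\<Sum>y<?b. of_bool (\<not> (\<exists>i<y + 1. eval L inp \<sigma> (\<rho>(x := i)) f \<noteq> 0)))"
    using assms(1) unfolding FirstE_def eval.simps
    by (intro sum.cong) (auto simp: eval_NotE eval_ExE)
  then show ?thesis unfolding sum_not_yet .
qed

lemma run_When: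
  "fresh_c 98 c \<Longrightarrow> 1 \<le> L \<Longrightarrow>
    run L inp \<rho> (When e c) \<sigma> = (if eval L inp \<sigma> \<rho> e \<noteq> 0 then run L inp \<rho> c \<sigma> else \<sigma>)"
  by (simp add: When_def eval_NzE run_fresh)

lemma writes_When [simp]: "writes (When e c) = writes c"
  by (simp add: When_def)


text \<open>Variables 0 and 1 hold \<open>n\<close> and \<open>k\<close>. The arrays are: 0 the affine forms of the unknowns \<open>x u v\<close>, one
  row of length \<open>n\<^sup>2 + 1\<close> per unknown with the constant term last; 1 to 3 the current equation, its
  pivot and the pivot column; 4 the representatives of the ends; 5 the powers of 2; 6 to 8 the
  colouring state; 9 the table of the dynamic program; 10 the answer; 11 the constants \<open>n\<^sup>2\<close>, \<open>n\<^sup>2 + 1\<close>,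
  \<open>W\<close>, the number of advice bits, the number of colours, \<open>2 n\<close>, \<open>2 k + 1\<close> and \<open>2 n + 4\<close>, in this order.\<close>

abbreviation "con i \<equiv> Arr 11 (Num i)"

definition "adjE u v = Inp (Plus (MulE u (Var 0)) v)"
definition "rowE a b p = Arr 0 (Plus (MulE (Plus (MulE a (Var 0)) b) (con 1)) p)"

definition "set_constants =
  Put 11 (Num 0) (MulE (Var 0) (Var 0)) ;;
  Put 11 (Num 1) (Plus (con 0) (Num 1)) ;;
  Put 11 (Num 5) (Plus (Var 0) (Var 0)) ;;
  Put 11 (Num 6) (Plus (Plus (Var 1) (Var 1)) (Num 1)) ;;
  Put 11 (Num 7) (Plus (con 5) (Num 4)) ;;
  Put 11 (Num 2) (MulE (con 7) (MulE (con 7) (MulE (con 7) (MulE (con 7) (MulE (con 7) (con 7)))))) ;;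
  Put 11 (Num 3) (Plus (MulE (Var 1) (Num 108)) (Num 7)) ;;
  Put 11 (Num 4) (Plus (Plus (con 3) (con 3)) (Num 1))"

definition "init_rows =
  For 2 (con 0) (For 3 (con 1) (Put 0 (Plus (MulE (Var 2) (con 1)) (Var 3)) (EqE (Var 2) (Var 3))))"

definition "form_row =
  For 5 (con 1) (Put 1 (Var 5)
    (XorE (XorE (rowE (Var 2) (Var 3) (Var 5)) (rowE (Var 2) (Var 4) (Var 5)))
      (XorE (AndE (adjE (Var 3) (Var 4))
              (XorE (rowE (Var 3) (Var 2) (Var 5)) (rowE (Var 3) (Var 4) (Var 5))))
            (AndE (NotE (adjE (Var 3) (Var 4))) (EqE (Var 5) (con 0))))))"

definition "find_pivot = Put 2 (Num 0) (FirstE 6 7 (con 0) (Arr 1 (Var 6)))"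

text \<open>\<open>update_rows\<close> works in place and changes the pivot column as well, so the
  column is saved beforehand.\<close>

definition "copy_pivot =
  For 5 (con 0) (Put 3 (Var 5) (Arr 0 (Plus (MulE (Var 5) (con 1)) (Arr 2 (Num 0)))))"

definition "update_rows =
  For 5 (con 0) (For 6 (con 1) (Put 0 (Plus (MulE (Var 5) (con 1)) (Var 6))
    (XorE (Arr 0 (Plus (MulE (Var 5) (con 1)) (Var 6))) (AndE (Arr 3 (Var 5)) (Arr 1 (Var 6))))))"

definition "eliminate =
  For 2 (Var 0) (For 3 (Var 0) (For 4 (Var 0)
    (When (AndE (adjE (Var 2) (Var 3)) (AndE (adjE (Var 2) (Var 4)) (NotE (EqE (Var 3) (Var 4)))))
      (form_row ;; find_pivot ;; When (LtE (Arr 2 (Num 0)) (con 0)) (copy_pivot ;; update_rows)))))"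

definition "compute_rep =
  For 2 (Var 0) (For 3 (Num 2) (Put 4 (Plus (Plus (Var 2) (Var 2)) (Var 3))
    (FirstE 4 5 (con 5) (ExE 6 (Var 0) (ExE 7 (Num 2)
      (AndE (EqE (Var 4) (Plus (Plus (Var 6) (Var 6)) (Var 7)))
        (OrE (AndE (EqE (Var 2) (Var 6)) (EqE (Var 3) (Var 7)))
          (AndE (adjE (Var 2) (Var 6)) (AndE (EqE (rowE (Var 2) (Var 6) (con 0)) (Var 3))
             (EqE (rowE (Var 6) (Var 2) (con 0)) (Var 7)))))))))))"

definition "compute_pow2 =
  Put 5 (Num 0) (Num 1) ;;
  For 2 (Plus (con 4) (Num 1)) (Put 5 (Plus (Var 2) (Num 1)) (Plus (Arr 5 (Var 2)) (Arr 5 (Var 2))))"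

text \<open>Bit \<open>t\<close> of \<open>c\<close> is set iff
  \<open>c = (2 * y + 1) * 2 ^ t + r\<close> with \<open>r < 2 ^ t\<close>; the search for
  \<open>y\<close> and \<open>r\<close> replaces a division.\<close>

definition "bitE t c = ExE 20 (Plus c (Num 1)) (ExE 21 (Arr 5 t)
  (EqE c (Plus (MulE (Plus (Plus (Var 20) (Var 20)) (Num 1)) (Arr 5 t)) (Var 21))))"

text \<open>\<open>a * x mod W\<close> is obtained from its predecessor by adding \<open>a\<close>;
  as \<open>a < W\<close>, one conditional subtraction of \<open>W\<close> reduces it.\<close>

definition "init_colouring =
  Put 6 (Num 0) (Num 0) ;;
  For 4 (con 5) (Put 6 (Plus (Var 4) (Num 1))
    (Minus (Plus (Arr 6 (Var 4)) (Var 2)) (MulE (LeE (con 2) (Plus (Arr 6 (Var 4)) (Var 2))) (con 2)))) ;;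
  For 4 (con 5) (Put 7 (Var 4) (Num 0)) ;;
  Put 8 (Num 0) (Num 1)"

definition "do_split =
  For 5 (con 5) (When (EqE (Arr 7 (Var 5)) (Var 4))
    (Put 7 (Var 5) (Plus (Arr 8 (Num 0)) (LeE (con 2) (Plus (Arr 6 (Var 5)) (Arr 6 (Var 5))))) ;;
     Put 6 (Var 5) (Minus (Plus (Arr 6 (Var 5)) (Arr 6 (Var 5)))
       (MulE (LeE (con 2) (Plus (Arr 6 (Var 5)) (Arr 6 (Var 5)))) (con 2))))) ;;
  Put 8 (Num 0) (Plus (Arr 8 (Num 0)) (Num 2))"

definition "do_colouring = For 4 (con 3) (When (bitE (Var 4) (Var 3)) do_split)"

definition "cellE c w e = Arr 9 (Plus (MulE (Plus (MulE c (con 5)) w) (con 6)) e)"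
definition "rootE v w = ExE 24 (Var 0) (OrE
  (AndE (EqE (Arr 4 (Plus (Var 24) (Var 24))) v) (EqE (Arr 4 (Plus (Plus (Var 24) (Var 24)) (Num 1))) w))
  (AndE (EqE (Arr 4 (Plus (Var 24) (Var 24))) w) (EqE (Arr 4 (Plus (Plus (Var 24) (Var 24)) (Num 1))) v)))"
text \<open>Removes the colour of the current vertex from the coded set. If the colour is not in the
  set the result is meaningless, and the bit test in \<open>fill_table\<close> discards it.\<close>

definition "restE = Minus (Var 4) (Arr 5 (Arr 7 (Var 5)))"
definition "evenE e = ExE 23 (Plus e (Num 1)) (EqE e (Plus (Var 23) (Var 23)))"

text \<open>Removing an element lowers the code of a set, so in ascending order of codes all entries
  that are read have been written.\<close>

definition "fill_table =
  For 4 (Arr 5 (con 4)) (For 5 (con 5) (For 6 (con 6)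
    (Put 9 (Plus (MulE (Plus (MulE (Var 4) (con 5)) (Var 5)) (con 6)) (Var 6))
      (AndE (bitE (Arr 7 (Var 5)) (Var 4))
        (OrE (AndE (EqE restE (Num 0)) (EqE (Var 6) (Num 0)))
          (ExE 22 (con 5) (OrE (AndE (evenE (Var 6)) (cellE restE (Var 22) (Var 6)))
            (AndE (LeE (Num 1) (Var 6)) (AndE (cellE restE (Var 22) (Minus (Var 6) (Num 1)))
              (rootE (Var 22) (Var 5)))))))))))"

definition "collect =
  Put 10 (Num 0) (Plus (Arr 10 (Num 0))
    (ExE 4 (Arr 5 (con 4)) (ExE 5 (con 5) (cellE (Var 4) (Var 5) (Plus (Var 1) (Var 1))))))"

definition "try_all =
  For 2 (con 2) (For 3 (Arr 5 (con 3)) (init_colouring ;; do_colouring ;; fill_table ;; collect))"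

definition "decide = set_constants ;; init_rows ;; eliminate ;; compute_rep ;; compute_pow2 ;; try_all"

lemmas com_defs = adjE_def rowE_def set_constants_def init_rows_def form_row_def find_pivot_def
  copy_pivot_def update_rows_def eliminate_def compute_rep_def compute_pow2_def bitE_def
  init_colouring_def do_split_def do_colouring_def cellE_def rootE_def restE_def evenE_def
  fill_table_def collect_def try_all_def decide_def

lemma arrays_decide: "arrays_c decide" "arrays_e (NzE (Arr 10 (Num 0)))"
  by (simp_all add: com_defs sugar_defs)

lemma run_For_inv:
  assumes "P 0 \<sigma>" "eval L inp \<sigma> \<rho> e = b" "b \<le> L"
    and "\<And>i \<sigma>'. i < b \<Longrightarrow> P i \<sigma>' \<Longrightarrow> P (Suc i) (run L inp (\<rho>(x := i)) c \<sigma>')"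
    and "\<And>\<sigma>'. P b \<sigma>' \<Longrightarrow> Q \<sigma>'"
  shows "Q (run L inp \<rho> (For x e c) \<sigma>)"
  using run_For_induct[of L inp \<sigma> \<rho> e b P x c] assms by blast

section \<open>Correctness of the program\<close>

lemma mixed_radix_eq:
  "b < m \<Longrightarrow> b' < m \<Longrightarrow> a * m + b = a' * m + b' \<longleftrightarrow> a = a' \<and> b = (b' :: nat)"
proof -
  assume *: "b < m" "b' < m"
  have "a = a' \<and> b = b'" if "a * m + b = a' * m + b'"
  proof -
    have "(a * m + b) div m = a" "(a' * m + b') div m = a'" using * by simp_all
    moreover have "(a * m + b) mod m = b" "(a' * m + b') mod m = b'" using * by simp_all
    ultimately show ?thesis using that by simp
  qed
  then show ?thesis by blast
qed

lemma mixed_radix_less: "a < A \<Longrightarrow> b < m \<Longrightarrow> a * m + b < A * (m::nat)"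
proof -
  assume "a < A" "b < m"
  then have "a * m + b < Suc a * m" "Suc a * m \<le> A * m" by (simp, intro mult_le_mono1) simp
  then show ?thesis by linarith
qed

lemma run_fill1:
  assumes "eval L inp \<sigma> \<rho> e = B" "B \<le> L"
    and "\<And>i \<sigma>'. i < B \<Longrightarrow> (\<And>j. j \<noteq> a \<Longrightarrow> \<sigma>' j = \<sigma> j) \<Longrightarrow>
      eval L inp \<sigma>' (\<rho>(x := i)) ix = i \<and> eval L inp \<sigma>' (\<rho>(x := i)) v = f i"
  shows "\<forall>i<B. run L inp \<rho> (For x e (Put a ix v)) \<sigma> a i = f i"
proof -
  let ?P = "\<lambda>b \<sigma>'. (\<forall>j. j \<noteq> a \<longrightarrow> \<sigma>' j = \<sigma> j) \<and> (\<forall>i<b. \<sigma>' a i = f i)"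
  show ?thesis
  proof (rule run_For_inv[where P = ?P and b = B])
    fix i \<sigma>' assume i: "i < B" and P: "?P i \<sigma>'"
    then have "eval L inp \<sigma>' (\<rho>(x := i)) ix = i" "eval L inp \<sigma>' (\<rho>(x := i)) v = f i"
      using assms(3)[of i \<sigma>'] by auto
    then show "?P (Suc i) (run L inp (\<rho>(x := i)) (Put a ix v) \<sigma>')"
      using P by (auto simp: less_Suc_eq)
  qed (use assms in auto)
qed

text \<open>In \<open>cell\<close> the entry about to be written may be assumed to have its original
  value; this is what the in-place update of the rows relies on.\<close>

lemma run_fill2:
  assumes "eval L inp \<sigma> \<rho> e = B" "B \<le> L" "m \<le> L"
    and bound: "\<And>i \<sigma>'. i < B \<Longrightarrow> (\<And>j. j \<noteq> a \<Longrightarrow> \<sigma>' j = \<sigma> j) \<Longrightarrow> eval L inp \<sigma>' (\<rho>(x := i)) e' = m"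
    and cell: "\<And>i i' \<sigma>'. i < B \<Longrightarrow> i' < m \<Longrightarrow> (\<And>j. j \<noteq> a \<Longrightarrow> \<sigma>' j = \<sigma> j) \<Longrightarrow>
      \<sigma>' a (i * m + i') = \<sigma> a (i * m + i') \<Longrightarrow>
      eval L inp \<sigma>' (\<rho>(x := i, y := i')) ix = i * m + i' \<and>
      eval L inp \<sigma>' (\<rho>(x := i, y := i')) v = f i i'"
  shows "\<forall>i<B. \<forall>i'<m. run L inp \<rho> (For x e (For y e' (Put a ix v))) \<sigma> a (i * m + i') = f i i'"
proof -
  let ?P = "\<lambda>b b' \<sigma>'. (\<forall>j. j \<noteq> a \<longrightarrow> \<sigma>' j = \<sigma> j) \<and>
    (\<forall>i<B. \<forall>i'<m. \<sigma>' a (i * m + i') = (if i < b \<or> i = b \<and> i' < b' then f i i' else \<sigma> a (i * m + i')))"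
  show ?thesis
  proof (rule run_For_inv[where P = "\<lambda>b. ?P b 0" and b = B])
    fix i \<sigma>' assume i: "i < B" and P: "?P i 0 \<sigma>'"
    show "?P (Suc i) 0 (run L inp (\<rho>(x := i)) (For y e' (Put a ix v)) \<sigma>')"
    proof (rule run_For_inv[where P = "?P i" and b = m])
      show "?P i 0 \<sigma>'" by (rule P)
      show "eval L inp \<sigma>' (\<rho>(x := i)) e' = m" using bound i P by blast
    next
      fix i' \<sigma>'' assume i': "i' < m" and P: "?P i i' \<sigma>''"
      then have "eval L inp \<sigma>'' (\<rho>(x := i, y := i')) ix = i * m + i'"
        "eval L inp \<sigma>'' (\<rho>(x := i, y := i')) v = f i i'"
        using cell[of i i' \<sigma>''] i by auto
      then show "?P i (Suc i') (run L inp (\<rho>(x := i, y := i')) (Put a ix v) \<sigma>'')"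
        using P i' by (auto simp: less_Suc_eq mixed_radix_eq)
    next
      fix \<sigma>'' assume "?P i m \<sigma>''"
      then show "?P (Suc i) 0 \<sigma>''" by (auto simp: less_Suc_eq)
    qed (use assms in auto)
  qed (use assms in auto)
qed

text \<open>The exponent \<open>216 * k + 17\<close> is \<open>NC + 2\<close> and the factor
  \<open>(2 * n + 4) ^ 6\<close> is \<open>W\<close>; their product dominates every loop bound of
  the program.\<close>

locale decide_run =
  fixes G :: "nat ugraph" and n k L :: nat and inp :: "nat \<Rightarrow> nat"
  assumes simple: "simple_graph G" and verts_G: "verts G = {..<n}" and k1: "1 \<le> k"
    and inp: "\<And>u v. u < n \<Longrightarrow> v < n \<Longrightarrow> inp (u * n + v) = of_bool (adjacent G u v)"
    and L_big: "2 ^ (216 * k + 17) * (2 * n + 4) ^ 6 \<le> L"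
begin

definition "N = n * n"
definition "N1 = N + 1"
definition "V = 2 * n"
definition "W = (V + 4) ^ 6"
text \<open>\<open>36 * s + 7\<close> advice bits for the \<open>s = 3 * k\<close> root vertices of
  the forest.\<close>

definition "Bt = 108 * k + 7"
definition "NC = 2 * Bt + 1"
definition "K = 2 * k + 1"

definition consts_ok :: "(nat \<Rightarrow> nat) \<Rightarrow> bool" where
  "consts_ok c \<longleftrightarrow> c 0 = N \<and> c (Suc 0) = N1 \<and> c 2 = W \<and> c 3 = Bt \<and> c 4 = NC \<and> c 5 = V \<and> c 6 = K"

definition env_ok :: "env \<Rightarrow> bool" where
  "env_ok \<rho> \<longleftrightarrow> \<rho> 0 = n \<and> \<rho> (Suc 0) = k"

lemma L_ge: "2 ^ (NC + 2) * (V + 4) ^ 6 \<le> L"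
proof -
  have "NC + 2 = 216 * k + 17" by (simp add: NC_def Bt_def)
  then show ?thesis using L_big by (simp only: V_def)
qed

lemma le_LI: "a \<le> 2 ^ (NC + 2) \<Longrightarrow> b \<le> (V + 4) ^ 6 \<Longrightarrow> a * b \<le> L"
  using L_ge mult_le_mono le_trans by blast

lemma V_pow: "(V + 4) ^ i \<le> (V + 4) ^ 6" if "i \<le> 6"
  using that by (intro power_increasing) auto

lemma pow2_NC: "NC + 2 \<le> 2 ^ (NC + 2)"
  by (rule less_imp_le) (rule less_exp)

lemma L_bounds:
  "n \<le> L" "N \<le> L" "N1 \<le> L" "V \<le> L" "V + 4 \<le> L" "W \<le> L" "k \<le> L" "K \<le> L" "Bt \<le> L" "Suc NC \<le> L"
  "1 \<le> L" "2 \<le> L" "2 ^ (NC + 2) \<le> L" "2 ^ NC * V \<le> L" "Suc 0 \<le> L"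
proof -
  have one: "1 \<le> (V + 4) ^ 6" "1 \<le> (2::nat) ^ (NC + 2)" by simp_all
  have V4: "V + 4 \<le> (V + 4) ^ 6" "(V + 4) ^ 2 \<le> (V + 4) ^ 6" using V_pow[of 1] V_pow[of 2] by simp_all
  have a: "b \<le> L" if "b \<le> (V + 4) ^ 6" for b using le_LI[OF one(2) that] by simp
  have b: "b \<le> L" if "b \<le> 2 ^ (NC + 2)" for b using le_LI[OF that one(1)] by simp
  show "V + 4 \<le> L" using V4 a by blast
  then show "n \<le> L" "V \<le> L" "2 \<le> L" "1 \<le> L" "Suc 0 \<le> L" by (auto simp: V_def)
  have "N1 \<le> (V + 4) ^ 2" by (simp add: N1_def N_def V_def power2_eq_square algebra_simps)
  then show "N1 \<le> L" using V4 a le_trans by blast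
  then show "N \<le> L" by (simp add: N1_def)
  show "W \<le> L" using a by (simp add: W_def)
  have "NC + 2 \<le> L" using b pow2_NC by blast
  then show "k \<le> L" "K \<le> L" "Bt \<le> L" "Suc NC \<le> L" by (auto simp: NC_def Bt_def K_def)
  show "2 ^ (NC + 2) \<le> L" using b by blast
  have "(2::nat) ^ NC \<le> 2 ^ (NC + 2)" by (rule power_increasing) auto
  then show "2 ^ NC * V \<le> L" using V4 by (intro le_LI) auto
qed

lemma set_constants_ok:
  assumes "env_ok \<rho>"
  shows "consts_ok (run L inp \<rho> set_constants \<sigma> 11)"
proof -
  define x where "x = n + n + 4"
  have "x * (x * (x * (x * (x * x)))) = x ^ 6" by (simp add: eval_nat_numeral)
  also have "x ^ 6 = W" by (simp only: W_def V_def x_def mult_2)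
  finally have p: "x * (x * (x * (x * (x * x)))) = W" .
  have b: "x \<le> L" using L_bounds(5) by (simp only: V_def x_def mult_2)
  have \<rho>: "\<rho> 0 = n" "\<rho> (Suc 0) = k" using assms by (simp_all add: env_ok_def)
  have c: "N1 = Suc N" "N = n * n" "V = n + n" "K = Suc (k + k)" "Bt = k * 108 + 7" "NC = Suc (Bt + Bt)"
    by (simp_all add: N1_def N_def V_def K_def Bt_def NC_def)
  show ?thesis
    using L_bounds(1,7) b p unfolding set_constants_def consts_ok_def
    by (simp add: eval_MulE \<rho> x_def[symmetric] c)
qed

lemma eval_adjE:
  assumes "env_ok \<rho>" "eval L inp \<sigma> \<rho> a < n" "eval L inp \<sigma> \<rho> b < n"
  shows "eval L inp \<sigma> \<rho> (adjE a b) = of_bool (adjacent G (eval L inp \<sigma> \<rho> a) (eval L inp \<sigma> \<rho> b))"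
  using assms L_bounds(1) inp[OF assms(2,3)] by (simp add: adjE_def eval_MulE env_ok_def)

lemma eval_rowE:
  assumes "env_ok \<rho>" "consts_ok (\<sigma> 11)" "eval L inp \<sigma> \<rho> a < n" "eval L inp \<sigma> \<rho> b < n"
  shows "eval L inp \<sigma> \<rho> (rowE a b p) =
    \<sigma> 0 ((eval L inp \<sigma> \<rho> a * n + eval L inp \<sigma> \<rho> b) * N1 + eval L inp \<sigma> \<rho> p)"
proof -
  have "eval L inp \<sigma> \<rho> a * n + eval L inp \<sigma> \<rho> b < N"
    unfolding N_def by (rule mixed_radix_less[OF assms(3,4)])
  then show ?thesis
    using assms L_bounds(1,2) by (simp add: rowE_def eval_MulE env_ok_def consts_ok_def)
qed

lemma fresh_adjE [simp]: "fresh 99 (adjE a b) = (fresh 99 a \<and> fresh 99 b)"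
  by (auto simp: adjE_def)

lemma fresh_rowE [simp]: "fresh 99 (rowE a b p) = (fresh 99 a \<and> fresh 99 b \<and> fresh 99 p)"
  by (auto simp: rowE_def)

section \<open>Elimination on the stored rows\<close>

definition rows :: "store \<Rightarrow> nat \<Rightarrow> nat \<Rightarrow> bool" where
  "rows \<sigma> y p \<longleftrightarrow> \<sigma> 0 (y * N1 + p) = 1"

definition rows_ok :: "store \<Rightarrow> bool" where
  "rows_ok \<sigma> \<longleftrightarrow> consts_ok (\<sigma> 11) \<and> (\<forall>y<N. \<forall>p<N1. \<sigma> 0 (y * N1 + p) \<le> 1)"

lemma rows_of_bool: "rows_ok \<sigma> \<Longrightarrow> y < N \<Longrightarrow> p < N1 \<Longrightarrow> \<sigma> 0 (y * N1 + p) = of_bool (rows \<sigma> y p)"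
  unfolding rows_ok_def rows_def by (auto simp: le_Suc_eq)

lemma affine_cong: "(\<And>p. p < N1 \<Longrightarrow> F p = F' p) \<Longrightarrow> affine N F z = affine N F' z"
proof -
  assume *: "\<And>p. p < N1 \<Longrightarrow> F p = F' p"
  then have "(\<Sum>p<N. of_bool (F p \<and> z p) :: nat) = (\<Sum>p<N. of_bool (F' p \<and> z p))"
    by (intro sum.cong) (auto simp: N1_def)
  then show ?thesis using *[of N] unfolding affine_def by (simp add: N1_def)
qed

lemma solved_cong:
  assumes "\<And>y p. p < N1 \<Longrightarrow> y < N \<Longrightarrow> A y p = A' y p" "solved N sol A Qs"
    and ext: "\<And>q z z'. q \<in> Qs \<Longrightarrow> (\<And>y. y < N \<Longrightarrow> z y = z' y) \<Longrightarrow> q z = q z'"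
  shows "solved N sol A' Qs"
proof -
  have *: "affine N (A y) z = affine N (A' y) z" if "y < N" for y z
    using that assms(1) by (intro affine_cong) auto
  have "q (\<lambda>y. affine N (A y) z) \<longleftrightarrow> q (\<lambda>y. affine N (A' y) z)" if "q \<in> Qs" for q z
    by (rule ext[OF that]) (simp add: *)
  then show ?thesis using assms(2) * unfolding solved_def by blast
qed

lemma init_rows_ok:
  assumes "env_ok \<rho>" "consts_ok (\<sigma> 11)"
  shows "rows_ok (run L inp \<rho> init_rows \<sigma>)"
    "\<And>y p. y < N \<Longrightarrow> p < N1 \<Longrightarrow> rows (run L inp \<rho> init_rows \<sigma>) y p \<longleftrightarrow> p = y"
proof -
  have c: "run L inp \<rho> init_rows \<sigma> 11 = \<sigma> 11" by (rule run_unchanged) (simp add: init_rows_def)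
  have "\<forall>y<N. \<forall>p<N1. run L inp \<rho> init_rows \<sigma> 0 (y * N1 + p) = of_bool (y = p)"
    unfolding init_rows_def
  proof (rule run_fill2)
    fix i i' \<sigma>' assume i: "i < N" "i' < N1" and fr: "\<And>j. j \<noteq> 0 \<Longrightarrow> \<sigma>' j = \<sigma> j"
    have c': "consts_ok (\<sigma>' 11)" using fr[of 11] assms by simp
    show "eval L inp \<sigma>' (\<rho>(2 := i, 3 := i')) (Plus (MulE (Var 2) (con 1)) (Var 3)) = i * N1 + i' \<and>
      eval L inp \<sigma>' (\<rho>(2 := i, 3 := i')) (EqE (Var 2) (Var 3)) = of_bool (i = i')"
      using i c' L_bounds(2) by (simp add: eval_MulE eval_EqE consts_ok_def)
  qed (use assms L_bounds in \<open>auto simp: consts_ok_def\<close>)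
  then show "rows_ok (run L inp \<rho> init_rows \<sigma>)"
    "\<And>y p. y < N \<Longrightarrow> p < N1 \<Longrightarrow> rows (run L inp \<rho> init_rows \<sigma>) y p \<longleftrightarrow> p = y"
    using assms c unfolding rows_ok_def rows_def by auto
qed

lemma env_ok_upd [simp]: "x \<noteq> 0 \<Longrightarrow> x \<noteq> Suc 0 \<Longrightarrow> env_ok (\<rho>(x := i)) = env_ok \<rho>"
  by (simp add: env_ok_def)

definition eqn :: "nat \<Rightarrow> nat \<Rightarrow> nat \<Rightarrow> (nat \<Rightarrow> bool) \<Rightarrow> bool" where
  "eqn u v w z = root_eq G u v w (\<lambda>a b. z (a * n + b))"

definition sol :: "(nat \<Rightarrow> bool) \<Rightarrow> bool" where
  "sol z \<longleftrightarrow> (\<forall>u<n. \<forall>v<n. \<forall>w<n. eqn u v w z)"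

lemma eqn_ext:
  assumes "u < n" "v < n" "w < n" "\<And>y. y < N \<Longrightarrow> z y = z' y"
  shows "eqn u v w z = eqn u v w z'"
proof -
  have "z (a * n + b) = z' (a * n + b)" if "a < n" "b < n" for a b
    using assms(4) mixed_radix_less[OF that] by (simp add: N_def)
  then show ?thesis using assms(1-3) unfolding eqn_def root_eq_def by simp
qed

text \<open>The coefficients of the defect of an equation after substitution of the rows. For
  non-adjacent \<open>v\<close> and \<open>w\<close> the two values have to differ, so the defect is
  their sum plus 1, which sets the constant term \<open>p = N\<close>.\<close>

definition form :: "store \<Rightarrow> nat \<Rightarrow> nat \<Rightarrow> nat \<Rightarrow> nat \<Rightarrow> bool" where
  "form \<sigma> u v w p \<longleftrightarrow> (rows \<sigma> (u * n + v) p \<noteq> rows \<sigma> (u * n + w) p) \<noteq>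
     ((adjacent G v w \<and> (rows \<sigma> (v * n + u) p \<noteq> rows \<sigma> (v * n + w) p)) \<noteq> (\<not> adjacent G v w \<and> p = N))"

lemma affine_form:
  assumes "adjacent G u v" "adjacent G u w" "v \<noteq> w"
  shows "affine N (form \<sigma> u v w) z \<longleftrightarrow> \<not> eqn u v w (\<lambda>y. affine N (rows \<sigma> y) z)"
proof (cases "adjacent G v w")
  case True
  then have "form \<sigma> u v w = (\<lambda>p. (rows \<sigma> (u * n + v) p \<noteq> rows \<sigma> (u * n + w) p) \<noteq>
     (rows \<sigma> (v * n + u) p \<noteq> rows \<sigma> (v * n + w) p))" by (auto simp: form_def fun_eq_iff)
  then show ?thesis using assms True unfolding eqn_def root_eq_def by (simp only: affine_xor) auto
next
  case False
  then have "form \<sigma> u v w = (\<lambda>p. (rows \<sigma> (u * n + v) p \<noteq> rows \<sigma> (u * n + w) p) \<noteq> (p = N \<and> True))"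
    by (auto simp: form_def fun_eq_iff)
  then show ?thesis using assms False unfolding eqn_def root_eq_def
    by (simp only: affine_xor affine_const) auto
qed

lemma form_row_ok:
  assumes "env_ok \<rho>" "rows_ok \<sigma>" "\<rho> 2 < n" "\<rho> 3 < n" "\<rho> 4 < n"
  shows "\<forall>p<N1. run L inp \<rho> form_row \<sigma> 1 p = of_bool (form \<sigma> (\<rho> 2) (\<rho> 3) (\<rho> 4) p)"
  unfolding form_row_def
proof (rule run_fill1)
  show "eval L inp \<sigma> \<rho> (con 1) = N1" using assms by (simp add: rows_ok_def consts_ok_def)
  fix p \<sigma>' assume p: "p < N1" and fr: "\<And>j. j \<noteq> 1 \<Longrightarrow> \<sigma>' j = \<sigma> j"
  have c: "consts_ok (\<sigma>' 11)" and e: "\<sigma>' 0 = \<sigma> 0" using fr assms by (simp_all add: rows_ok_def)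
  have r: "\<sigma>' 0 ((a * n + b) * N1 + p) = of_bool (rows \<sigma> (a * n + b) p)" if "a < n" "b < n" for a b
    using rows_of_bool[OF assms(2) _ p] mixed_radix_less[OF that] by (simp add: e N_def)
  have N: "\<sigma>' 11 0 = N" using c by (simp add: consts_ok_def)
  let ?\<rho> = "\<rho>(5 := p)"
  have row: "eval L inp \<sigma>' ?\<rho> (rowE (Var a) (Var b) (Var 5)) = of_bool (rows \<sigma> (\<rho> a * n + \<rho> b) p)"
    if "\<rho> a < n" "\<rho> b < n" "a \<noteq> 5" "b \<noteq> 5" for a b
    using that assms(1) c r by (simp add: eval_rowE)
  have adj: "eval L inp \<sigma>' ?\<rho> (adjE (Var 3) (Var 4)) = of_bool (adjacent G (\<rho> 3) (\<rho> 4))"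
    using assms by (simp add: eval_adjE)
  have "eval L inp \<sigma>' ?\<rho> (XorE (XorE (rowE (Var 2) (Var 3) (Var 5)) (rowE (Var 2) (Var 4) (Var 5)))
      (XorE (AndE (adjE (Var 3) (Var 4))
              (XorE (rowE (Var 3) (Var 2) (Var 5)) (rowE (Var 3) (Var 4) (Var 5))))
            (AndE (NotE (adjE (Var 3) (Var 4))) (EqE (Var 5) (con 0)))))
    = of_bool (form \<sigma> (\<rho> 2) (\<rho> 3) (\<rho> 4) p)"
    unfolding form_def
  proof (intro eval_XorE row)
    have "eval L inp \<sigma>' ?\<rho> (XorE (rowE (Var 3) (Var 2) (Var 5)) (rowE (Var 3) (Var 4) (Var 5))) =
      of_bool (rows \<sigma> (\<rho> 3 * n + \<rho> 2) p \<noteq> rows \<sigma> (\<rho> 3 * n + \<rho> 4) p)"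
      using assms by (intro eval_XorE row) auto
    then show "eval L inp \<sigma>' ?\<rho> (AndE (adjE (Var 3) (Var 4))
        (XorE (rowE (Var 3) (Var 2) (Var 5)) (rowE (Var 3) (Var 4) (Var 5)))) =
      of_bool (adjacent G (\<rho> 3) (\<rho> 4) \<and> rows \<sigma> (\<rho> 3 * n + \<rho> 2) p \<noteq> rows \<sigma> (\<rho> 3 * n + \<rho> 4) p)"
      using L_bounds(11) by (simp add: eval_AndE adj)
    show "eval L inp \<sigma>' ?\<rho> (AndE (NotE (adjE (Var 3) (Var 4))) (EqE (Var 5) (con 0))) =
      of_bool (\<not> adjacent G (\<rho> 3) (\<rho> 4) \<and> p = N)"
      using L_bounds(11) by (simp add: eval_AndE adj eval_NotE eval_EqE N)
  qed (use assms in auto)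
  then show "eval L inp \<sigma>' ?\<rho> (Var 5) = p \<and> eval L inp \<sigma>' ?\<rho>
      (XorE (XorE (rowE (Var 2) (Var 3) (Var 5)) (rowE (Var 2) (Var 4) (Var 5)))
      (XorE (AndE (adjE (Var 3) (Var 4))
              (XorE (rowE (Var 3) (Var 2) (Var 5)) (rowE (Var 3) (Var 4) (Var 5))))
            (AndE (NotE (adjE (Var 3) (Var 4))) (EqE (Var 5) (con 0)))))
    = of_bool (form \<sigma> (\<rho> 2) (\<rho> 3) (\<rho> 4) p)" by simp
qed (use L_bounds in auto)

lemma pivot_rows:
  fixes \<rho> :: env
  assumes "consts_ok (\<sigma> 11)" "rows_ok \<sigma>" "\<And>p. p < N1 \<Longrightarrow> \<sigma> 1 p = of_bool (F p)"
    and i: "\<sigma> 2 0 = i" "i < N"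
  defines "\<sigma>' \<equiv> run L inp \<rho> (copy_pivot ;; update_rows) \<sigma>"
  shows "rows_ok \<sigma>'" "\<And>y p. y < N \<Longrightarrow> p < N1 \<Longrightarrow> rows \<sigma>' y p = (rows \<sigma> y p \<noteq> (rows \<sigma> y i \<and> F p))"
proof -
  define \<sigma>1 where "\<sigma>1 = run L inp \<rho> copy_pivot \<sigma>"
  have iN: "i < N1" using i by (simp add: N1_def)
  have s1: "\<sigma>1 j = \<sigma> j" if "j \<noteq> 3" for j
    unfolding \<sigma>1_def by (rule run_unchanged) (use that in \<open>simp add: copy_pivot_def\<close>)
  have s3: "\<forall>y<N. \<sigma>1 3 y = of_bool (rows \<sigma> y i)"
    unfolding \<sigma>1_def copy_pivot_def
  proof (rule run_fill1)
    show "eval L inp \<sigma> \<rho> (con 0) = N" using assms(1) by (simp add: consts_ok_def)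
    fix y \<sigma>' assume y: "y < N" and fr: "\<And>j. j \<noteq> 3 \<Longrightarrow> \<sigma>' j = \<sigma> j"
    have "consts_ok (\<sigma>' 11)" "\<sigma>' 0 = \<sigma> 0" "\<sigma>' 2 0 = i" using fr assms by simp_all
    then show "eval L inp \<sigma>' (\<rho>(5 := y)) (Var 5) = y \<and>
      eval L inp \<sigma>' (\<rho>(5 := y)) (Arr 0 (Plus (MulE (Var 5) (con 1)) (Arr 2 (Num 0)))) = of_bool (rows \<sigma> y i)"
      using y L_bounds(2) rows_of_bool[OF assms(2) y iN] by (simp add: eval_MulE consts_ok_def)
  qed (use L_bounds in auto)
  have \<sigma>': "\<sigma>' = run L inp \<rho> update_rows \<sigma>1" by (simp add: \<sigma>'_def \<sigma>1_def)
  have c': "\<sigma>' 11 = \<sigma> 11"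
    unfolding \<sigma>' using s1[of 11] by (subst run_unchanged) (simp_all add: update_rows_def)
  have r: "\<forall>y<N. \<forall>p<N1. \<sigma>' 0 (y * N1 + p) = of_bool (rows \<sigma> y p \<noteq> (rows \<sigma> y i \<and> F p))"
    unfolding \<sigma>' update_rows_def
  proof (rule run_fill2)
    show "eval L inp \<sigma>1 \<rho> (con 0) = N" using assms(1) s1[of 11] by (simp add: consts_ok_def)
    fix y p \<sigma>2 assume y: "y < N" "p < N1" and fr: "\<And>j. j \<noteq> 0 \<Longrightarrow> \<sigma>2 j = \<sigma>1 j"
      and old: "\<sigma>2 0 (y * N1 + p) = \<sigma>1 0 (y * N1 + p)"
    let ?\<rho> = "\<rho>(5 := y, 6 := p)"
    have c: "\<sigma>2 11 1 = N1" using fr[of 11] s1[of 11] assms(1) by (simp add: consts_ok_def)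
    have ix: "eval L inp \<sigma>2 ?\<rho> (Plus (MulE (Var 5) (con 1)) (Var 6)) = y * N1 + p"
      using c y L_bounds(2) by (simp add: eval_MulE)
    have "eval L inp \<sigma>2 ?\<rho> (XorE (Arr 0 (Plus (MulE (Var 5) (con 1)) (Var 6)))
        (AndE (Arr 3 (Var 5)) (Arr 1 (Var 6)))) = of_bool (rows \<sigma> y p \<noteq> (rows \<sigma> y i \<and> F p))"
    proof (rule eval_XorE)
      show "eval L inp \<sigma>2 ?\<rho> (Arr 0 (Plus (MulE (Var 5) (con 1)) (Var 6))) = of_bool (rows \<sigma> y p)"
        using ix old s1[of 0] rows_of_bool[OF assms(2) y] by simp
      show "eval L inp \<sigma>2 ?\<rho> (AndE (Arr 3 (Var 5)) (Arr 1 (Var 6))) = of_bool (rows \<sigma> y i \<and> F p)"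
        using L_bounds(11) fr[of 3] fr[of 1] s3 s1[of 1] y assms(3)[of p] by (simp add: eval_AndE)
    qed
    with ix show "eval L inp \<sigma>2 ?\<rho> (Plus (MulE (Var 5) (con 1)) (Var 6)) = y * N1 + p \<and>
      eval L inp \<sigma>2 ?\<rho> (XorE (Arr 0 (Plus (MulE (Var 5) (con 1)) (Var 6)))
        (AndE (Arr 3 (Var 5)) (Arr 1 (Var 6)))) = of_bool (rows \<sigma> y p \<noteq> (rows \<sigma> y i \<and> F p))" by blast
  next
    fix y \<sigma>2 assume "\<And>j. j \<noteq> 0 \<Longrightarrow> \<sigma>2 j = \<sigma>1 j"
    then have "\<sigma>2 11 = \<sigma> 11" using s1[of 11] by simp
    then show "eval L inp \<sigma>2 (\<rho>(5 := y)) (con 1) = N1" using assms(1) by (simp add: consts_ok_def)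
  qed (use L_bounds in auto)
  show "rows_ok \<sigma>'" "\<And>y p. y < N \<Longrightarrow> p < N1 \<Longrightarrow> rows \<sigma>' y p = (rows \<sigma> y p \<noteq> (rows \<sigma> y i \<and> F p))"
    using r c' assms(1) unfolding rows_ok_def rows_def by auto
qed

lemma eliminate_step:
  fixes \<rho> :: env and \<sigma> :: store
  defines "c \<equiv> form_row ;; find_pivot ;; When (LtE (Arr 2 (Num 0)) (con 0)) (copy_pivot ;; update_rows)"
  assumes \<rho>: "env_ok \<rho>" "\<rho> 2 < n" "\<rho> 3 < n" "\<rho> 4 < n" and ok: "rows_ok \<sigma>"
    and solv: "solved N sol (rows \<sigma>) Qs"
    and ext: "\<And>q z z'. q \<in> Qs \<Longrightarrow> (\<And>y. y < N \<Longrightarrow> z y = z' y) \<Longrightarrow> q z = q z'"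
    and ex: "sol z0" and adj: "adjacent G (\<rho> 2) (\<rho> 3)" "adjacent G (\<rho> 2) (\<rho> 4)" "\<rho> 3 \<noteq> \<rho> 4"
  defines "\<sigma>' \<equiv> run L inp \<rho> c \<sigma>"
  shows "rows_ok \<sigma>' \<and> solved N sol (rows \<sigma>') (insert (eqn (\<rho> 2) (\<rho> 3) (\<rho> 4)) Qs)"
proof -
  let ?q = "eqn (\<rho> 2) (\<rho> 3) (\<rho> 4)" and ?F = "form \<sigma> (\<rho> 2) (\<rho> 3) (\<rho> 4)"
  define \<sigma>1 where "\<sigma>1 = run L inp \<rho> form_row \<sigma>"
  have s1: "\<sigma>1 j = \<sigma> j" if "j \<noteq> 1" for j
    unfolding \<sigma>1_def by (rule run_unchanged) (use that in \<open>simp add: form_row_def\<close>)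
  have F: "\<sigma>1 1 p = of_bool (?F p)" if "p < N1" for p
    using form_row_ok[OF \<rho>(1) ok \<rho>(2-4)] that by (simp add: \<sigma>1_def)
  define \<sigma>2 where "\<sigma>2 = run L inp \<rho> find_pivot \<sigma>1"
  have s2: "\<sigma>2 j = \<sigma>1 j" if "j \<noteq> 2" for j
    unfolding \<sigma>2_def by (rule run_unchanged) (use that in \<open>simp add: find_pivot_def\<close>)
  have cok: "consts_ok (\<sigma>1 11)" "consts_ok (\<sigma>2 11)" using s1[of 11] s2[of 11] ok by (simp_all add: rows_ok_def)
  have rows2: "rows \<sigma>2 = rows \<sigma>" using s1[of 0] s2[of 0] by (simp add: rows_def fun_eq_iff)
  have ok2: "rows_ok \<sigma>2" using ok cok s1[of 0] s2[of 0] by (simp add: rows_ok_def)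
  have F2: "\<sigma>2 1 p = of_bool (?F p)" if "p < N1" for p using F[OF that] s2[of 1] by simp
  have FN: "\<sigma>1 (Suc 0) p = of_bool (?F p)" if "p < N" for p using F[of p] that by (simp add: N1_def)
  have piv: "\<sigma>2 2 0 = (if \<exists>i<N. ?F i then LEAST i. \<sigma>1 (Suc 0) i \<noteq> 0 else N)"
  proof -
    have "(\<exists>i<N. \<sigma>1 (Suc 0) i \<noteq> 0) \<longleftrightarrow> (\<exists>i<N. ?F i)" using FN by auto
    then show ?thesis
      unfolding \<sigma>2_def find_pivot_def using cok(1) L_bounds(2)
      by (auto simp: eval_FirstE consts_ok_def)
  qed
  have sol_q: "sol z \<Longrightarrow> ?q z" for z using \<rho>(2-4) by (simp add: sol_def)
  note form = affine_form[OF adj, of \<sigma>]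
  have q_ext: "?q z = ?q z'" if "\<And>y. y < N \<Longrightarrow> z y = z' y" for z z'
    using that \<rho>(2-4) by (intro eqn_ext)
  have lt: "eval L inp \<sigma>2 \<rho> (LtE (Arr 2 (Num 0)) (con 0)) \<noteq> 0 \<longleftrightarrow> \<sigma>2 2 0 < N"
    using cok(2) by (simp add: eval_LtE consts_ok_def)
  have fr: "fresh_c 98 (copy_pivot ;; update_rows)" by (simp add: copy_pivot_def update_rows_def sugar_defs)
  have \<sigma>': "\<sigma>' = (if \<sigma>2 2 0 < N then run L inp \<rho> (copy_pivot ;; update_rows) \<sigma>2 else \<sigma>2)"
    unfolding \<sigma>'_def c_def using lt run_When[OF fr L_bounds(11), of inp \<rho> _ \<sigma>2]
    by (simp add: \<sigma>1_def \<sigma>2_def)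
  show ?thesis
  proof (cases "\<exists>i<N. ?F i")
    case True
    then obtain i0 where i0: "i0 < N" "?F i0" by blast
    define i where "i = \<sigma>2 2 0"
    have i': "i = (LEAST i. \<sigma>1 (Suc 0) i \<noteq> 0)" unfolding i_def piv using True by simp
    have le: "i \<le> i0" unfolding i' by (rule Least_le) (use FN i0 in simp)
    have "\<sigma>1 (Suc 0) i \<noteq> 0" unfolding i' by (rule LeastI[of _ i0]) (use FN i0 in simp)
    then have i: "i < N" "?F i" using FN[of i] le i0 by auto
    have pr: "rows_ok (run L inp \<rho> (copy_pivot ;; update_rows) \<sigma>2)"
      "\<And>y p. y < N \<Longrightarrow> p < N1 \<Longrightarrow> rows (run L inp \<rho> (copy_pivot ;; update_rows) \<sigma>2) y p =
        (rows \<sigma>2 y p \<noteq> (rows \<sigma>2 y i \<and> ?F p))"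
      using pivot_rows[OF cok(2) ok2 _ i_def[symmetric] i(1), where F = ?F and \<rho> = \<rho>] F2 by blast+
    have sv: "solved N sol (\<lambda>y p. rows \<sigma> y p \<noteq> (rows \<sigma> y i \<and> ?F p)) (insert ?q Qs)"
      by (rule solved_pivot[OF solv form sol_q q_ext i])
    have s': "\<sigma>' = run L inp \<rho> (copy_pivot ;; update_rows) \<sigma>2"
      unfolding \<sigma>' i_def[symmetric] using i(1) by (rule if_P)
    have "solved N sol (rows \<sigma>') (insert ?q Qs)"
    proof (rule solved_cong[OF _ sv])
      show "(rows \<sigma> y p \<noteq> (rows \<sigma> y i \<and> ?F p)) = rows \<sigma>' y p" if "p < N1" "y < N" for y p
        using pr(2)[OF that(2,1)] unfolding s' rows2 by blast
      show "q z = q z'" if "q \<in> insert ?q Qs" "\<And>y. y < N \<Longrightarrow> z y = z' y" for q z z'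
        using that ext[of q z z'] q_ext[of z z'] by blast
    qed
    moreover have "rows_ok \<sigma>'" using pr(1) unfolding s' .
    ultimately show ?thesis by blast
  next
    case False
    then have "\<sigma>2 2 0 = N" unfolding piv by (rule if_not_P)
    then have "\<sigma>' = \<sigma>2" unfolding \<sigma>' by simp
    moreover have "solved N sol (rows \<sigma>) (insert ?q Qs)"
      using False by (intro solved_no_pivot[OF solv form sol_q q_ext _ ex]) auto
    ultimately show ?thesis using ok2 rows2 by simp
  qed
qed

lemma eliminate_ok:
  assumes \<rho>: "env_ok \<rho>" and ok: "rows_ok \<sigma>"
    and init: "\<And>y p. y < N \<Longrightarrow> p < N1 \<Longrightarrow> rows \<sigma> y p \<longleftrightarrow> p = y"
    and x: "root_system G n x"
  defines "\<sigma>' \<equiv> run L inp \<rho> eliminate \<sigma>"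
  shows "rows_ok \<sigma>' \<and> root_system G n (\<lambda>u v. rows \<sigma>' (u * n + v) N)"
proof -
  \<comment> \<open>The equations treated before the loops reach \<open>(u, v, l)\<close>, in
    lexicographic order.\<close>
  define D3 where "D3 u v l = {eqn a b c |a b c. b < n \<and> c < n \<and>
    (a < u \<or> a = u \<and> (b < v \<or> b = v \<and> c < l))}" for u v l
  have D3_step: "D3 u v (Suc l) = insert (eqn u v l) (D3 u v l)" if "v < n" "l < n" for u v l
    using that unfolding D3_def by (auto simp: less_Suc_eq)
  have D3_2: "D3 u v n = D3 u (Suc v) 0" if "v < n" for u v
    using that unfolding D3_def by (auto simp: less_Suc_eq)
  have D3_1: "D3 u n 0 = D3 (Suc u) 0 0" for u
    unfolding D3_def by (auto simp: less_Suc_eq)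
  have ext: "q z = q z'" if q: "q \<in> D3 u v l" and "u < n" and z: "\<And>y. y < N \<Longrightarrow> z y = z' y" for q z z' u v l
  proof -
    obtain a b c where "q = eqn a b c" "a < n" "b < n" "c < n" using q \<open>u < n\<close> unfolding D3_def by auto
    then show ?thesis using eqn_ext[of a b c z z'] z by simp
  qed
  define z0 where "z0 y = x (y div n) (y mod n)" for y
  have "z0 (a * n + b) = x a b" if "b < n" for a b using that by (simp add: z0_def)
  then have "eqn u v w z0 = root_eq G u v w x" if "u < n" "v < n" "w < n" for u v w
    using that unfolding eqn_def root_eq_def by simp
  then have ex: "sol z0" using x by (simp add: sol_def root_system_def)
  let ?I = "\<lambda>u v w \<sigma>. rows_ok \<sigma> \<and> solved N sol (rows \<sigma>) (D3 u v w)"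
  have "?I n 0 0 \<sigma>'"
    unfolding \<sigma>'_def eliminate_def
  proof (rule run_For_inv[where P = "\<lambda>u. ?I u 0 0" and b = n])
    have "solved N sol (rows \<sigma>) {}"
      by (rule solved_cong[OF _ solved_init]) (use init in auto)
    moreover have "D3 0 0 0 = {}" by (auto simp: D3_def)
    ultimately show "?I 0 0 0 \<sigma>" using ok by simp
  next
    fix u \<sigma>1 assume u: "u < n" and I1: "?I u 0 0 \<sigma>1"
    show "?I (Suc u) 0 0 (run L inp (\<rho>(2 := u)) (For 3 (Var 0) (For 4 (Var 0)
      (When (AndE (adjE (Var 2) (Var 3)) (AndE (adjE (Var 2) (Var 4)) (NotE (EqE (Var 3) (Var 4)))))
      (form_row ;; find_pivot ;; When (LtE (Arr 2 (Num 0)) (con 0)) (copy_pivot ;; update_rows))))) \<sigma>1)"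
    proof (rule run_For_inv[where P = "\<lambda>v. ?I u v 0" and b = n])
      fix v \<sigma>2 assume v: "v < n" and I2: "?I u v 0 \<sigma>2"
      show "?I u (Suc v) 0 (run L inp (\<rho>(2 := u, 3 := v)) (For 4 (Var 0)
        (When (AndE (adjE (Var 2) (Var 3)) (AndE (adjE (Var 2) (Var 4)) (NotE (EqE (Var 3) (Var 4)))))
        (form_row ;; find_pivot ;; When (LtE (Arr 2 (Num 0)) (con 0)) (copy_pivot ;; update_rows)))) \<sigma>2)"
      proof (rule run_For_inv[where P = "\<lambda>w. ?I u v w" and b = n])
        fix w \<sigma>3 assume w: "w < n" and I3: "?I u v w \<sigma>3"
        let ?\<rho> = "\<rho>(2 := u, 3 := v, 4 := w)"
        let ?b = "form_row ;; find_pivot ;; When (LtE (Arr 2 (Num 0)) (con 0)) (copy_pivot ;; update_rows)"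
        let ?g = "AndE (adjE (Var 2) (Var 3)) (AndE (adjE (Var 2) (Var 4)) (NotE (EqE (Var 3) (Var 4))))"
        have fr: "fresh_c 98 ?b" by (simp add: com_defs sugar_defs)
        have g: "eval L inp \<sigma>3 ?\<rho> ?g \<noteq> 0 \<longleftrightarrow> adjacent G u v \<and> adjacent G u w \<and> v \<noteq> w"
          using \<rho> u v w L_bounds(11) by (auto simp: eval_AndE eval_adjE eval_NotE eval_EqE)
        show "?I u v (Suc w) (run L inp ?\<rho> (When ?g ?b) \<sigma>3)"
        proof (cases "adjacent G u v \<and> adjacent G u w \<and> v \<noteq> w")
          case True
          then have "run L inp ?\<rho> (When ?g ?b) \<sigma>3 = run L inp ?\<rho> ?b \<sigma>3"
            by (subst run_When[OF fr L_bounds(11)], intro if_P) (use g in blast)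
          moreover have "rows_ok (run L inp ?\<rho> ?b \<sigma>3) \<and> solved N sol (rows (run L inp ?\<rho> ?b \<sigma>3))
              (insert (eqn (?\<rho> 2) (?\<rho> 3) (?\<rho> 4)) (D3 u v w))"
            by (rule eliminate_step) (use \<rho> u v w I3 ext ex True in auto)
          ultimately show ?thesis using D3_step[OF v w] by simp
        next
          case False
          then have "run L inp ?\<rho> (When ?g ?b) \<sigma>3 = \<sigma>3"
            by (subst run_When[OF fr L_bounds(11)], intro if_not_P) (use g in blast)
          \<comment> \<open>A triple rejected by the guard carries an equation that holds for every
            \<open>z\<close>.\<close>
          moreover have "eqn u v w z" for z using False by (auto simp: eqn_def root_eq_def)
          ultimately show ?thesis using I3 D3_step[OF v w] unfolding solved_def by auto
        qed
      qed (use I2 \<rho> D3_2[OF v] L_bounds in \<open>auto simp: env_ok_def\<close>)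
    qed (use I1 \<rho> D3_1 L_bounds in \<open>auto simp: env_ok_def\<close>)
  qed (use \<rho> L_bounds in \<open>auto simp: env_ok_def\<close>)
  \<comment> \<open>With all parameters set to 0 only the constant terms survive: column
    \<open>N\<close> of the rows is itself a solution.\<close>
  then have fin: "rows_ok \<sigma>'" "\<And>q. q \<in> D3 n 0 0 \<Longrightarrow> q (\<lambda>y. affine N (rows \<sigma>' y) (\<lambda>_. False))"
    unfolding solved_def by auto
  have "root_eq G u v w (\<lambda>u v. rows \<sigma>' (u * n + v) N)" if "u < n" "v < n" "w < n" for u v w
  proof -
    have "eqn u v w \<in> D3 n 0 0" using that unfolding D3_def by blast
    from fin(2)[OF this] show ?thesis by (simp add: affine_zero eqn_def)
  qed
  then show ?thesis using fin(1) unfolding root_system_def by blast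
qed

lemma compute_rep_ok:
  fixes \<sigma> :: store
  assumes \<rho>: "env_ok \<rho>" and ok: "rows_ok \<sigma>"
  defines "x \<equiv> \<lambda>u v. rows \<sigma> (u * n + v) N"
  shows "\<forall>u<n. \<forall>i<2. run L inp \<rho> compute_rep \<sigma> 4 (u * 2 + i) = rep G x (u * 2 + i)"
  unfolding compute_rep_def
proof (rule run_fill2)
  fix u i \<sigma>' assume u: "u < n" and i: "i < (2::nat)" and fr: "\<And>j. j \<noteq> 4 \<Longrightarrow> \<sigma>' j = \<sigma> j"
  let ?\<rho> = "\<rho>(2 := u, 3 := i)"
  let ?in = "AndE (EqE (Var 4) (Plus (Plus (Var 6) (Var 6)) (Var 7)))
        (OrE (AndE (EqE (Var 2) (Var 6)) (EqE (Var 3) (Var 7)))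
          (AndE (adjE (Var 2) (Var 6)) (AndE (EqE (rowE (Var 2) (Var 6) (con 0)) (Var 3))
             (EqE (rowE (Var 6) (Var 2) (con 0)) (Var 7)))))"
  let ?body = "ExE 6 (Var 0) (ExE 7 (Num 2) ?in)"
  have c: "consts_ok (\<sigma>' 11)" and e: "\<sigma>' 0 = \<sigma> 0" using fr ok by (simp_all add: rows_ok_def)
  have c0: "\<sigma>' 11 0 = N" "\<sigma>' 11 5 = V" using c by (simp_all add: consts_ok_def)
  have r: "\<sigma> 0 ((a * n + b) * N1 + N) = of_bool (x a b)" if "a < n" "b < n" for a b
    using rows_of_bool[OF ok, of "a * n + b" N] mixed_radix_less[OF that] by (simp add: N_def N1_def x_def)
  have ev_in: "eval L inp \<sigma>' (?\<rho>(4 := b, 6 := v, 7 := j)) ?in \<noteq> 0 \<longleftrightarrow>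
      b = v + v + j \<and> (u = v \<and> i = j \<or> adjacent G u v \<and> of_bool (x u v) = i \<and> of_bool (x v u) = j)"
    if "v < n" for b v j
    using that u \<rho> c e c0 r L_bounds(11)
    by (auto simp: eval_AndE eval_OrE eval_EqE eval_adjE eval_rowE)
  have ev: "eval L inp \<sigma>' (?\<rho>(4 := b)) ?body \<noteq> 0 \<longleftrightarrow> b < V \<and> same_end G x (u * 2 + i) b" for b
  proof -
    have "eval L inp \<sigma>' (?\<rho>(4 := b)) ?body \<noteq> 0 \<longleftrightarrow> (\<exists>v<n. \<exists>j<2. b = v + v + j \<and>
        (u = v \<and> i = j \<or> adjacent G u v \<and> of_bool (x u v) = i \<and> of_bool (x v u) = j))"
    proof -
      have "eval L inp \<sigma>' (?\<rho>(4 := b)) ?body \<noteq> 0 \<longleftrightarrow>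
          (\<exists>v<n. \<exists>j<2. eval L inp \<sigma>' (?\<rho>(4 := b, 6 := v, 7 := j)) ?in \<noteq> 0)"
        using \<rho> L_bounds(1,12) by (simp add: eval_ExE env_ok_def)
      then show ?thesis by (simp only: ev_in cong: conj_cong)
    qed
    also have "\<dots> \<longleftrightarrow> b < V \<and> same_end G x (u * 2 + i) b"
    proof
      assume "\<exists>v<n. \<exists>j<2. b = v + v + j \<and>
        (u = v \<and> i = j \<or> adjacent G u v \<and> of_bool (x u v) = i \<and> of_bool (x v u) = j)"
      then obtain v j where *: "v < n" "j < 2" "b = v + v + j"
        "u = v \<and> i = j \<or> adjacent G u v \<and> of_bool (x u v) = i \<and> of_bool (x v u) = j" by blast
      have "b div 2 = v" "(u * 2 + i) div 2 = u" using * i by auto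
      then show "b < V \<and> same_end G x (u * 2 + i) b"
        using * i unfolding same_end_def V_def by (auto simp: of_bool_def split: if_splits)
    next
      assume b: "b < V \<and> same_end G x (u * 2 + i) b"
      define v j where "v = b div 2" and "j = b mod 2"
      have vj: "v < n" "j < 2" "b = v + v + j" using b unfolding v_def j_def V_def by auto presburger
      have div: "(u * 2 + i) div 2 = u" "b div 2 = v" using i by (auto simp: v_def)
      have odd: "odd (u * 2 + i) \<longleftrightarrow> i = 1" "odd b \<longleftrightarrow> j = 1" using i by (auto simp: j_def odd_iff_mod_2_eq_one)
      have "u = v \<and> i = j \<or> adjacent G u v \<and> of_bool (x u v) = i \<and> of_bool (x v u) = j"
      proof (cases "u * 2 + i = b")
        case True
        then show ?thesis using i by (auto simp: v_def j_def)
      next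
        case False
        then have *: "adjacent G u v" "x u v \<longleftrightarrow> i = 1" "x v u \<longleftrightarrow> j = 1"
          using b unfolding same_end_def div odd by auto
        have "of_bool (x u v) = i" "of_bool (x v u) = j" unfolding *(2,3) using i vj(2) by auto
        then show ?thesis using *(1) by blast
      qed
      then show "\<exists>v<n. \<exists>j<2. b = v + v + j \<and>
        (u = v \<and> i = j \<or> adjacent G u v \<and> of_bool (x u v) = i \<and> of_bool (x v u) = j)"
        using vj by blast
    qed
    finally show ?thesis .
  qed
  \<comment> \<open>The least equivalent end is at most \<open>u * 2 + i\<close>, so searching below
    \<open>V\<close> finds it.\<close>
  have rl: "rep G x (u * 2 + i) < V" using rep_le[of G x "u * 2 + i"] u i by (simp add: V_def)
  have "(LEAST b. b < V \<and> same_end G x (u * 2 + i) b) = rep G x (u * 2 + i)"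
  proof (rule Least_equality)
    show "rep G x (u * 2 + i) < V \<and> same_end G x (u * 2 + i) (rep G x (u * 2 + i))"
      using rl same_end_rep by blast
    show "rep G x (u * 2 + i) \<le> y" if "y < V \<and> same_end G x (u * 2 + i) y" for y
      unfolding rep_def by (rule Least_le) (use that in blast)
  qed
  moreover have "\<exists>b<V. same_end G x (u * 2 + i) b" using rl same_end_rep by blast
  moreover have "eval L inp \<sigma>' ?\<rho> (FirstE 4 5 (con 5) ?body) =
      (if \<exists>b<V. b < V \<and> same_end G x (u * 2 + i) b
       then LEAST b. b < V \<and> same_end G x (u * 2 + i) b else V)"
  proof -
    have "fresh 5 ?body" by (simp add: sugar_defs adjE_def rowE_def)
    from eval_FirstE[OF _ this, of L inp \<sigma>' ?\<rho> "con 5" 4] show ?thesis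
      unfolding ev using c0 L_bounds(4) by auto
  qed
  ultimately have "eval L inp \<sigma>' ?\<rho> (FirstE 4 5 (con 5) ?body) = rep G x (u * 2 + i)" by auto
  then show "eval L inp \<sigma>' ?\<rho> (Plus (Plus (Var 2) (Var 2)) (Var 3)) = u * 2 + i \<and>
    eval L inp \<sigma>' ?\<rho> (FirstE 4 5 (con 5) ?body) = rep G x (u * 2 + i)" by simp
qed (use \<rho> L_bounds in \<open>auto simp: env_ok_def\<close>)

definition pow_ok :: "(nat \<Rightarrow> nat) \<Rightarrow> bool" where
  "pow_ok a \<longleftrightarrow> (\<forall>j\<le>NC. a j = 2 ^ j)"

lemma compute_pow2_ok:
  assumes "consts_ok (\<sigma> 11)"
  shows "pow_ok (run L inp \<rho> compute_pow2 \<sigma> 5)"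
proof -
  define \<sigma>1 where "\<sigma>1 = run L inp \<rho> (Put 5 (Num 0) (Num 1)) \<sigma>"
  have s1: "\<sigma>1 11 4 = NC" "\<sigma>1 5 0 = 1" using assms by (simp_all add: \<sigma>1_def consts_ok_def)
  have "run L inp \<rho> compute_pow2 \<sigma> = run L inp \<rho> (For 2 (Plus (con 4) (Num 1))
    (Put 5 (Plus (Var 2) (Num 1)) (Plus (Arr 5 (Var 2)) (Arr 5 (Var 2))))) \<sigma>1"
    by (simp only: compute_pow2_def run.simps(2) \<sigma>1_def)
  moreover have "\<forall>j\<le>Suc NC. run L inp \<rho> (For 2 (Plus (con 4) (Num 1))
    (Put 5 (Plus (Var 2) (Num 1)) (Plus (Arr 5 (Var 2)) (Arr 5 (Var 2))))) \<sigma>1 5 j = 2 ^ j"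
    by (rule run_For_inv[where P = "\<lambda>i \<sigma>'. \<forall>j\<le>i. \<sigma>' 5 j = 2 ^ j" and b = "Suc NC"])
      (use s1 L_bounds in \<open>auto simp: le_Suc_eq\<close>)
  ultimately show ?thesis unfolding pow_ok_def by simp
qed

lemma odd_div_pow2_iff:
  "(\<exists>y<c + 1. \<exists>r<2 ^ t. c = (y + y + 1) * 2 ^ t + r) \<longleftrightarrow> odd (c div 2 ^ t)" for c t :: nat
proof
  assume "\<exists>y<c + 1. \<exists>r<2 ^ t. c = (y + y + 1) * 2 ^ t + r"
  then obtain y r where "r < 2 ^ t" "c = (y + y + 1) * 2 ^ t + r" by blast
  moreover have "(a * m + r) div m = a" if "r < m" for a m r :: nat using that by simp
  ultimately have "c div 2 ^ t = y + y + 1" by blast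
  then show "odd (c div 2 ^ t)" by simp
next
  assume "odd (c div 2 ^ t)"
  then obtain y where y: "c div 2 ^ t = 2 * y + 1" by (rule oddE)
  have "c = (y + y + 1) * 2 ^ t + c mod 2 ^ t" using y div_mult_mod_eq[of c "2 ^ t"] by (simp add: mult_2)
  moreover have "y \<le> c" using y div_le_dividend[of c "2 ^ t"] by linarith
  ultimately show "\<exists>y<c + 1. \<exists>r<2 ^ t. c = (y + y + 1) * 2 ^ t + r"
    by (intro exI[of _ y] conjI exI[of _ "c mod 2 ^ t"]) auto
qed

lemma eval_bitE:
  assumes "pow_ok (\<sigma> 5)" "eval L inp \<sigma> \<rho> t \<le> NC" "eval L inp \<sigma> \<rho> c < 2 ^ NC"
    and fr: "fresh 20 t" "fresh 21 t" "fresh 99 t" "fresh 20 c" "fresh 21 c"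
  shows "eval L inp \<sigma> \<rho> (bitE t c) = of_bool (eval L inp \<sigma> \<rho> t \<in> set_decode (eval L inp \<sigma> \<rho> c))"
proof -
  let ?t = "eval L inp \<sigma> \<rho> t" and ?c = "eval L inp \<sigma> \<rho> c"
  have ct: "eval L inp \<sigma> (\<rho>(20 := y)) c = ?c" "eval L inp \<sigma> (\<rho>(20 := y, 21 := r)) c = ?c"
    "eval L inp \<sigma> (\<rho>(20 := y)) t = ?t" "eval L inp \<sigma> (\<rho>(20 := y, 21 := r)) t = ?t" for y r
    using fr by (simp_all add: eval_fresh del: fun_upd_apply)
  have p: "\<sigma> 5 ?t = 2 ^ ?t" using assms by (simp add: pow_ok_def)
  have "(2::nat) ^ ?t \<le> 2 ^ NC" using assms(2) by (intro power_increasing) auto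
  \<comment> \<open>The spare factor 4 in \<open>L\<close> leaves room for \<open>y + y + 1\<close>,
    the loop bound of the product in \<open>bitE\<close>.\<close>
  moreover have "(2::nat) ^ NC * 4 \<le> L" using L_bounds(13) by simp
  ultimately have b: "2 ^ ?t \<le> L" "?c + 1 \<le> L" "y < ?c + 1 \<Longrightarrow> y + y + 1 \<le> L" for y
    using assms(3) by linarith+
  have "eval L inp \<sigma> \<rho> (bitE t c) = of_bool (\<exists>y<?c + 1. \<exists>r<2 ^ ?t. ?c = (y + y + 1) * 2 ^ ?t + r)"
  proof -
    have "eval L inp \<sigma> (\<rho>(20 := y, 21 := r)) (EqE c (Plus (MulE (Plus (Plus (Var 20) (Var 20)) (Num 1))
      (Arr 5 t)) (Var 21))) = of_bool (?c = (y + y + 1) * 2 ^ ?t + r)" if "y < ?c + 1" for y r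
      using b(3)[OF that] fr(3) by (simp add: eval_EqE eval_MulE ct p)
    then show ?thesis
      unfolding bitE_def using b by (simp add: eval_ExE ct p del: fun_upd_apply)
  qed
  then show ?thesis unfolding odd_div_pow2_iff set_decode_def by simp
qed

end

lemma reach_less: "reach V E col D w e \<Longrightarrow> w < V"
  by (induction rule: reach.induct)

text \<open>The recurrence of the table: the colour of \<open>w\<close> was new when
  \<open>w\<close> was added, so the colour set before it can only be
  \<open>D - {col w}\<close>.\<close>

lemma reach_iff:
  "reach V E col D w e \<longleftrightarrow> w < V \<and> col w \<in> D \<and> (D - {col w} = {} \<and> e = 0 \<or>
    (\<exists>v<V. even e \<and> reach V E col (D - {col w}) v e \<or>
      1 \<le> e \<and> reach V E col (D - {col w}) v (e - 1) \<and> E v w))"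
proof
  assume "reach V E col D w e"
  then show "w < V \<and> col w \<in> D \<and> (D - {col w} = {} \<and> e = 0 \<or>
    (\<exists>v<V. even e \<and> reach V E col (D - {col w}) v e \<or>
      1 \<le> e \<and> reach V E col (D - {col w}) v (e - 1) \<and> E v w))"
  proof cases
    case start
    then show ?thesis by simp
  next
    case (step C v e')
    then have "D - {col w} = C" by auto
    then show ?thesis using step reach_less[of V E col C v e'] by (auto intro!: exI[of _ v])
  next
    case (jump C v)
    then have "D - {col w} = C" by auto
    then show ?thesis using jump reach_less[of V E col C v e] by (auto intro!: exI[of _ v])
  qed
next
  assume *: "w < V \<and> col w \<in> D \<and> (D - {col w} = {} \<and> e = 0 \<or>
    (\<exists>v<V. even e \<and> reach V E col (D - {col w}) v e \<or>
      1 \<le> e \<and> reach V E col (D - {col w}) v (e - 1) \<and> E v w))"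
  then have D: "insert (col w) (D - {col w}) = D" by auto
  consider "D = {col w}" "e = 0" | v where "even e" "reach V E col (D - {col w}) v e"
    | v where "1 \<le> e" "reach V E col (D - {col w}) v (e - 1)" "E v w" using * D by force
  then show "reach V E col D w e"
  proof cases
    case 1
    then show ?thesis using * reach.start by simp
  next
    case 2
    then show ?thesis using reach.jump[OF 2(2,1), of w] * D by simp
  next
    case 3
    then show ?thesis using reach.step[of V E col "D - {col w}" v "e - 1" w] * D by simp
  qed
qed

lemma set_decode_minus:
  assumes "c \<in> set_decode C"
  shows "set_decode (C - 2 ^ c) = set_decode C - {c}"
proof -
  have fin: "finite (set_decode C)" by simp
  have "set_encode (set_decode C - {c}) = set_encode (set_decode C) - 2 ^ c"
    unfolding set_encode_def using assms fin by (simp add: sum_diff1_nat)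
  then have "set_encode (set_decode C - {c}) = C - 2 ^ c" by simp
  then show ?thesis using fin by (metis finite_Diff set_encode_inverse)
qed

lemma set_encode_less: "finite A \<Longrightarrow> A \<subseteq> {..<m} \<Longrightarrow> set_encode A < 2 ^ m"
proof -
  assume A: "finite A" "A \<subseteq> {..<m}"
  have "set_encode A \<le> (\<Sum>i<m. 2 ^ i)" unfolding set_encode_def using A by (intro sum_mono2) auto
  also have "\<dots> < 2 ^ m" by (induction m) auto
  finally show ?thesis .
qed

lemma colouring_cong:
  "(\<And>t. t < B \<Longrightarrow> T t = T' t) \<Longrightarrow> colouring W y T B = colouring W y T' B"
  by (induction B) auto

section \<open>Simulation of the colouring process\<close>

context decide_run
begin

definition col_state :: "store \<Rightarrow> (nat \<Rightarrow> nat) \<times> (nat \<Rightarrow> nat) \<times> nat \<Rightarrow> bool" where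
  "col_state \<sigma> s \<longleftrightarrow> (\<forall>x<V. \<sigma> 7 x = fst s x) \<and> (\<forall>x<V. \<sigma> 6 x = fst (snd s) x) \<and> \<sigma> 8 0 = snd (snd s)"

lemma W_pos: "0 < W"
  by (simp add: W_def)

lemma init_colouring_ok:
  assumes c: "consts_ok (\<sigma> 11)" and a: "\<rho> 2 < W"
  shows "col_state (run L inp \<rho> init_colouring \<sigma>) (colouring W (\<lambda>x. \<rho> 2 * x mod W) T 0)"
proof -
  define \<sigma>0 where "\<sigma>0 = run L inp \<rho> (Put 6 (Num 0) (Num 0)) \<sigma>"
  define c1 where "c1 = For 4 (con 5) (Put 6 (Plus (Var 4) (Num 1))
    (Minus (Plus (Arr 6 (Var 4)) (Var 2)) (MulE (LeE (con 2) (Plus (Arr 6 (Var 4)) (Var 2))) (con 2))))"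
  define c2 where "c2 = For 4 (con 5) (Put 7 (Var 4) (Num 0))"
  define \<sigma>1 where "\<sigma>1 = run L inp \<rho> c1 \<sigma>0"
  define \<sigma>2 where "\<sigma>2 = run L inp \<rho> c2 \<sigma>1"
  have fin: "run L inp \<rho> init_colouring \<sigma> = run L inp \<rho> (Put 8 (Num 0) (Num 1)) \<sigma>2"
    by (simp only: init_colouring_def run.simps(2) \<sigma>0_def \<sigma>1_def \<sigma>2_def c1_def c2_def)
  have c0: "consts_ok (\<sigma>0 11)" "\<sigma>0 6 0 = 0" using c by (simp_all add: \<sigma>0_def)
  have s1: "\<forall>x\<le>V. \<sigma>1 6 x = \<rho> 2 * x mod W"
    unfolding \<sigma>1_def c1_def
  proof (rule run_For_inv[where P = "\<lambda>i \<sigma>'. consts_ok (\<sigma>' 11) \<and> (\<forall>x\<le>i. \<sigma>' 6 x = \<rho> 2 * x mod W)" and b = V])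
    fix i and \<sigma>' :: store assume P: "consts_ok (\<sigma>' 11) \<and> (\<forall>x\<le>i. \<sigma>' 6 x = \<rho> 2 * x mod W)"
    let ?y = "\<rho> 2 * i mod W"
    have y: "\<sigma>' 6 i = ?y" "?y < W" using P W_pos by auto
    have "?y + \<rho> 2 - of_bool (W \<le> ?y + \<rho> 2) * W = (?y + \<rho> 2) mod W"
    proof (cases "W \<le> ?y + \<rho> 2")
      case True
      then have "(?y + \<rho> 2) mod W = (?y + \<rho> 2 - W) mod W" by (rule le_mod_geq)
      also have "\<dots> = ?y + \<rho> 2 - W" using y(2) a by (intro mod_less) linarith
      finally show ?thesis using True by simp
    qed simp
    also have "\<dots> = (\<rho> 2 * i + \<rho> 2) mod W" by (rule mod_add_left_eq)
    also have "\<rho> 2 * i + \<rho> 2 = \<rho> 2 * Suc i" by simp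
    finally have e: "?y + \<rho> 2 - of_bool (W \<le> ?y + \<rho> 2) * W = \<rho> 2 * Suc i mod W" .
    have cc: "\<sigma>' 11 2 = W" using P by (simp add: consts_ok_def)
    have v: "eval L inp \<sigma>' (\<rho>(4 := i)) (Minus (Plus (Arr 6 (Var 4)) (Var 2))
        (MulE (LeE (con 2) (Plus (Arr 6 (Var 4)) (Var 2))) (con 2))) = \<rho> 2 * Suc i mod W"
      using e y(1) cc L_bounds(11) by (simp add: eval_MulE eval_LeE del: mult_Suc_right)
    show "consts_ok (run L inp (\<rho>(4 := i)) (Put 6 (Plus (Var 4) (Num 1)) (Minus (Plus (Arr 6 (Var 4)) (Var 2))
        (MulE (LeE (con 2) (Plus (Arr 6 (Var 4)) (Var 2))) (con 2)))) \<sigma>' 11) \<and>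
      (\<forall>x\<le>Suc i. run L inp (\<rho>(4 := i)) (Put 6 (Plus (Var 4) (Num 1)) (Minus (Plus (Arr 6 (Var 4)) (Var 2))
        (MulE (LeE (con 2) (Plus (Arr 6 (Var 4)) (Var 2))) (con 2)))) \<sigma>' 6 x = \<rho> 2 * x mod W)"
      unfolding run.simps v using P by (auto simp: le_Suc_eq)
  qed (use c0 L_bounds in \<open>auto simp: consts_ok_def\<close>)
  have s1c: "\<sigma>1 11 = \<sigma>0 11" unfolding \<sigma>1_def by (rule run_unchanged) (simp add: c1_def)
  have "\<forall>x<V. \<sigma>2 7 x = 0"
    unfolding \<sigma>2_def c2_def
    by (rule run_fill1) (use c0 s1c L_bounds in \<open>auto simp: consts_ok_def\<close>)
  moreover have "\<sigma>2 6 = \<sigma>1 6" unfolding \<sigma>2_def by (rule run_unchanged) (simp add: c2_def)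
  ultimately show ?thesis using s1 unfolding fin col_state_def by simp
qed

lemma do_split_ok:
  assumes c: "consts_ok (\<sigma> 11)" and s: "col_state \<sigma> s"
  shows "col_state (run L inp \<rho> do_split \<sigma>) (split_class W (\<rho> 4) s)"
proof -
  obtain col y m where s': "s = (col, y, m)" by (metis prod_cases3)
  let ?t = "\<rho> 4"
  define col' where "col' x = (if col x = ?t then m + of_bool (W \<le> 2 * y x) else col x)" for x
  define y' where "y' x = (if col x = ?t then 2 * y x - W * of_bool (W \<le> 2 * y x) else y x)" for x
  let ?g = "EqE (Arr 7 (Var 5)) (Var 4)"
  let ?b1 = "Put 7 (Var 5) (Plus (Arr 8 (Num 0)) (LeE (con 2) (Plus (Arr 6 (Var 5)) (Arr 6 (Var 5)))))"
  let ?b2 = "Put 6 (Var 5) (Minus (Plus (Arr 6 (Var 5)) (Arr 6 (Var 5)))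
       (MulE (LeE (con 2) (Plus (Arr 6 (Var 5)) (Arr 6 (Var 5)))) (con 2)))"
  define \<sigma>1 where "\<sigma>1 = run L inp \<rho> (For 5 (con 5) (When ?g (?b1 ;; ?b2))) \<sigma>"
  let ?P = "\<lambda>i (\<sigma>' :: store). consts_ok (\<sigma>' 11) \<and> \<sigma>' 8 0 = m \<and>
    (\<forall>x<V. \<sigma>' 7 x = (if x < i then col' x else col x)) \<and> (\<forall>x<V. \<sigma>' 6 x = (if x < i then y' x else y x))"
  have P: "?P V \<sigma>1"
    unfolding \<sigma>1_def
  proof (rule run_For_inv[where P = ?P and b = V])
    show "?P 0 \<sigma>" using c s by (simp add: s' col_state_def)
    show "eval L inp \<sigma> \<rho> (con 5) = V" using c by (simp add: consts_ok_def)
  next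
    fix x and \<sigma>' :: store assume x: "x < V" and P: "?P x \<sigma>'"
    let ?\<rho> = "\<rho>(5 := x)"
    have cc: "\<sigma>' 11 2 = W" using P by (simp add: consts_ok_def)
    have o: "\<sigma>' 7 x = col x" "\<sigma>' 6 x = y x" using P x by auto
    have fr: "fresh_c 98 (?b1 ;; ?b2)" by (simp add: sugar_defs)
    have g: "eval L inp \<sigma>' ?\<rho> ?g \<noteq> 0 \<longleftrightarrow> col x = ?t" using o by (simp add: eval_EqE)
    show "?P (Suc x) (run L inp ?\<rho> (When ?g (?b1 ;; ?b2)) \<sigma>')"
    proof (cases "col x = ?t")
      case True
      have "run L inp ?\<rho> (When ?g (?b1 ;; ?b2)) \<sigma>' = run L inp ?\<rho> (?b1 ;; ?b2) \<sigma>'"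
        by (subst run_When[OF fr L_bounds(11)], intro if_P) (use g True in blast)
      also have "\<dots> = \<sigma>'(7 := (\<sigma>' 7)(x := col' x), 6 := (\<sigma>' 6)(x := y' x))"
        using o cc True P L_bounds(11)
        by (simp add: eval_LeE eval_MulE col'_def y'_def mult_2)
      finally show ?thesis using P by (auto simp: less_Suc_eq)
    next
      case False
      have "run L inp ?\<rho> (When ?g (?b1 ;; ?b2)) \<sigma>' = \<sigma>'"
        by (subst run_When[OF fr L_bounds(11)], intro if_not_P) (use g False in blast)
      then show ?thesis using P False by (auto simp: less_Suc_eq col'_def y'_def)
    qed
  qed (use L_bounds in auto)
  have "run L inp \<rho> do_split \<sigma> = run L inp \<rho> (Put 8 (Num 0) (Plus (Arr 8 (Num 0)) (Num 2))) \<sigma>1"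
    by (simp only: do_split_def run.simps(2) \<sigma>1_def)
  moreover have "split_class W ?t s = (col', y', m + 2)"
    by (simp add: split_class_def s' col'_def y'_def fun_eq_iff)
  ultimately show ?thesis using P by (simp add: col_state_def)
qed

lemma do_colouring_ok:
  assumes c: "consts_ok (\<sigma> 11)" "pow_ok (\<sigma> 5)" and adv: "\<rho> 3 < 2 ^ Bt"
    and s: "col_state \<sigma> (colouring W y T 0)" and T: "T = (\<lambda>t. t \<in> set_decode (\<rho> 3))"
  shows "col_state (run L inp \<rho> do_colouring \<sigma>) (colouring W y T Bt)"
  unfolding do_colouring_def
proof (rule run_For_inv[where P = "\<lambda>t \<sigma>'. consts_ok (\<sigma>' 11) \<and> pow_ok (\<sigma>' 5) \<and>
    col_state \<sigma>' (colouring W y T t)" and b = Bt])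
  fix t and \<sigma>' :: store assume t: "t < Bt"
    and P: "consts_ok (\<sigma>' 11) \<and> pow_ok (\<sigma>' 5) \<and> col_state \<sigma>' (colouring W y T t)"
  let ?\<rho> = "\<rho>(4 := t)" and ?c = "When (bitE (Var 4) (Var 3)) do_split"
  have fr: "fresh_c 98 do_split" by (simp add: do_split_def sugar_defs)
  have "(2::nat) ^ Bt \<le> 2 ^ NC" by (intro power_increasing) (auto simp: NC_def)
  then have "eval L inp \<sigma>' ?\<rho> (bitE (Var 4) (Var 3)) = of_bool (T t)"
    using P t adv unfolding T by (subst eval_bitE) (auto simp: NC_def)
  then have r: "run L inp ?\<rho> ?c \<sigma>' = (if T t then run L inp ?\<rho> do_split \<sigma>' else \<sigma>')"
    by (simp add: run_When[OF fr L_bounds(11)])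
  have u: "run L inp ?\<rho> do_split \<sigma>' 11 = \<sigma>' 11" "run L inp ?\<rho> do_split \<sigma>' 5 = \<sigma>' 5"
    by (rule run_unchanged; simp add: do_split_def)+
  show "consts_ok (run L inp ?\<rho> ?c \<sigma>' 11) \<and> pow_ok (run L inp ?\<rho> ?c \<sigma>' 5) \<and>
    col_state (run L inp ?\<rho> ?c \<sigma>') (colouring W y T (Suc t))"
    using P do_split_ok[of \<sigma>' "colouring W y T t" ?\<rho>] u unfolding r by simp
qed (use c s L_bounds in \<open>auto simp: consts_ok_def\<close>)

section \<open>The table over colour sets\<close>

definition root_edge :: "(nat \<Rightarrow> nat \<Rightarrow> bool) \<Rightarrow> nat \<Rightarrow> nat \<Rightarrow> bool" where
  "root_edge x v w \<longleftrightarrow> (\<exists>u<n. ends G x u = {v, w})"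

definition rep_ok :: "(nat \<Rightarrow> nat \<Rightarrow> bool) \<Rightarrow> (nat \<Rightarrow> nat) \<Rightarrow> bool" where
  "rep_ok x a \<longleftrightarrow> (\<forall>u<n. \<forall>i<2. a (u * 2 + i) = rep G x (u * 2 + i))"

lemma eval_rootE:
  assumes "env_ok \<rho>" "rep_ok x (\<sigma> 4)" "fresh 24 a" "fresh 24 b" "fresh 99 a" "fresh 99 b"
  shows "eval L inp \<sigma> \<rho> (rootE a b) = of_bool (root_edge x (eval L inp \<sigma> \<rho> a) (eval L inp \<sigma> \<rho> b))"
proof -
  have ab: "eval L inp \<sigma> (\<rho>(24 := u)) a = eval L inp \<sigma> \<rho> a" "eval L inp \<sigma> (\<rho>(24 := u)) b = eval L inp \<sigma> \<rho> b" for u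
    using assms by (simp_all add: eval_fresh del: fun_upd_apply)
  have r: "\<sigma> 4 (u + u) = rep G x (2 * u)" "\<sigma> 4 (Suc (u + u)) = rep G x (Suc (2 * u))" if "u < n" for u
    using assms(2)[unfolded rep_ok_def, rule_format, OF that, of 0]
      assms(2)[unfolded rep_ok_def, rule_format, OF that, of 1]
    by (simp_all add: mult_2 mult_2_right)
  let ?A = "OrE (AndE (EqE (Arr 4 (Plus (Var 24) (Var 24))) a) (EqE (Arr 4 (Plus (Plus (Var 24) (Var 24)) (Num 1))) b))
    (AndE (EqE (Arr 4 (Plus (Var 24) (Var 24))) b) (EqE (Arr 4 (Plus (Plus (Var 24) (Var 24)) (Num 1))) a))"
  have "eval L inp \<sigma> (\<rho>(24 := u)) ?A \<noteq> 0 \<longleftrightarrow> ends G x u = {eval L inp \<sigma> \<rho> a, eval L inp \<sigma> \<rho> b}"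
    if "u < n" for u
    using r[OF that] ab assms(5,6) L_bounds(11)
    by (simp add: eval_OrE eval_AndE eval_EqE ends_def doubleton_eq_iff)
  then have "(\<exists>u<n. eval L inp \<sigma> (\<rho>(24 := u)) ?A \<noteq> 0) \<longleftrightarrow>
      root_edge x (eval L inp \<sigma> \<rho> a) (eval L inp \<sigma> \<rho> b)" unfolding root_edge_def by blast
  then show ?thesis
    unfolding rootE_def using assms(1) L_bounds(1) by (subst eval_ExE) (simp_all add: env_ok_def)
qed

lemma eval_cellE:
  assumes "consts_ok (\<sigma> 11)" "eval L inp \<sigma> \<rho> c < 2 ^ NC" "eval L inp \<sigma> \<rho> w < V"
  shows "eval L inp \<sigma> \<rho> (cellE c w e) =
    \<sigma> 9 ((eval L inp \<sigma> \<rho> c * V + eval L inp \<sigma> \<rho> w) * K + eval L inp \<sigma> \<rho> e)"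
proof -
  have "eval L inp \<sigma> \<rho> c * V + eval L inp \<sigma> \<rho> w < 2 ^ NC * V" by (rule mixed_radix_less[OF assms(2,3)])
  moreover have "(2::nat) ^ NC \<le> 2 ^ (NC + 2)" by (intro power_increasing) auto
  ultimately have "eval L inp \<sigma> \<rho> c * V + eval L inp \<sigma> \<rho> w \<le> L" "eval L inp \<sigma> \<rho> c \<le> L"
    using assms(2) L_bounds(13,14) by linarith+
  then show ?thesis using assms(1) by (simp add: cellE_def eval_MulE consts_ok_def)
qed

lemma eval_evenE:
  assumes "eval L inp \<sigma> \<rho> e < K" "fresh 23 e"
  shows "eval L inp \<sigma> \<rho> (evenE e) = of_bool (even (eval L inp \<sigma> \<rho> e))"
proof -
  have e: "eval L inp \<sigma> (\<rho>(23 := z)) e = eval L inp \<sigma> \<rho> e" for z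
    using assms by (simp add: eval_fresh del: fun_upd_apply)
  have "(\<exists>z<m + 1. m = z + z) \<longleftrightarrow> even m" for m :: nat
    by (auto simp: mult_2[symmetric] elim!: evenE)
  then show ?thesis
    unfolding evenE_def using assms(1) L_bounds(8) by (subst eval_ExE) (simp_all add: eval_EqE e)
qed

lemma fresh_99_derived [simp]:
  "fresh 99 (cellE c w e) = (fresh 99 c \<and> fresh 99 w \<and> fresh 99 e)"
  "fresh 99 (rootE v w) = (fresh 99 v \<and> fresh 99 w)"
  "fresh 99 (evenE e) = fresh 99 e" "fresh 99 restE"
  by (auto simp: cellE_def rootE_def evenE_def restE_def)

definition cell :: "nat \<Rightarrow> nat \<Rightarrow> nat \<Rightarrow> nat" where
  "cell c w e = (c * V + w) * K + e"

lemma cell_eq: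
  "w < V \<Longrightarrow> w' < V \<Longrightarrow> e < K \<Longrightarrow> e' < K \<Longrightarrow> cell c w e = cell c' w' e' \<longleftrightarrow> c = c' \<and> w = w' \<and> e = e'"
  unfolding cell_def by (simp add: mixed_radix_eq)

lemma cell_less: "c < c' \<Longrightarrow> w < V \<Longrightarrow> e < K \<Longrightarrow> cell c w e < cell c' w' e'"
proof -
  assume *: "c < c'" "w < V" "e < K"
  have "cell c w e < (c' * V) * K"
    unfolding cell_def by (rule mixed_radix_less[OF mixed_radix_less[OF *(1,2)] *(3)])
  also have "\<dots> \<le> cell c' w' e'" unfolding cell_def by (simp add: trans_le_add1)
  finally show ?thesis .
qed

lemma fill_table_ok:
  fixes \<sigma> :: store
  assumes \<rho>: "env_ok \<rho>" and c: "consts_ok (\<sigma> 11)" "pow_ok (\<sigma> 5)" "rep_ok x (\<sigma> 4)"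
    and col: "\<And>v. v < V \<Longrightarrow> \<sigma> 7 v = col v" "\<And>v. v < V \<Longrightarrow> col v < NC"
  shows "\<forall>C<2 ^ NC. \<forall>w<V. \<forall>e<K. run L inp \<rho> fill_table \<sigma> 9 (cell C w e) =
    of_bool (reach V (root_edge x) col (set_decode C) w e)"
proof -
  let ?r = "\<lambda>C w e. reach V (root_edge x) col (set_decode C) w e"
  \<comment> \<open>Cells are numbered in the order in which the three nested loops write them, so
    one counter \<open>j\<close> serves as invariant for all three.\<close>
  define P where "P j \<sigma>' \<longleftrightarrow> (\<forall>i. i \<noteq> 9 \<longrightarrow> \<sigma>' i = \<sigma> i) \<and>
    (\<forall>C w e. w < V \<longrightarrow> e < K \<longrightarrow> cell C w e < j \<longrightarrow> \<sigma>' 9 (cell C w e) = of_bool (?r C w e))"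
    for j and \<sigma>' :: store
  let ?ix = "Plus (MulE (Plus (MulE (Var 4) (con 5)) (Var 5)) (con 6)) (Var 6)"
  let ?in = "OrE (AndE (evenE (Var 6)) (cellE restE (Var 22) (Var 6)))
            (AndE (LeE (Num 1) (Var 6)) (AndE (cellE restE (Var 22) (Minus (Var 6) (Num 1)))
              (rootE (Var 22) (Var 5))))"
  let ?v = "AndE (bitE (Arr 7 (Var 5)) (Var 4))
        (OrE (AndE (EqE restE (Num 0)) (EqE (Var 6) (Num 0))) (ExE 22 (con 5) ?in))"
  have NCL: "(2::nat) ^ NC \<le> L"
  proof -
    have "(2::nat) ^ NC \<le> 2 ^ (NC + 2)" by (intro power_increasing) auto
    then show ?thesis using L_bounds(13) by linarith
  qed
  have step: "P (Suc (cell C w e)) (run L inp (\<rho>(4 := C, 5 := w, 6 := e)) (Put 9 ?ix ?v) \<sigma>')"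
    if C: "C < 2 ^ NC" and w: "w < V" and e: "e < K" and P: "P (cell C w e) \<sigma>'" for C w e \<sigma>'
  proof -
    let ?\<rho> = "\<rho>(4 := C, 5 := w, 6 := e)"
    have fr: "\<sigma>' i = \<sigma> i" if "i \<noteq> 9" for i using P that by (simp add: P_def)
    have c': "consts_ok (\<sigma>' 11)" "pow_ok (\<sigma>' 5)" "rep_ok x (\<sigma>' 4)" using c fr by simp_all
    have cv: "\<sigma>' 11 5 = V" "\<sigma>' 11 6 = K" using c'(1) by (simp_all add: consts_ok_def)
    have cw: "\<sigma>' 7 w = col w" "col w < NC" using col w fr by simp_all
    define C' where "C' = C - 2 ^ col w"
    have C': "C' < 2 ^ NC" using C by (simp add: C'_def)
    have pw: "\<sigma>' 5 (col w) = 2 ^ col w" using c'(2) cw(2) by (simp add: pow_ok_def)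
    have rest: "eval L inp \<sigma>' (?\<rho>(22 := v)) restE = C'" "eval L inp \<sigma>' ?\<rho> restE = C'" for v
      using cw(1) pw by (simp_all add: restE_def C'_def)
    have bit: "eval L inp \<sigma>' ?\<rho> (bitE (Arr 7 (Var 5)) (Var 4)) = of_bool (col w \<in> set_decode C)"
      using c'(2) cw C by (subst eval_bitE) simp_all
    have ix: "eval L inp \<sigma>' ?\<rho> ?ix = cell C w e"
    proof -
      have "C * V + w < 2 ^ NC * V" by (rule mixed_radix_less[OF C w])
      then have "C * V + w \<le> L" using L_bounds(14) by linarith
      then show ?thesis using cv C NCL by (simp add: eval_MulE cell_def)
    qed
    have in_eq: "eval L inp \<sigma>' (?\<rho>(22 := v)) ?in \<noteq> 0 \<longleftrightarrow>
        even e \<and> \<sigma>' 9 (cell C' v e) \<noteq> 0 \<or>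
        1 \<le> e \<and> \<sigma>' 9 (cell C' v (e - 1)) \<noteq> 0 \<and> root_edge x v w" if v: "v < V" for v
    proof -
      let ?\<rho>' = "?\<rho>(22 := v)"
      have 1: "eval L inp \<sigma>' ?\<rho>' (evenE (Var 6)) = of_bool (even e)"
        using e by (subst eval_evenE) simp_all
      have 2: "eval L inp \<sigma>' ?\<rho>' (cellE restE (Var 22) (Var 6)) = \<sigma>' 9 (cell C' v e)"
        using c'(1) C' v rest by (subst eval_cellE) (simp_all add: cell_def)
      have 3: "eval L inp \<sigma>' ?\<rho>' (cellE restE (Var 22) (Minus (Var 6) (Num 1))) = \<sigma>' 9 (cell C' v (e - 1))"
        using c'(1) C' v rest by (subst eval_cellE) (simp_all add: cell_def)
      have 4: "eval L inp \<sigma>' ?\<rho>' (rootE (Var 22) (Var 5)) = of_bool (root_edge x v w)"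
        using \<rho> c'(3) by (subst eval_rootE) simp_all
      have 5: "eval L inp \<sigma>' ?\<rho>' (LeE (Num 1) (Var 6)) = of_bool (1 \<le> e)" by (simp add: eval_LeE)
      have f: "fresh 99 (cellE restE (Var 22) (Var 6))" "fresh 99 (rootE (Var 22) (Var 5))"
        "fresh 99 (AndE (cellE restE (Var 22) (Minus (Var 6) (Num 1))) (rootE (Var 22) (Var 5)))" by simp_all
      show ?thesis
        unfolding eval_OrE f[THEN eval_AndE, OF L_bounds(11)] 1 2 3 4 5 by simp
    qed
    have ex_eq: "eval L inp \<sigma>' ?\<rho> (ExE 22 (con 5) ?in) \<noteq> 0 \<longleftrightarrow>
        (\<exists>v<V. even e \<and> \<sigma>' 9 (cell C' v e) \<noteq> 0 \<or>
          1 \<le> e \<and> \<sigma>' 9 (cell C' v (e - 1)) \<noteq> 0 \<and> root_edge x v w)"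
    proof -
      have "eval L inp \<sigma>' ?\<rho> (ExE 22 (con 5) ?in) \<noteq> 0 \<longleftrightarrow> (\<exists>v<V. eval L inp \<sigma>' (?\<rho>(22 := v)) ?in \<noteq> 0)"
        using cv L_bounds(4) by (subst eval_ExE) simp_all
      then show ?thesis using in_eq by blast
    qed
    have fr99: "fresh 99 (OrE (AndE (EqE restE (Num 0)) (EqE (Var 6) (Num 0))) (ExE 22 (con 5) ?in))"
      by simp
    have v_eq: "eval L inp \<sigma>' ?\<rho> ?v = of_bool (col w \<in> set_decode C \<and> (C' = 0 \<and> e = 0 \<or>
        (\<exists>v<V. even e \<and> \<sigma>' 9 (cell C' v e) \<noteq> 0 \<or>
          1 \<le> e \<and> \<sigma>' 9 (cell C' v (e - 1)) \<noteq> 0 \<and> root_edge x v w)))"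
    proof -
      have "eval L inp \<sigma>' ?\<rho> (AndE (EqE restE (Num 0)) (EqE (Var 6) (Num 0))) = of_bool (C' = 0 \<and> e = 0)"
        using L_bounds(11) rest by (simp add: eval_AndE eval_EqE)
      then have "eval L inp \<sigma>' ?\<rho> (OrE (AndE (EqE restE (Num 0)) (EqE (Var 6) (Num 0))) (ExE 22 (con 5) ?in)) =
        of_bool (C' = 0 \<and> e = 0 \<or> (\<exists>v<V. even e \<and> \<sigma>' 9 (cell C' v e) \<noteq> 0 \<or>
          1 \<le> e \<and> \<sigma>' 9 (cell C' v (e - 1)) \<noteq> 0 \<and> root_edge x v w))"
        unfolding eval_OrE ex_eq by simp
      then show ?thesis unfolding eval_AndE[OF fr99 L_bounds(11)] bit by simp
    qed
    have val: "eval L inp \<sigma>' ?\<rho> ?v = of_bool (?r C w e)"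
    proof (cases "col w \<in> set_decode C")
      case True
      have C_minus: "set_decode C' = set_decode C - {col w}"
        unfolding C'_def by (rule set_decode_minus[OF True])
      \<comment> \<open>Hence every cell of \<open>C'\<close>, whatever its vertex and edge count,
        precedes the current one and is already correct.\<close>
      have "C' < C"
      proof -
        have "0 < C" using True by (cases C) auto
        then show ?thesis by (simp add: C'_def)
      qed
      then have rd: "\<sigma>' 9 (cell C' v e') = of_bool (?r C' v e')" if "v < V" "e' < K" for v e'
        using P that cell_less[of C' C v e' w e] unfolding P_def by blast
      have "C' = 0 \<longleftrightarrow> set_decode C - {col w} = {}"
        unfolding C_minus[symmetric] by (metis set_decode_inverse set_decode_zero set_encode_empty)
      moreover have "\<sigma>' 9 (cell C' v e) \<noteq> 0 \<longleftrightarrow> ?r C' v e"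
        "\<sigma>' 9 (cell C' v (e - 1)) \<noteq> 0 \<longleftrightarrow> ?r C' v (e - 1)" if "v < V" for v
        using rd[OF that, of e] rd[OF that, of "e - 1"] e by simp_all
      ultimately show ?thesis
        unfolding v_eq reach_iff[of V "root_edge x" col "set_decode C" w e] C_minus[symmetric]
        using True w by (intro arg_cong[of _ _ of_bool]) (simp cong: conj_cong)
    next
      case False
      then show ?thesis unfolding v_eq reach_iff[of V "root_edge x" col "set_decode C" w e] by simp
    qed
    show ?thesis
      unfolding run.simps ix val P_def
    proof (intro conjI allI impI)
      fix C1 w1 e1 assume 1: "w1 < V" "e1 < K" "cell C1 w1 e1 < Suc (cell C w e)"
      show "(\<sigma>'(9 := (\<sigma>' 9)(cell C w e := of_bool (?r C w e)))) 9 (cell C1 w1 e1) = of_bool (?r C1 w1 e1)"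
      proof (cases "cell C1 w1 e1 = cell C w e")
        case True
        then show ?thesis using cell_eq[OF 1(1) w 1(2) e] by simp
      next
        case False
        then show ?thesis using P 1 unfolding P_def by simp
      qed
    qed (use fr in simp)
  qed
  have "P (cell (2 ^ NC) 0 0) (run L inp \<rho> fill_table \<sigma>)"
    unfolding fill_table_def
  proof (rule run_For_inv[where P = "\<lambda>C. P (cell C 0 0)" and b = "2 ^ NC"])
    show "P (cell 0 0 0) \<sigma>" by (simp add: P_def cell_def)
    show "eval L inp \<sigma> \<rho> (Arr 5 (con 4)) = 2 ^ NC" using c by (simp add: consts_ok_def pow_ok_def)
  next
    fix C \<sigma>1 assume C: "C < 2 ^ NC" and P1: "P (cell C 0 0) \<sigma>1"
    show "P (cell (Suc C) 0 0) (run L inp (\<rho>(4 := C)) (For 5 (con 5) (For 6 (con 6) (Put 9 ?ix ?v))) \<sigma>1)"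
    proof (rule run_For_inv[where P = "\<lambda>w. P (cell C w 0)" and b = V])
      show "eval L inp \<sigma>1 (\<rho>(4 := C)) (con 5) = V" using P1 c by (simp add: P_def consts_ok_def)
    next
      fix w \<sigma>2 assume w: "w < V" and P2: "P (cell C w 0) \<sigma>2"
      show "P (cell C (Suc w) 0) (run L inp (\<rho>(4 := C, 5 := w)) (For 6 (con 6) (Put 9 ?ix ?v)) \<sigma>2)"
      proof (rule run_For_inv[where P = "\<lambda>e. P (cell C w e)" and b = K])
        show "eval L inp \<sigma>2 (\<rho>(4 := C, 5 := w)) (con 6) = K" using P2 c by (simp add: P_def consts_ok_def)
      next
        fix e \<sigma>3 assume "e < K" "P (cell C w e) \<sigma>3"
        then have "P (Suc (cell C w e)) (run L inp (\<rho>(4 := C, 5 := w, 6 := e)) (Put 9 ?ix ?v) \<sigma>3)"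
          using step[OF C w] by blast
        moreover have "Suc (cell C w e) = cell C w (Suc e)" by (simp add: cell_def)
        ultimately show "P (cell C w (Suc e)) (run L inp (\<rho>(4 := C, 5 := w, 6 := e)) (Put 9 ?ix ?v) \<sigma>3)"
          by simp
      next
        fix \<sigma>3 assume "P (cell C w K) \<sigma>3"
        moreover have "cell C w K = cell C (Suc w) 0" by (simp add: cell_def algebra_simps)
        ultimately show "P (cell C (Suc w) 0) \<sigma>3" by simp
      qed (use P2 L_bounds in auto)
    next
      fix \<sigma>2 assume "P (cell C V 0) \<sigma>2"
      moreover have "cell C V 0 = cell (Suc C) 0 0" by (simp add: cell_def algebra_simps)
      ultimately show "P (cell (Suc C) 0 0) \<sigma>2" by simp
    qed (use P1 L_bounds in auto)
  qed (use NCL in auto)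
  then show ?thesis unfolding P_def using cell_less by blast
qed

definition accepts :: "(nat \<Rightarrow> nat \<Rightarrow> bool) \<Rightarrow> nat \<Rightarrow> nat \<Rightarrow> bool" where
  "accepts x a adv \<longleftrightarrow> (\<exists>C<2 ^ NC. \<exists>w<V. reach V (root_edge x)
     (fst (colouring W (\<lambda>x. a * x mod W) (\<lambda>t. t \<in> set_decode adv) Bt)) (set_decode C) w (2 * k))"

definition ready :: "(nat \<Rightarrow> nat \<Rightarrow> bool) \<Rightarrow> store \<Rightarrow> bool" where
  "ready x \<sigma> \<longleftrightarrow> consts_ok (\<sigma> 11) \<and> pow_ok (\<sigma> 5) \<and> rep_ok x (\<sigma> 4)"

lemma ready_unchanged:
  assumes "ready x \<sigma>" "11 \<notin> writes c" "5 \<notin> writes c" "4 \<notin> writes c"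
  shows "ready x (run L inp \<rho> c \<sigma>)"
  using assms unfolding ready_def by (simp add: run_unchanged)

lemma try_one_ok:
  fixes \<rho> :: env and \<sigma> :: store
  assumes \<rho>: "env_ok \<rho>" "\<rho> 2 < W" "\<rho> 3 < 2 ^ Bt" and r: "ready x \<sigma>"
  defines "\<sigma>' \<equiv> run L inp \<rho> (init_colouring ;; do_colouring ;; fill_table ;; collect) \<sigma>"
  shows "ready x \<sigma>' \<and> (\<sigma>' 10 0 \<noteq> 0 \<longleftrightarrow> \<sigma> 10 0 \<noteq> 0 \<or> accepts x (\<rho> 2) (\<rho> 3))"
proof -
  define \<sigma>1 where "\<sigma>1 = run L inp \<rho> init_colouring \<sigma>"
  define \<sigma>2 where "\<sigma>2 = run L inp \<rho> do_colouring \<sigma>1"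
  define \<sigma>3 where "\<sigma>3 = run L inp \<rho> fill_table \<sigma>2"
  have \<sigma>': "\<sigma>' = run L inp \<rho> collect \<sigma>3" by (simp add: \<sigma>'_def \<sigma>1_def \<sigma>2_def \<sigma>3_def)
  have wr: "writes init_colouring = {6, 7, 8}" "writes do_colouring = {6, 7, 8}" "writes fill_table = {9}"
    "writes collect = {10}"
    by (auto simp: init_colouring_def do_colouring_def do_split_def fill_table_def collect_def)
  have r1: "ready x \<sigma>1" unfolding \<sigma>1_def by (rule ready_unchanged[OF r]) (simp_all add: wr)
  have r2: "ready x \<sigma>2" unfolding \<sigma>2_def by (rule ready_unchanged[OF r1]) (simp_all add: wr)
  have r3: "ready x \<sigma>3" unfolding \<sigma>3_def by (rule ready_unchanged[OF r2]) (simp_all add: wr)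
  have r': "ready x \<sigma>'" unfolding \<sigma>' by (rule ready_unchanged[OF r3]) (simp_all add: wr)
  have s10: "\<sigma>3 10 = \<sigma> 10"
    unfolding \<sigma>3_def \<sigma>2_def \<sigma>1_def by (simp add: run_unchanged wr)
  let ?T = "\<lambda>t. t \<in> set_decode (\<rho> 3)"
  define s where "s = colouring W (\<lambda>x. \<rho> 2 * x mod W) ?T Bt"
  have c1: "col_state \<sigma>1 (colouring W (\<lambda>x. \<rho> 2 * x mod W) ?T 0)"
    unfolding \<sigma>1_def using r \<rho> by (intro init_colouring_ok) (auto simp: ready_def)
  have c2: "col_state \<sigma>2 s"
    unfolding \<sigma>2_def s_def using r1 \<rho> c1 by (intro do_colouring_ok) (auto simp: ready_def)
  have colNC: "fst s v < NC" for v
    using colouring_bound[of W "\<lambda>x. \<rho> 2 * x mod W" ?T Bt v] unfolding s_def NC_def by linarith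
  have tab: "\<forall>C<2 ^ NC. \<forall>w<V. \<forall>e<K. \<sigma>3 9 (cell C w e) =
      of_bool (reach V (root_edge x) (fst s) (set_decode C) w e)"
    unfolding \<sigma>3_def using \<rho>(1) r2 c2 colNC
    by (intro fill_table_ok) (auto simp: ready_def col_state_def)
  have k3: "consts_ok (\<sigma>3 11)" "\<sigma>3 11 4 = NC" "\<sigma>3 11 5 = V" "\<sigma>3 5 NC = 2 ^ NC"
    using r3 by (simp_all add: ready_def consts_ok_def pow_ok_def)
  have NCL: "(2::nat) ^ NC \<le> L"
  proof -
    have "(2::nat) ^ NC \<le> 2 ^ (NC + 2)" by (intro power_increasing) auto
    then show ?thesis using L_bounds(13) by linarith
  qed
  let ?e = "ExE 4 (Arr 5 (con 4)) (ExE 5 (con 5) (cellE (Var 4) (Var 5) (Plus (Var 1) (Var 1))))"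
  have "eval L inp \<sigma>3 \<rho> ?e = of_bool (accepts x (\<rho> 2) (\<rho> 3))"
  proof -
    have 1: "eval L inp \<sigma>3 (\<rho>(4 := C, 5 := w)) (cellE (Var 4) (Var 5) (Plus (Var 1) (Var 1))) \<noteq> 0 \<longleftrightarrow>
      reach V (root_edge x) (fst s) (set_decode C) w (2 * k)" if "C < 2 ^ NC" "w < V" for C w
    proof -
      have "eval L inp \<sigma>3 (\<rho>(4 := C, 5 := w)) (cellE (Var 4) (Var 5) (Plus (Var 1) (Var 1))) =
        \<sigma>3 9 (cell C w (2 * k))"
        using k3(1) that \<rho>(1) by (subst eval_cellE) (simp_all add: cell_def env_ok_def mult_2)
      moreover have "2 * k < K" by (simp add: K_def)
      ultimately show ?thesis using tab that by simp
    qed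
    have 2: "eval L inp \<sigma>3 (\<rho>(4 := C)) (ExE 5 (con 5) (cellE (Var 4) (Var 5) (Plus (Var 1) (Var 1)))) \<noteq> 0 \<longleftrightarrow>
      (\<exists>w<V. reach V (root_edge x) (fst s) (set_decode C) w (2 * k))" if "C < 2 ^ NC" for C
    proof -
      have "eval L inp \<sigma>3 (\<rho>(4 := C)) (ExE 5 (con 5) (cellE (Var 4) (Var 5) (Plus (Var 1) (Var 1)))) \<noteq> 0 \<longleftrightarrow>
        (\<exists>w<V. eval L inp \<sigma>3 (\<rho>(4 := C, 5 := w)) (cellE (Var 4) (Var 5) (Plus (Var 1) (Var 1))) \<noteq> 0)"
        using k3 L_bounds(4) by (subst eval_ExE) simp_all
      then show ?thesis using 1[OF that] by blast
    qed
    have "eval L inp \<sigma>3 \<rho> ?e = of_bool (\<exists>C<2 ^ NC. eval L inp \<sigma>3 (\<rho>(4 := C))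
        (ExE 5 (con 5) (cellE (Var 4) (Var 5) (Plus (Var 1) (Var 1)))) \<noteq> 0)"
      using k3 NCL by (subst eval_ExE) simp_all
    also have "\<dots> = of_bool (accepts x (\<rho> 2) (\<rho> 3))"
      unfolding accepts_def s_def[symmetric] using 2 by (intro arg_cong[of _ _ of_bool]) blast
    finally show ?thesis .
  qed
  then have "\<sigma>' 10 0 = \<sigma> 10 0 + of_bool (accepts x (\<rho> 2) (\<rho> 3))"
    unfolding \<sigma>' collect_def by (simp add: s10)
  then show ?thesis using r' by auto
qed

lemma try_all_ok:
  assumes \<rho>: "env_ok \<rho>" and r: "ready x \<sigma>" and "\<sigma> 10 0 = 0"
  shows "run L inp \<rho> try_all \<sigma> 10 0 \<noteq> 0 \<longleftrightarrow> (\<exists>a<W. \<exists>adv<2 ^ Bt. accepts x a adv)"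
proof -
  let ?b = "init_colouring ;; do_colouring ;; fill_table ;; collect"
  let ?P = "\<lambda>a b (\<sigma>' :: store). ready x \<sigma>' \<and> (\<sigma>' 10 0 \<noteq> 0 \<longleftrightarrow>
    (\<exists>a'<a. \<exists>adv<2 ^ Bt. accepts x a' adv) \<or> (\<exists>adv<b. accepts x a adv))"
  have BtL: "(2::nat) ^ Bt \<le> L"
  proof -
    have "(2::nat) ^ Bt \<le> 2 ^ (NC + 2)" by (intro power_increasing) (auto simp: NC_def)
    then show ?thesis using L_bounds(13) by linarith
  qed
  show ?thesis
    unfolding try_all_def
  proof (rule run_For_inv[where P = "\<lambda>a. ?P a 0" and b = W])
    show "?P 0 0 \<sigma>" using assms by simp
    show "eval L inp \<sigma> \<rho> (con 2) = W" using r by (simp add: ready_def consts_ok_def)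
  next
    fix a \<sigma>1 assume a: "a < W" and P1: "?P a 0 \<sigma>1"
    show "?P (Suc a) 0 (run L inp (\<rho>(2 := a)) (For 3 (Arr 5 (con 3)) ?b) \<sigma>1)"
    proof (rule run_For_inv[where P = "?P a" and b = "2 ^ Bt"])
      show "eval L inp \<sigma>1 (\<rho>(2 := a)) (Arr 5 (con 3)) = 2 ^ Bt"
        using P1 by (simp add: ready_def consts_ok_def pow_ok_def NC_def)
    next
      fix adv \<sigma>2 assume adv: "adv < 2 ^ Bt" and P2: "?P a adv \<sigma>2"
      have "ready x (run L inp (\<rho>(2 := a, 3 := adv)) ?b \<sigma>2) \<and>
        (run L inp (\<rho>(2 := a, 3 := adv)) ?b \<sigma>2 10 0 \<noteq> 0 \<longleftrightarrow> \<sigma>2 10 0 \<noteq> 0 \<or> accepts x a adv)"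
        using try_one_ok[of "\<rho>(2 := a, 3 := adv)" x \<sigma>2] \<rho> a adv P2 by simp
      then show "?P a (Suc adv) (run L inp (\<rho>(2 := a, 3 := adv)) ?b \<sigma>2)"
        using P2 by (auto simp: less_Suc_eq simp del: run.simps)
    next
      fix \<sigma>2 assume "?P a (2 ^ Bt) \<sigma>2"
      then show "?P (Suc a) 0 \<sigma>2" by (auto simp: less_Suc_eq)
    qed (use P1 BtL in auto)
  qed (use L_bounds in auto)
qed

text \<open>Acceptance under any colouring is sound, as different colours force different vertices.
  Completeness needs a single colouring that is injective on the at most \<open>3 * k\<close>
  vertices of one forest.\<close>

lemma accepts_iff_acyclic_matching:
  assumes x: "root_system G n x"
  shows "(\<exists>a<W. \<exists>adv<2 ^ Bt. accepts x a adv) \<longleftrightarrow> (\<exists>M. acyclic_matching G M \<and> card M = k)"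
proof -
  interpret root_labelling G n V "ends G x"
    unfolding V_def by (rule root_labelling_ends[OF simple verts_G x])
  have E: "root_edge x = E" by (simp add: fun_eq_iff root_edge_def E_def)
  show ?thesis
  proof
    assume "\<exists>a<W. \<exists>adv<2 ^ Bt. accepts x a adv"
    then show "\<exists>M. acyclic_matching G M \<and> card M = k"
      unfolding accepts_def E using reach_sound by blast
  next
    assume "\<exists>M. acyclic_matching G M \<and> card M = k"
    then obtain M where M: "acyclic_matching G M" "card M = k" by blast
    let ?S = "\<Union>(ends G x ` \<Union>M)"
    have match: "matching G M" using M(1) by (simp add: acyclic_matching_def)
    have e: "e \<subseteq> {..<n} \<and> card e = 2" if "e \<in> M" for e
      using that match simple verts_G unfolding matching_def simple_graph_def by auto
    have SV: "?S \<subseteq> {..<V}"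
    proof -
      have "ends G x u \<subseteq> {..<V}" if "u \<in> \<Union>M" for u using that e en_bound by blast
      then show ?thesis by blast
    qed
    have "?S \<noteq> {}"
    proof -
      have "M \<noteq> {}" using M(2) k1 by auto
      then obtain e where "e \<in> M" by blast
      moreover from this have "e \<noteq> {}" using e by fastforce
      moreover have "ends G x u \<noteq> {}" for u by (simp add: ends_def)
      ultimately show ?thesis by blast
    qed
    moreover have "36 * (3 * k) + 7 \<le> Bt" by (simp add: Bt_def)
    ultimately obtain a T where a: "a < W" and inj: "inj_on (fst (colouring W (\<lambda>x. a * x mod W) T Bt)) ?S"
      using colouring_injective[OF SV _ card_root_vertices[OF match M(2) k1] W_def] by blast
    \<comment> \<open>Only the first \<open>Bt\<close> decisions of \<open>T\<close> are consulted,
      so they can be packed into a number below \<open>2 ^ Bt\<close>.\<close>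
    define adv where "adv = set_encode {t. t < Bt \<and> T t}"
    have adv: "adv < 2 ^ Bt" unfolding adv_def by (rule set_encode_less) auto
    define col where "col = fst (colouring W (\<lambda>x. a * x mod W) (\<lambda>t. t \<in> set_decode adv) Bt)"
    have "colouring W (\<lambda>x. a * x mod W) T Bt = colouring W (\<lambda>x. a * x mod W) (\<lambda>t. t \<in> set_decode adv) Bt"
      by (rule colouring_cong) (simp add: adv_def)
    then have "inj_on col ?S" using inj by (simp add: col_def)
    from reach_complete[OF M k1 this] obtain Z w
      where Z: "Z \<subseteq> ?S" "w \<in> Z" "reach V E col (col ` Z) w (2 * k)" by blast
    have finZ: "finite Z" using Z(1) SV by (meson finite_lessThan finite_subset)
    have "col v < NC" for v
      using colouring_bound[of W "\<lambda>x. a * x mod W" "\<lambda>t. t \<in> set_decode adv" Bt v]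
      unfolding col_def NC_def by linarith
    then have "set_encode (col ` Z) < 2 ^ NC" using finZ by (intro set_encode_less) auto
    moreover have "set_decode (set_encode (col ` Z)) = col ` Z" using finZ by simp
    moreover have "w < V" using Z(1,2) SV by blast
    ultimately have "accepts x a adv"
      unfolding accepts_def col_def[symmetric] E using Z(3) by metis
    then show "\<exists>a<W. \<exists>adv<2 ^ Bt. accepts x a adv" using a adv by blast
  qed
qed

lemma decide_ok:
  assumes "is_line_graph G" "env_ok \<rho>"
  shows "run L inp \<rho> decide (\<lambda>_ _. 0) 10 0 \<noteq> 0 \<longleftrightarrow> (\<exists>M. acyclic_matching G M \<and> card M = k)"
proof -
  \<comment> \<open>\<open>x0\<close> comes from the unknown root graph and only certifies that the
    system is solvable; the program works with its own solution \<open>x\<close>.\<close>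
  obtain x0 where x0: "root_system G n x0" using line_graph_root_system[OF simple verts_G assms(1)] by blast
  define \<sigma>1 where "\<sigma>1 = run L inp \<rho> set_constants (\<lambda>_ _. 0)"
  define \<sigma>2 where "\<sigma>2 = run L inp \<rho> init_rows \<sigma>1"
  define \<sigma>3 where "\<sigma>3 = run L inp \<rho> eliminate \<sigma>2"
  define \<sigma>4 where "\<sigma>4 = run L inp \<rho> compute_rep \<sigma>3"
  define \<sigma>5 where "\<sigma>5 = run L inp \<rho> compute_pow2 \<sigma>4"
  define x where "x = (\<lambda>u v. rows \<sigma>3 (u * n + v) N)"
  have run: "run L inp \<rho> decide (\<lambda>_ _. 0) = run L inp \<rho> try_all \<sigma>5"
    by (simp only: decide_def run.simps(2) \<sigma>1_def \<sigma>2_def \<sigma>3_def \<sigma>4_def \<sigma>5_def)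
  have wr: "writes set_constants = {11}" "writes init_rows = {0}" "writes eliminate = {0, 1, 2, 3}"
    "writes compute_rep = {4}" "writes compute_pow2 = {5}"
    by (auto simp: com_defs)
  have c1: "consts_ok (\<sigma>1 11)" unfolding \<sigma>1_def by (rule set_constants_ok[OF assms(2)])
  note rows2 = init_rows_ok[where \<sigma> = \<sigma>1, OF assms(2) c1, folded \<sigma>2_def]
  have rows3: "rows_ok \<sigma>3 \<and> root_system G n x"
    unfolding \<sigma>3_def x_def by (rule eliminate_ok[OF assms(2) rows2 x0])
  have rep4: "rep_ok x (\<sigma>4 4)"
    unfolding \<sigma>4_def rep_ok_def x_def using compute_rep_ok[OF assms(2)] rows3 by blast
  have c4: "consts_ok (\<sigma>4 11)"
    unfolding \<sigma>4_def using rows3 by (simp add: run_unchanged wr rows_ok_def)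
  have "ready x \<sigma>5"
    unfolding ready_def using c4 rep4 compute_pow2_ok[where \<sigma> = \<sigma>4, OF c4]
    by (simp add: \<sigma>5_def run_unchanged wr)
  moreover have "\<sigma>5 10 0 = 0"
    unfolding \<sigma>5_def \<sigma>4_def \<sigma>3_def \<sigma>2_def \<sigma>1_def by (simp add: run_unchanged wr)
  ultimately show ?thesis
    unfolding run using try_all_ok[OF assms(2)] accepts_iff_acyclic_matching rows3 by blast
qed

end

text \<open>From \<open>2 * n + 4 \<le> 4 * (n + 1)\<close> the sixth power contributes 12 to the
  exponent of 2, giving \<open>216 * k + 29\<close>, at most \<open>245 * k\<close> because
  \<open>k\<close> is positive. This is the origin of 245.\<close>

lemma clamp_large:
  fixes n k :: nat
  assumes "1 \<le> k"
  shows "2 ^ (216 * k + 17) * (2 * n + 4) ^ 6 \<le> (2 ^ k * (n + 1)) ^ (245::nat)"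
proof -
  have "(2 * n + 4) ^ 6 \<le> (2 ^ 2 * (n + 1)) ^ 6" by (rule power_mono) simp_all
  also have "\<dots> = 2 ^ 12 * (n + 1) ^ 6" by (simp only: power_mult_distrib power_mult[symmetric]) simp
  finally have "2 ^ (216 * k + 17) * (2 * n + 4) ^ 6 \<le> 2 ^ (216 * k + 17) * (2 ^ 12 * (n + 1) ^ 6)"
    by (rule mult_le_mono2)
  also have "\<dots> = 2 ^ (216 * k + 29) * (n + 1) ^ 6" by (simp add: power_add mult.assoc)
  also have "\<dots> \<le> 2 ^ (k * 245) * (n + 1) ^ 245"
    using assms by (intro mult_le_mono power_increasing) auto
  also have "\<dots> = (2 ^ k * (n + 1)) ^ 245" by (simp only: power_mult_distrib power_mult)
  finally show ?thesis .
qed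

theorem theorem7:
  "\<exists>(P :: prog) (c :: nat) (d :: nat).
     \<forall>(G :: nat ugraph) (n :: nat) (k :: nat).
       simple_graph G \<longrightarrow> verts G = {..<n} \<longrightarrow> is_line_graph G \<longrightarrow> 1 \<le> k \<longrightarrow>
         answers_within P G k (\<exists>M. acyclic_matching G M \<and> card M = k)
           (2 ^ (c * k) * max 1 n ^ d)"
proof -
  obtain P C D where P: "\<And>n k M. (\<forall>i\<ge>n * n. M i = 0) \<Longrightarrow>
    within P (C * (2 ^ k * (n + 1)) ^ D)
      (\<lambda>s. fst s 0 = eval ((2 ^ k * (n + 1)) ^ 245) M
        (run ((2 ^ k * (n + 1)) ^ 245) M (init_env n k) decide (\<lambda>_ _. 0)) (init_env n k) (NzE (Arr 10 (Num 0))))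
      ((\<lambda>_. 0)(0 := n, 1 := k), M)"
    using compile_program[OF arrays_decide, of 245] unfolding Let_def by blast
  have "answers_within P G k (\<exists>M. acyclic_matching G M \<and> card M = k)
      (2 ^ ((C + 2 * D) * k) * max 1 n ^ D)"
    if G: "simple_graph G" "verts G = {..<n}" "is_line_graph G" and k: "1 \<le> k" for G n k
  proof -
    define L where "L = (2 ^ k * (n + 1)) ^ 245"
    define mem where "mem a = (if a < n * n \<and> {a div n, a mod n} \<in> edges G then 1 else 0 :: nat)" for a
    have input: "input_state G k = ((\<lambda>_. 0)(0 := n, 1 := k), mem)"
      using G(2) by (simp add: input_state_def mem_def fun_eq_iff)
    interpret decide_run G n k L mem
    proof
      show "mem (u * n + v) = of_bool (adjacent G u v)" if "u < n" "v < n" for u v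
        using mixed_radix_less[OF that] that by (simp add: mem_def adjacent_def)
      show "2 ^ (216 * k + 17) * (2 * n + 4) ^ 6 \<le> L" unfolding L_def by (rule clamp_large[OF k])
    qed (use G k in auto)
    let ?b = "\<exists>M. acyclic_matching G M \<and> card M = k"
    have "env_ok (init_env n k)" by (simp add: env_ok_def init_env_def)
    from decide_ok[OF G(3) this]
    have res: "eval L mem (run L mem (init_env n k) decide (\<lambda>_ _. 0)) (init_env n k) (NzE (Arr 10 (Num 0))) =
        (if ?b then 1 else 0)"
      by (simp add: eval_NzE)
    have "\<forall>i\<ge>n * n. mem i = 0" by (simp add: mem_def)
    from P[OF this, of k] obtain t s where ts: "exec P (input_state G k) t s"
      "t \<le> C * (2 ^ k * (n + 1)) ^ D" "fst s 0 = (if ?b then 1 else 0)"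
      unfolding within_def L_def[symmetric] res input[symmetric] by blast
    let ?m = "max 1 n"
    \<comment> \<open>As \<open>k\<close> is positive, constant factors disappear in powers of
      \<open>2 ^ k\<close>: both \<open>C\<close> here and the factor 2 in
      \<open>n + 1 \<le> 2 * max 1 n\<close> below.\<close>
    have "C \<le> 2 ^ (C * k)"
    proof -
      have "C \<le> 2 ^ C" by simp
      also have "\<dots> \<le> 2 ^ (C * k)" using k by (intro power_increasing) auto
      finally show ?thesis .
    qed
    moreover have "(2 ^ k * (n + 1)) ^ D \<le> 2 ^ (2 * D * k) * ?m ^ D"
    proof -
      have "n + 1 \<le> 2 * ?m" by simp
      also have "\<dots> \<le> 2 ^ k * ?m" using k power_increasing[of 1 k "2::nat"] by (intro mult_le_mono1) simp
      finally have "2 ^ k * (n + 1) \<le> 2 ^ k * (2 ^ k * ?m)" by (rule mult_le_mono2)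
      also have "\<dots> = 2 ^ (2 * k) * ?m" by (simp add: mult_2 power_add mult.assoc)
      finally have "(2 ^ k * (n + 1)) ^ D \<le> (2 ^ (2 * k) * ?m) ^ D" by (rule power_mono) simp
      also have "\<dots> = 2 ^ (2 * D * k) * ?m ^ D"
        by (simp add: power_mult_distrib power_mult[symmetric] mult_ac)
      finally show ?thesis .
    qed
    ultimately have "C * (2 ^ k * (n + 1)) ^ D \<le> 2 ^ (C * k) * (2 ^ (2 * D * k) * ?m ^ D)"
      by (rule mult_le_mono)
    also have "\<dots> = 2 ^ ((C + 2 * D) * k) * ?m ^ D" by (simp add: add_mult_distrib power_add mult.assoc)
    finally show ?thesis unfolding answers_within_def using ts le_trans by blast
  qed
  then show ?thesis by blast
qed

end
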